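(* Let $\mathcal{C}'$ be a triangulated subcategory of a triangulated category $\mathcal{C}$. Assume that $w$ is a weight structure on $\mathcal{C}'$ that is orthogonal to a $t$-structure $t$ on $\mathcal{C}$, and $\mathcal{C}_{t=0}\subset\mathrm{Obj}\,\mathcal{C}'$. 1. Then there are enough projectives in $\underline{Ht}$; for any $M\in\mathcal{C}_{t=0}$ there exists an $\underline{Ht}$-epimorphism from $H_0^t(P)$ into $M$ for some $P\in\mathcal{C}'_{w=0}$; and the functor $H_0^t$ induces an equivalence of $\mathrm{Kar}(\underline{Hw})$ with the category of projective objects of $\underline{Ht}$. 2. Moreover, $\underline{Hw}$ is equivalent to the latter category whenever the category $\underline{Hw}$ is Karoubian. In particular, this is the case if the class $\mathrm{Obj}\,\mathcal{C}'$ is retraction-closed in $\mathcal{C}$ and $\mathcal{C}$ is Karoubian. 3. Assume in addition that $t$ is left non-degenerate, i.e. $\bigcap_{i\in\mathbb{Z}}\mathcal{C}_{t\ge i}=\{0\}$. Then $t$ is $+$-orthogonal to $w$; hence $\mathcal{C}_{t\le 0}$ is closed with respect to $\mathcal{C}$-products.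
   Context: Conventions: all products are small; subcategories are strictly full; $X\perp Y$ means $\mathcal{C}(X,Y)=\{0\}$; for classes of objects, $D\perp E$ means $X\perp Y$ for all $X\in D$, $Y\in E$; $D^{\perp}=\{Y\in\mathrm{Obj}\,\mathcal{C}:\ X\perp Y\ \forall X\in D\}$. An additive category is Karoubian if every idempotent endomorphism yields a direct sum decomposition; $\mathrm{Kar}(-)$ denotes the Karoubi envelope (idempotent completion). A class of objects is retraction-closed in $\mathcal{C}$ if it contains all $\mathcal{C}$-retracts of its elements. A weight structure $w=(\mathcal{C}'_{w\le 0},\mathcal{C}'_{w\ge 0})$ on $\mathcal{C}'$ is a pair of classes of objects closed under retracts in $\mathcal{C}'$ such that $\mathcal{C}'_{w\le 0}\subset \mathcal{C}'_{w\le 0}[1]$, $\mathcal{C}'_{w\ge 0}[1]\subset \mathcal{C}'_{w\ge 0}$, $\mathcal{C}'_{w\le 0}\perp \mathcal{C}'_{w\ge 0}[1]$, and every object $M$ of $\mathcal{C}'$ fits into a distinguished triangle $L_wM\to M\to R_wM\to L_wM[1]$ with $L_wM\in \mathcal{C}'_{w\le 0}$, $R_wM\in\mathcal{C}'_{w\ge 0}[1]$. Write $\mathcal{C}'_{w=0}=\mathcal{C}'_{w\le 0}\cap \mathcal{C}'_{w\ge 0}$; the heart $\underline{Hw}$ is the corresponding full subcategory. A $t$-structure $t=(\mathcal{C}_{t\le 0},\mathcal{C}_{t\ge 0})$ on $\mathcal{C}$ (homological convention) is a pair of classes of objects closed under isomorphism such that $\mathcal{C}_{t\le 0}\subset \mathcal{C}_{t\le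 0}[1]$, $\mathcal{C}_{t\ge 0}[1]\subset \mathcal{C}_{t\ge 0}$, $\mathcal{C}_{t\ge 0}[1]\perp \mathcal{C}_{t\le 0}$, and every object $M$ fits into a distinguished triangle $L_tM\to M\to R_tM\to L_tM[1]$ with $L_tM\in \mathcal{C}_{t\ge 0}$, $R_tM\in\mathcal{C}_{t\le 0}[-1]$ (this triangle is functorial in $M$). Write $\mathcal{C}_{t\le i}=\mathcal{C}_{t\le 0}[i]$, $\mathcal{C}_{t\ge i}=\mathcal{C}_{t\ge 0}[i]$, $\mathcal{C}_{t=0}=\mathcal{C}_{t\le 0}\cap \mathcal{C}_{t\ge 0}$; the heart $\underline{Ht}$ is the corresponding full (abelian) subcategory. Put $t_{\ge 0}=L_t$, $t_{\le 0}=[1]\circ R_t\circ[-1]$; then $H_0^t=t_{\le 0}\circ t_{\ge 0}:\mathcal{C}\to\underline{Ht}$ is a homological functor. The structures $w$ and $t$ are orthogonal if $\mathcal{C}'_{w\le 0}\perp\mathcal{C}_{t\ge 1}$ and $\mathcal{C}'_{w\ge 0}\perp\mathcal{C}_{t\le -1}$; they are $+$-orthogonal if $\mathcal{C}_{t\ge 1}=(\mathcal{C}'_{w\le 0})^{\perp}$ (orthogonal taken in $\mathcal{C}$).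
   Formalization: Part 3 is false as printed (take C'=0, C_{t≥0}=0, C_{t≤0}=C), so left non-degeneracy is shown to give C_{t≤-1}=(C'_{w≥0})^⊥ and product closure of C_{t≤0}, while +-orthogonality is shown if instead the intersection of all C_{t≤i} is {0}. *)

theory Defs
  imports "HOL-Algebra.Group"
begin

section \<open>Categories, functors, equivalences\<close>

text \<open>
  Composition is written in the usual order: \<open>g \<bullet> f\<close> is "first f, then g".  The sets
  \<open>Hom C X Y\<close> are not required to be disjoint for different pairs of objects; this costs
  no generality and lets Karoubi envelopes reuse the morphisms of the original category.  All
  fields are meaningful only on objects of \<open>Obj C\<close>, so that a full subcategory is obtained
  by just replacing \<open>Obj C\<close>.
\<close>

record ('o, 'm) cat =
  Obj :: "'o set"
  Hom :: "'o \<Rightarrow> 'o \<Rightarrow> 'm set"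
  Idm :: "'o \<Rightarrow> 'm"
  Comp :: "'m \<Rightarrow> 'm \<Rightarrow> 'm"  (infixr \<open>\<bullet>\<index>\<close> 70)

locale category =
  fixes C :: "('o, 'm, 'z) cat_scheme" (structure)
  assumes id_in_hom: "X \<in> Obj C \<Longrightarrow> Idm C X \<in> Hom C X X"
    and comp_in_hom: "\<lbrakk>X \<in> Obj C; Y \<in> Obj C; Z \<in> Obj C; f \<in> Hom C X Y; g \<in> Hom C Y Z\<rbrakk>
      \<Longrightarrow> g \<bullet> f \<in> Hom C X Z"
    and comp_assoc: "\<lbrakk>X \<in> Obj C; Y \<in> Obj C; Z \<in> Obj C; W \<in> Obj C;
        f \<in> Hom C X Y; g \<in> Hom C Y Z; h \<in> Hom C Z W\<rbrakk> \<Longrightarrow> (h \<bullet> g) \<bullet> f = h \<bullet> (g \<bullet> f)"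
    and id_left: "\<lbrakk>X \<in> Obj C; Y \<in> Obj C; f \<in> Hom C X Y\<rbrakk> \<Longrightarrow> Idm C Y \<bullet> f = f"
    and id_right: "\<lbrakk>X \<in> Obj C; Y \<in> Obj C; f \<in> Hom C X Y\<rbrakk> \<Longrightarrow> f \<bullet> Idm C X = f"

definition full_sub :: "('o, 'm, 'z) cat_scheme \<Rightarrow> 'o set \<Rightarrow> ('o, 'm, 'z) cat_scheme" where
  "full_sub C D = C\<lparr>Obj := D\<rparr>"

definition is_iso :: "('o, 'm, 'z) cat_scheme \<Rightarrow> 'o \<Rightarrow> 'o \<Rightarrow> 'm \<Rightarrow> bool" where
  "is_iso C X Y f \<longleftrightarrow> f \<in> Hom C X Y \<and>
     (\<exists>g \<in> Hom C Y X. g \<bullet>\<^bsub>C\<^esub> f = Idm C X \<and> f \<bullet>\<^bsub>C\<^esub> g = Idm C Y)"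

definition iso_closed :: "('o, 'm, 'z) cat_scheme \<Rightarrow> 'o set \<Rightarrow> bool" where
  "iso_closed C D \<longleftrightarrow> (\<forall>X \<in> D. \<forall>Y \<in> Obj C. (\<exists>f. is_iso C X Y f) \<longrightarrow> Y \<in> D)"

definition retract :: "('o, 'm, 'z) cat_scheme \<Rightarrow> 'o \<Rightarrow> 'o \<Rightarrow> bool" where
  "retract C X Y \<longleftrightarrow> (\<exists>i \<in> Hom C X Y. \<exists>p \<in> Hom C Y X. p \<bullet>\<^bsub>C\<^esub> i = Idm C X)"

definition retraction_closed :: "('o, 'm, 'z) cat_scheme \<Rightarrow> 'o set \<Rightarrow> bool" where
  "retraction_closed C D \<longleftrightarrow> (\<forall>Y \<in> D. \<forall>X \<in> Obj C. retract C X Y \<longrightarrow> X \<in> D)"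

definition is_epi :: "('o, 'm, 'z) cat_scheme \<Rightarrow> 'o \<Rightarrow> 'o \<Rightarrow> 'm \<Rightarrow> bool" where
  "is_epi C X Y f \<longleftrightarrow> f \<in> Hom C X Y \<and>
     (\<forall>Z \<in> Obj C. \<forall>g \<in> Hom C Y Z. \<forall>h \<in> Hom C Y Z. g \<bullet>\<^bsub>C\<^esub> f = h \<bullet>\<^bsub>C\<^esub> f \<longrightarrow> g = h)"

definition projective :: "('o, 'm, 'z) cat_scheme \<Rightarrow> 'o \<Rightarrow> bool" where
  "projective C P \<longleftrightarrow> P \<in> Obj C \<and>
     (\<forall>X \<in> Obj C. \<forall>Y \<in> Obj C. \<forall>f g. is_epi C X Y f \<and> g \<in> Hom C P Y \<longrightarrow>
        (\<exists>h \<in> Hom C P X. f \<bullet>\<^bsub>C\<^esub> h = g))"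

definition Proj :: "('o, 'm, 'z) cat_scheme \<Rightarrow> ('o, 'm, 'z) cat_scheme" where
  "Proj C = full_sub C {P. projective C P}"

definition enough_projectives :: "('o, 'm, 'z) cat_scheme \<Rightarrow> bool" where
  "enough_projectives C \<longleftrightarrow> (\<forall>M \<in> Obj C. \<exists>P f. projective C P \<and> is_epi C P M f)"

definition is_product ::
  "('o, 'm, 'z) cat_scheme \<Rightarrow> 'i set \<Rightarrow> ('i \<Rightarrow> 'o) \<Rightarrow> 'o \<Rightarrow> ('i \<Rightarrow> 'm) \<Rightarrow> bool" where
  "is_product C I X P p \<longleftrightarrow> P \<in> Obj C \<and> (\<forall>i \<in> I. X i \<in> Obj C \<and> p i \<in> Hom C P (X i)) \<and>
     (\<forall>Q \<in> Obj C. \<forall>q. (\<forall>i \<in> I. q i \<in> Hom C Q (X i)) \<longrightarrow>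
        (\<exists>!f. f \<in> Hom C Q P \<and> (\<forall>i \<in> I. p i \<bullet>\<^bsub>C\<^esub> f = q i)))"

text \<open>As hom-sets may overlap, the morphism part of a functor also takes source and target.\<close>

record ('o, 'm, 'p, 'n) functor_data =
  FO :: "'o \<Rightarrow> 'p"
  FM :: "'o \<Rightarrow> 'o \<Rightarrow> 'm \<Rightarrow> 'n"

definition is_functor :: "('o, 'm, 'y) cat_scheme \<Rightarrow> ('p, 'n, 'z) cat_scheme
    \<Rightarrow> ('o, 'm, 'p, 'n) functor_data \<Rightarrow> bool" where
  "is_functor C D F \<longleftrightarrow>
     (\<forall>X \<in> Obj C. FO F X \<in> Obj D \<and> FM F X X (Idm C X) = Idm D (FO F X)) \<and>
     (\<forall>X \<in> Obj C. \<forall>Y \<in> Obj C. \<forall>f \<in> Hom C X Y. FM F X Y f \<in> Hom D (FO F X) (FO F Y)) \<and>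
     (\<forall>X \<in> Obj C. \<forall>Y \<in> Obj C. \<forall>Z \<in> Obj C. \<forall>f \<in> Hom C X Y. \<forall>g \<in> Hom C Y Z.
        FM F X Z (g \<bullet>\<^bsub>C\<^esub> f) = FM F Y Z g \<bullet>\<^bsub>D\<^esub> FM F X Y f)"

definition id_functor :: "('o, 'm, 'o, 'm) functor_data" where
  "id_functor = \<lparr>FO = \<lambda>X. X, FM = \<lambda>X Y f. f\<rparr>"

definition comp_functor :: "('p, 'n, 'q, 'l) functor_data \<Rightarrow> ('o, 'm, 'p, 'n) functor_data
    \<Rightarrow> ('o, 'm, 'q, 'l) functor_data"  (infixr \<open>\<circ>\<^sub>F\<close> 75) where
  "G \<circ>\<^sub>F F = \<lparr>FO = \<lambda>X. FO G (FO F X), FM = \<lambda>X Y f. FM G (FO F X) (FO F Y) (FM F X Y f)\<rparr>"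

definition naturally_isomorphic :: "('o, 'm, 'y) cat_scheme \<Rightarrow> ('p, 'n, 'z) cat_scheme
    \<Rightarrow> ('o, 'm, 'p, 'n) functor_data \<Rightarrow> ('o, 'm, 'p, 'n) functor_data \<Rightarrow> bool" where
  "naturally_isomorphic C D F G \<longleftrightarrow> is_functor C D F \<and> is_functor C D G \<and>
     (\<exists>\<eta>. (\<forall>X \<in> Obj C. is_iso D (FO F X) (FO G X) (\<eta> X)) \<and>
        (\<forall>X \<in> Obj C. \<forall>Y \<in> Obj C. \<forall>f \<in> Hom C X Y.
           \<eta> Y \<bullet>\<^bsub>D\<^esub> FM F X Y f = FM G X Y f \<bullet>\<^bsub>D\<^esub> \<eta> X))"

definition is_equivalence :: "('o, 'm, 'y) cat_scheme \<Rightarrow> ('p, 'n, 'z) cat_scheme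
    \<Rightarrow> ('o, 'm, 'p, 'n) functor_data \<Rightarrow> bool" where
  "is_equivalence C D F \<longleftrightarrow> is_functor C D F \<and>
     (\<exists>G. is_functor D C G \<and>
        naturally_isomorphic C C (G \<circ>\<^sub>F F) id_functor \<and>
        naturally_isomorphic D D (F \<circ>\<^sub>F G) id_functor)"

definition equivalent_categories ::
    "('o, 'm, 'y) cat_scheme \<Rightarrow> ('p, 'n, 'z) cat_scheme \<Rightarrow> bool" where
  "equivalent_categories C D \<longleftrightarrow> (\<exists>F. is_equivalence C D F)"

definition Kar :: "('o, 'm, 'z) cat_scheme \<Rightarrow> ('o \<times> 'm, 'm) cat" where
  "Kar C = \<lparr>Obj = {(X, e). X \<in> Obj C \<and> e \<in> Hom C X X \<and> e \<bullet>\<^bsub>C\<^esub> e = e},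
     Hom = \<lambda>(X, e) (Y, e'). {f \<in> Hom C X Y. e' \<bullet>\<^bsub>C\<^esub> f \<bullet>\<^bsub>C\<^esub> e = f},
     Idm = \<lambda>(X, e). e, Comp = Comp C\<rparr>"

definition kar_embedding :: "('o, 'm, 'z) cat_scheme \<Rightarrow> ('o, 'm, 'o \<times> 'm, 'm) functor_data" where
  "kar_embedding C = \<lparr>FO = \<lambda>X. (X, Idm C X), FM = \<lambda>X Y f. f\<rparr>"

section \<open>Additive categories\<close>

record ('o, 'm) addcat = "('o, 'm) cat" +
  Zero :: "'o \<Rightarrow> 'o \<Rightarrow> 'm"
  Add :: "'m \<Rightarrow> 'm \<Rightarrow> 'm"

definition hom_group :: "('o, 'm, 'z) addcat_scheme \<Rightarrow> 'o \<Rightarrow> 'o \<Rightarrow> 'm monoid" where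
  "hom_group C X Y = \<lparr>carrier = Hom C X Y, mult = Add C, one = Zero C X Y\<rparr>"

definition is_zero_object :: "('o, 'm, 'z) cat_scheme \<Rightarrow> 'o \<Rightarrow> bool" where
  "is_zero_object C Z \<longleftrightarrow> Z \<in> Obj C \<and>
     (\<forall>X \<in> Obj C. (\<exists>!f. f \<in> Hom C X Z) \<and> (\<exists>!f. f \<in> Hom C Z X))"

definition is_direct_sum :: "('o, 'm, 'z) addcat_scheme \<Rightarrow> 'o \<Rightarrow> 'o \<Rightarrow> 'o
    \<Rightarrow> 'm \<Rightarrow> 'm \<Rightarrow> 'm \<Rightarrow> 'm \<Rightarrow> bool" where
  "is_direct_sum C B X Y i j p q \<longleftrightarrow>
     i \<in> Hom C X B \<and> j \<in> Hom C Y B \<and> p \<in> Hom C B X \<and> q \<in> Hom C B Y \<and>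
     p \<bullet>\<^bsub>C\<^esub> i = Idm C X \<and> q \<bullet>\<^bsub>C\<^esub> j = Idm C Y \<and> q \<bullet>\<^bsub>C\<^esub> i = Zero C X Y \<and> p \<bullet>\<^bsub>C\<^esub> j = Zero C Y X \<and>
     Add C (i \<bullet>\<^bsub>C\<^esub> p) (j \<bullet>\<^bsub>C\<^esub> q) = Idm C B"

locale additive_category = category C for C :: "('o, 'm, 'z) addcat_scheme" (structure) +
  assumes hom_comm_group: "\<lbrakk>X \<in> Obj C; Y \<in> Obj C\<rbrakk> \<Longrightarrow> comm_group (hom_group C X Y)"
    and add_comp_left: "\<lbrakk>X \<in> Obj C; Y \<in> Obj C; Z \<in> Obj C;
        f \<in> Hom C X Y; g \<in> Hom C Y Z; g' \<in> Hom C Y Z\<rbrakk>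
      \<Longrightarrow> Add C g g' \<bullet> f = Add C (g \<bullet> f) (g' \<bullet> f)"
    and add_comp_right: "\<lbrakk>X \<in> Obj C; Y \<in> Obj C; Z \<in> Obj C;
        f \<in> Hom C X Y; f' \<in> Hom C X Y; g \<in> Hom C Y Z\<rbrakk>
      \<Longrightarrow> g \<bullet> Add C f f' = Add C (g \<bullet> f) (g \<bullet> f')"
    and zero_object_ex: "\<exists>Z. is_zero_object C Z"
    and direct_sum_ex: "\<lbrakk>X \<in> Obj C; Y \<in> Obj C\<rbrakk>
      \<Longrightarrow> \<exists>B \<in> Obj C. \<exists>i j p q. is_direct_sum C B X Y i j p q"

definition karoubian :: "('o, 'm, 'z) addcat_scheme \<Rightarrow> bool" where
  "karoubian C \<longleftrightarrow> (\<forall>B \<in> Obj C. \<forall>e \<in> Hom C B B. e \<bullet>\<^bsub>C\<^esub> e = e \<longrightarrow>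
     (\<exists>X \<in> Obj C. \<exists>Y \<in> Obj C. \<exists>i j p q. is_direct_sum C B X Y i j p q \<and> e = i \<bullet>\<^bsub>C\<^esub> p))"

definition orth :: "('o, 'm, 'z) addcat_scheme \<Rightarrow> 'o set \<Rightarrow> 'o set \<Rightarrow> bool" where
  "orth C D E \<longleftrightarrow> (\<forall>X \<in> D. \<forall>Y \<in> E. Hom C X Y = {Zero C X Y})"

definition right_orth :: "('o, 'm, 'z) addcat_scheme \<Rightarrow> 'o set \<Rightarrow> 'o set" where
  "right_orth C D = {Y \<in> Obj C. \<forall>X \<in> D. Hom C X Y = {Zero C X Y}}"

section \<open>Triangulated categories\<close>

text \<open>
  \<open>ShO\<close> and \<open>ShM\<close> are the shift [1] on objects and on morphisms.  A tuple
  \<open>(X, Y, Z, f, g, h)\<close> in \<open>Tri\<close> is a distinguished triangle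
  \<open>X \<rightarrow> Y \<rightarrow> Z \<rightarrow> X[1]\<close> with maps f, g, h.
\<close>

record ('o, 'm) tricat = "('o, 'm) addcat" +
  ShO :: "'o \<Rightarrow> 'o"
  ShM :: "'m \<Rightarrow> 'm"
  Tri :: "('o \<times> 'o \<times> 'o \<times> 'm \<times> 'm \<times> 'm) set"

definition is_triangle :: "('o, 'm, 'z) tricat_scheme
    \<Rightarrow> 'o \<times> 'o \<times> 'o \<times> 'm \<times> 'm \<times> 'm \<Rightarrow> bool" where
  "is_triangle C = (\<lambda>(X, Y, Z, f, g, h). X \<in> Obj C \<and> Y \<in> Obj C \<and> Z \<in> Obj C \<and>
     f \<in> Hom C X Y \<and> g \<in> Hom C Y Z \<and> h \<in> Hom C Z (ShO C X))"

definition triangle_hom :: "('o, 'm, 'z) tricat_scheme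
    \<Rightarrow> 'o \<times> 'o \<times> 'o \<times> 'm \<times> 'm \<times> 'm \<Rightarrow> 'o \<times> 'o \<times> 'o \<times> 'm \<times> 'm \<times> 'm
    \<Rightarrow> 'm \<Rightarrow> 'm \<Rightarrow> 'm \<Rightarrow> bool" where
  "triangle_hom C = (\<lambda>(X, Y, Z, f, g, h) (X', Y', Z', f', g', h') a b c.
     a \<in> Hom C X X' \<and> b \<in> Hom C Y Y' \<and> c \<in> Hom C Z Z' \<and>
     b \<bullet>\<^bsub>C\<^esub> f = f' \<bullet>\<^bsub>C\<^esub> a \<and> c \<bullet>\<^bsub>C\<^esub> g = g' \<bullet>\<^bsub>C\<^esub> b \<and> ShM C a \<bullet>\<^bsub>C\<^esub> h = h' \<bullet>\<^bsub>C\<^esub> c)"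

definition triangle_iso :: "('o, 'm, 'z) tricat_scheme
    \<Rightarrow> 'o \<times> 'o \<times> 'o \<times> 'm \<times> 'm \<times> 'm \<Rightarrow> 'o \<times> 'o \<times> 'o \<times> 'm \<times> 'm \<times> 'm \<Rightarrow> bool" where
  "triangle_iso C = (\<lambda>(X, Y, Z, f, g, h) (X', Y', Z', f', g', h'). \<exists>a b c.
     triangle_hom C (X, Y, Z, f, g, h) (X', Y', Z', f', g', h') a b c \<and>
     is_iso C X X' a \<and> is_iso C Y Y' b \<and> is_iso C Z Z' c)"

text \<open>
  Verdier's axioms, the shift being an additive automorphism of the category; the last one is
  the octahedral axiom.
\<close>

locale triangulated_category = additive_category C
  for C :: "('o, 'm, 'z) tricat_scheme" (structure) +
  assumes shift_bij: "bij_betw (ShO C) (Obj C) (Obj C)"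
    and shift_hom_bij: "\<lbrakk>X \<in> Obj C; Y \<in> Obj C\<rbrakk>
      \<Longrightarrow> bij_betw (ShM C) (Hom C X Y) (Hom C (ShO C X) (ShO C Y))"
    and shift_id: "X \<in> Obj C \<Longrightarrow> ShM C (Idm C X) = Idm C (ShO C X)"
    and shift_comp: "\<lbrakk>X \<in> Obj C; Y \<in> Obj C; Z \<in> Obj C; f \<in> Hom C X Y; g \<in> Hom C Y Z\<rbrakk>
      \<Longrightarrow> ShM C (g \<bullet> f) = ShM C g \<bullet> ShM C f"
    and shift_add: "\<lbrakk>X \<in> Obj C; Y \<in> Obj C; f \<in> Hom C X Y; g \<in> Hom C X Y\<rbrakk>
      \<Longrightarrow> ShM C (Add C f g) = Add C (ShM C f) (ShM C g)"
    and tri_is_triangle: "T \<in> Tri C \<Longrightarrow> is_triangle C T"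
    and tri_iso_closed: "\<lbrakk>T \<in> Tri C; is_triangle C T'; triangle_iso C T T'\<rbrakk> \<Longrightarrow> T' \<in> Tri C"
    and tri_trivial: "\<lbrakk>X \<in> Obj C; is_zero_object C Z\<rbrakk>
      \<Longrightarrow> (X, X, Z, Idm C X, Zero C X Z, Zero C Z (ShO C X)) \<in> Tri C"
    and tri_cone_ex: "\<lbrakk>X \<in> Obj C; Y \<in> Obj C; f \<in> Hom C X Y\<rbrakk>
      \<Longrightarrow> \<exists>Z g h. (X, Y, Z, f, g, h) \<in> Tri C"
    and tri_rotate: "is_triangle C (X, Y, Z, f, g, h) \<Longrightarrow>
      (X, Y, Z, f, g, h) \<in> Tri C \<longleftrightarrow>
      (Y, Z, ShO C X, g, h, inv\<^bsub>hom_group C (ShO C X) (ShO C Y)\<^esub> (ShM C f)) \<in> Tri C"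
    and tri_morphism: "\<lbrakk>(X, Y, Z, f, g, h) \<in> Tri C; (X', Y', Z', f', g', h') \<in> Tri C;
        a \<in> Hom C X X'; b \<in> Hom C Y Y'; b \<bullet> f = f' \<bullet> a\<rbrakk>
      \<Longrightarrow> \<exists>c. triangle_hom C (X, Y, Z, f, g, h) (X', Y', Z', f', g', h') a b c"
    and tri_octahedron: "\<lbrakk>(X, Y, Z', f, f1, f2) \<in> Tri C; (Y, Z, X', g, g1, g2) \<in> Tri C;
        (X, Z, Y', g \<bullet> f, k1, k2) \<in> Tri C\<rbrakk>
      \<Longrightarrow> \<exists>u v. (Z', Y', X', u, v, ShM C f1 \<bullet> g2) \<in> Tri C \<and>
        u \<bullet> f1 = k1 \<bullet> g \<and> k2 \<bullet> u = f2 \<and> v \<bullet> k1 = g1 \<and> g2 \<bullet> v = ShM C f \<bullet> k2"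

definition shift_obj :: "('o, 'm, 'z) tricat_scheme \<Rightarrow> int \<Rightarrow> 'o \<Rightarrow> 'o" where
  "shift_obj C i = (if 0 \<le> i then ShO C ^^ nat i
     else inv_into (Obj C) (ShO C) ^^ nat (- i))"

text \<open>\<open>shift_class C i D\<close> is the class D[i].\<close>

definition shift_class :: "('o, 'm, 'z) tricat_scheme \<Rightarrow> int \<Rightarrow> 'o set \<Rightarrow> 'o set" where
  "shift_class C i D = shift_obj C i ` D"

definition shift_functor :: "('o, 'm, 'z) tricat_scheme \<Rightarrow> ('o, 'm, 'o, 'm) functor_data" where
  "shift_functor C = \<lparr>FO = ShO C, FM = \<lambda>X Y. ShM C\<rparr>"

definition unshift_functor :: "('o, 'm, 'z) tricat_scheme \<Rightarrow> ('o, 'm, 'o, 'm) functor_data" where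
  "unshift_functor C = \<lparr>FO = shift_obj C (-1),
     FM = \<lambda>X Y. inv_into (Hom C (shift_obj C (-1) X) (shift_obj C (-1) Y)) (ShM C)\<rparr>"

text \<open>Object classes of (strictly full) triangulated subcategories:\<close>

definition triangulated_subcategory :: "('o, 'm, 'z) tricat_scheme \<Rightarrow> 'o set \<Rightarrow> bool" where
  "triangulated_subcategory C D \<longleftrightarrow> D \<subseteq> Obj C \<and> iso_closed C D \<and>
     (\<exists>Z \<in> D. is_zero_object C Z) \<and> shift_class C 1 D \<subseteq> D \<and> shift_class C (-1) D \<subseteq> D \<and>
     (\<forall>X Y Z f g h. (X, Y, Z, f, g, h) \<in> Tri C \<and> X \<in> D \<and> Y \<in> D \<longrightarrow> Z \<in> D)"

definition full_tri_sub ::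
    "('o, 'm, 'z) tricat_scheme \<Rightarrow> 'o set \<Rightarrow> ('o, 'm, 'z) tricat_scheme" where
  "full_tri_sub C D = (full_sub C D)
     \<lparr>Tri := {(X, Y, Z, f, g, h). (X, Y, Z, f, g, h) \<in> Tri C \<and> X \<in> D \<and> Y \<in> D \<and> Z \<in> D}\<rparr>"

section \<open>Weight structures and t-structures\<close>

definition weight_structure :: "('o, 'm, 'z) tricat_scheme \<Rightarrow> 'o set \<Rightarrow> 'o set \<Rightarrow> bool" where
  "weight_structure C Wle Wge \<longleftrightarrow> Wle \<subseteq> Obj C \<and> Wge \<subseteq> Obj C \<and>
     retraction_closed C Wle \<and> retraction_closed C Wge \<and>
     Wle \<subseteq> shift_class C 1 Wle \<and> shift_class C 1 Wge \<subseteq> Wge \<and>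
     orth C Wle (shift_class C 1 Wge) \<and>
     (\<forall>M \<in> Obj C. \<exists>L \<in> Wle. \<exists>R \<in> shift_class C 1 Wge. \<exists>l r d. (L, M, R, l, r, d) \<in> Tri C)"

definition t_decomposition :: "('o, 'm, 'z) tricat_scheme \<Rightarrow> 'o set \<Rightarrow> 'o set \<Rightarrow> 'o
    \<Rightarrow> 'o \<times> 'o \<times> 'm \<times> 'm \<times> 'm \<Rightarrow> bool" where
  "t_decomposition C Tle Tge M = (\<lambda>(L, R, l, r, d).
     L \<in> Tge \<and> R \<in> shift_class C (-1) Tle \<and> (L, M, R, l, r, d) \<in> Tri C)"

definition t_structure :: "('o, 'm, 'z) tricat_scheme \<Rightarrow> 'o set \<Rightarrow> 'o set \<Rightarrow> bool" where
  "t_structure C Tle Tge \<longleftrightarrow> Tle \<subseteq> Obj C \<and> Tge \<subseteq> Obj C \<and>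
     iso_closed C Tle \<and> iso_closed C Tge \<and>
     Tle \<subseteq> shift_class C 1 Tle \<and> shift_class C 1 Tge \<subseteq> Tge \<and>
     orth C (shift_class C 1 Tge) Tle \<and>
     (\<forall>M \<in> Obj C. \<exists>T. t_decomposition C Tle Tge M T)"

text \<open>
  The heart of either kind of structure is the full subcategory on the intersection of its two
  classes.
\<close>

definition heart :: "('o, 'm, 'z) cat_scheme \<Rightarrow> 'o set \<Rightarrow> 'o set \<Rightarrow> ('o, 'm, 'z) cat_scheme" where
  "heart C Dle Dge = full_sub C (Dle \<inter> Dge)"

text \<open>
  The functors \<open>L\<^sub>t\<close> and \<open>R\<^sub>t\<close> are obtained from a choice of a decomposition triangle for each
  object; on morphisms they are determined by commutation with the maps \<open>L\<^sub>t M \<rightarrow> M \<rightarrow> R\<^sub>t M\<close>.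
\<close>

definition t_dec :: "('o, 'm, 'z) tricat_scheme \<Rightarrow> 'o set \<Rightarrow> 'o set \<Rightarrow> 'o
    \<Rightarrow> 'o \<times> 'o \<times> 'm \<times> 'm \<times> 'm" where
  "t_dec C Tle Tge M = (SOME T. t_decomposition C Tle Tge M T)"

definition Lt :: "('o, 'm, 'z) tricat_scheme \<Rightarrow> 'o set \<Rightarrow> 'o set
    \<Rightarrow> ('o, 'm, 'o, 'm) functor_data" where
  "Lt C Tle Tge = (
     let LO = (\<lambda>M. case t_dec C Tle Tge M of (L, R, l, r, d) \<Rightarrow> L);
         lm = (\<lambda>M. case t_dec C Tle Tge M of (L, R, l, r, d) \<Rightarrow> l)
     in \<lparr>FO = LO,
         FM = \<lambda>M N f. THE g. g \<in> Hom C (LO M) (LO N) \<and> lm N \<bullet>\<^bsub>C\<^esub> g = f \<bullet>\<^bsub>C\<^esub> lm M\<rparr>)"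

definition Rt :: "('o, 'm, 'z) tricat_scheme \<Rightarrow> 'o set \<Rightarrow> 'o set
    \<Rightarrow> ('o, 'm, 'o, 'm) functor_data" where
  "Rt C Tle Tge = (
     let RO = (\<lambda>M. case t_dec C Tle Tge M of (L, R, l, r, d) \<Rightarrow> R);
         rm = (\<lambda>M. case t_dec C Tle Tge M of (L, R, l, r, d) \<Rightarrow> r)
     in \<lparr>FO = RO,
         FM = \<lambda>M N f. THE g. g \<in> Hom C (RO M) (RO N) \<and> g \<bullet>\<^bsub>C\<^esub> rm M = rm N \<bullet>\<^bsub>C\<^esub> f\<rparr>)"

definition H0 :: "('o, 'm, 'z) tricat_scheme \<Rightarrow> 'o set \<Rightarrow> 'o set
    \<Rightarrow> ('o, 'm, 'o, 'm) functor_data" where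
  "H0 C Tle Tge =
     (shift_functor C \<circ>\<^sub>F Rt C Tle Tge \<circ>\<^sub>F unshift_functor C) \<circ>\<^sub>F Lt C Tle Tge"

definition orthogonal_structures ::
    "('o, 'm, 'z) tricat_scheme \<Rightarrow> 'o set \<Rightarrow> 'o set \<Rightarrow> 'o set \<Rightarrow> 'o set \<Rightarrow> bool" where
  "orthogonal_structures C Wle Wge Tle Tge \<longleftrightarrow>
     orth C Wle (shift_class C 1 Tge) \<and> orth C Wge (shift_class C (-1) Tle)"

text \<open>
  In the homological convention, non-degeneracy on the side of \<open>Tge\<close> (called left here) is what
  forces minus-orthogonality, whereas plus-orthogonality needs it on the side of \<open>Tle\<close>: for
  zero weight classes and \<open>Tge\<close> the class of zero objects, \<open>Tle = Obj C\<close>, the former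
  condition holds and plus-orthogonality fails as soon as \<open>C\<close> has a non-zero object.
\<close>

definition plus_orthogonal :: "('o, 'm, 'z) tricat_scheme \<Rightarrow> 'o set \<Rightarrow> 'o set \<Rightarrow> bool" where
  "plus_orthogonal C Wle Tge \<longleftrightarrow> shift_class C 1 Tge = right_orth C Wle"

definition minus_orthogonal :: "('o, 'm, 'z) tricat_scheme \<Rightarrow> 'o set \<Rightarrow> 'o set \<Rightarrow> bool" where
  "minus_orthogonal C Wge Tle \<longleftrightarrow> shift_class C (-1) Tle = right_orth C Wge"

definition left_nondegenerate :: "('o, 'm, 'z) tricat_scheme \<Rightarrow> 'o set \<Rightarrow> bool" where
  "left_nondegenerate C Tge \<longleftrightarrow> (\<Inter>i. shift_class C i Tge) = {Z. is_zero_object C Z}"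

definition right_nondegenerate :: "('o, 'm, 'z) tricat_scheme \<Rightarrow> 'o set \<Rightarrow> bool" where
  "right_nondegenerate C Tle \<longleftrightarrow> (\<Inter>i. shift_class C i Tle) = {Z. is_zero_object C Z}"

end

theory Submission
  imports Defs
begin

text \<open>
  The whole argument rests on the observation that orthogonality alone transports the weight
  structure into the t-structure.  An object belongs to \<open>Tge\<close> as soon as it is left orthogonal to
  \<open>Tle[-1]\<close>, hence \<open>Wge \<subseteq> Tge\<close>; dually an object of \<open>D\<close> to which \<open>Wle[-1]\<close> is left orthogonal belongs
  to \<open>Wge\<close>, hence \<open>D \<inter> Tge \<subseteq> Wge\<close> (lemmas \<open>wge_tge\<close> and \<open>D_tge_wge\<close>).

  Let \<open>P\<close> lie in the heart of \<open>w\<close>.  Then \<open>P\<close> is in \<open>Tge\<close>, so \<open>H\<^sub>0 P\<close> is the truncation of \<open>P\<close> into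
  \<open>Tle\<close> and comes with a unit \<open>P \<rightarrow> H\<^sub>0 P\<close> whose fibre is in \<open>Tge[1]\<close>.  Maps out of \<open>H\<^sub>0 P\<close> into \<open>Tle\<close> are
  the same as maps out of \<open>P\<close>; and as \<open>P\<close> is left orthogonal to \<open>Tge[1]\<close>, maps from \<open>P\<close> into \<open>H\<^sub>0 Q\<close> are
  the same as maps into \<open>Q\<close>, for any \<open>Q\<close> in the heart of \<open>w\<close>.  Therefore \<open>H\<^sub>0\<close> is fully faithful on
  the heart of \<open>w\<close>.  Cokernels in the heart of \<open>t\<close> are truncations of cones, and the part of the
  cone that is cut off lies in \<open>Tge[1]\<close>, to which \<open>P\<close> has no non-zero maps; so maps from \<open>P\<close> lift
  along epimorphisms of the heart, which makes \<open>H\<^sub>0 P\<close> projective (lemmas \<open>heart_cokernel\<close> and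
  \<open>H0_projective\<close>).

  If \<open>M\<close> is in the heart of \<open>t\<close>, then it lies in \<open>D \<inter> Tge \<subseteq> Wge\<close>, and a weight decomposition
  \<open>P \<rightarrow> M \<rightarrow> R\<close> of \<open>M\<close> has \<open>P\<close> in the heart of \<open>w\<close> and \<open>R \<in> Tge[1]\<close>.  The induced map \<open>H\<^sub>0 P \<rightarrow> M\<close> is an
  epimorphism because nothing in \<open>Tge[1]\<close> maps to \<open>Tle\<close> (lemmas \<open>cover_triangle\<close> and \<open>H0_cover\<close>).
  Hence every projective object of the heart of \<open>t\<close> is a retract of some \<open>H\<^sub>0 P\<close>.  What remains for
  the statements on \<open>Kar\<close> is pure category theory and is done in the locale
  \<open>lifted_projectives\<close>: send an idempotent \<open>e\<close> on \<open>P\<close> to an object that splits \<open>H\<^sub>0 e\<close>.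

  For the non-degenerate cases, let \<open>Wge\<close> be left orthogonal to \<open>L \<in> Tge\<close>.  No object \<open>P\<close> of the heart
  of \<open>w\<close> has a non-zero map to \<open>H\<^sub>0 L\<close>, because it would lift to \<open>L\<close>; by the covers above this
  forces \<open>H\<^sub>0 L = 0\<close>, that is, \<open>L \<in> Tge[1]\<close>.  The same applies to \<open>L[-1]\<close>, so \<open>L\<close> lies in all \<open>Tge[i]\<close>.
  Applying this to the truncation of an arbitrary object right orthogonal to \<open>Wge\<close> gives
  minus-orthogonality; plus-orthogonality is dual.
\<close>

section \<open>Categories\<close>

text \<open>
  The hom-sets of a category carry no information outside its objects, so typing a morphism
  always includes the two membership conditions; bundling them keeps the rules for composition
  free of side conditions.
\<close>

definition arr :: "('o, 'm, 'z) cat_scheme \<Rightarrow> 'm \<Rightarrow> 'o \<Rightarrow> 'o \<Rightarrow> bool"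
    (\<open>\<guillemotleft>_ : _ \<rightarrow>\<index> _\<guillemotright>\<close>) where
  "arr C f X Y \<longleftrightarrow> X \<in> Obj C \<and> Y \<in> Obj C \<and> f \<in> Hom C X Y"

context category
begin

lemma arr_dom: "\<guillemotleft>f : X \<rightarrow> Y\<guillemotright> \<Longrightarrow> X \<in> Obj C"
  and arr_cod: "\<guillemotleft>f : X \<rightarrow> Y\<guillemotright> \<Longrightarrow> Y \<in> Obj C"
  and arr_hom: "\<guillemotleft>f : X \<rightarrow> Y\<guillemotright> \<Longrightarrow> f \<in> Hom C X Y"
  by (auto simp: arr_def)

lemma arrI: "X \<in> Obj C \<Longrightarrow> Y \<in> Obj C \<Longrightarrow> f \<in> Hom C X Y \<Longrightarrow> \<guillemotleft>f : X \<rightarrow> Y\<guillemotright>"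
  by (auto simp: arr_def)

lemma idm_arr: "X \<in> Obj C \<Longrightarrow> \<guillemotleft>Idm C X : X \<rightarrow> X\<guillemotright>"
  by (simp add: arr_def id_in_hom)

lemma comp_arr: "\<guillemotleft>f : X \<rightarrow> Y\<guillemotright> \<Longrightarrow> \<guillemotleft>g : Y \<rightarrow> Z\<guillemotright> \<Longrightarrow> \<guillemotleft>g \<bullet> f : X \<rightarrow> Z\<guillemotright>"
  by (auto simp: arr_def intro: comp_in_hom)

lemma assoc: "\<guillemotleft>f : X \<rightarrow> Y\<guillemotright> \<Longrightarrow> \<guillemotleft>g : Y \<rightarrow> Z\<guillemotright> \<Longrightarrow> \<guillemotleft>h : Z \<rightarrow> W\<guillemotright>
    \<Longrightarrow> (h \<bullet> g) \<bullet> f = h \<bullet> (g \<bullet> f)"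
  by (auto simp: arr_def intro: comp_assoc)

lemma idl: "\<guillemotleft>f : X \<rightarrow> Y\<guillemotright> \<Longrightarrow> Idm C Y \<bullet> f = f"
  and idr: "\<guillemotleft>f : X \<rightarrow> Y\<guillemotright> \<Longrightarrow> f \<bullet> Idm C X = f"
  by (auto simp: arr_def id_left id_right)

lemma isoI: "\<guillemotleft>f : X \<rightarrow> Y\<guillemotright> \<Longrightarrow> \<guillemotleft>g : Y \<rightarrow> X\<guillemotright> \<Longrightarrow> g \<bullet> f = Idm C X \<Longrightarrow> f \<bullet> g = Idm C Y \<Longrightarrow> is_iso C X Y f"
  unfolding is_iso_def arr_def by blast

lemma iso_inverse:
  assumes "is_iso C X Y f" "X \<in> Obj C" "Y \<in> Obj C"
  obtains g where "\<guillemotleft>g : Y \<rightarrow> X\<guillemotright>" "g \<bullet> f = Idm C X" "f \<bullet> g = Idm C Y" "is_iso C Y X g"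
  using assms unfolding is_iso_def arr_def by blast

end

section \<open>Full subcategories and equivalences of categories\<close>

lemma full_sub_simps [simp]:
  "Obj (full_sub C D) = D" "Hom (full_sub C D) = Hom C"
  "Idm (full_sub C D) = Idm C" "Comp (full_sub C D) = Comp C"
  by (simp_all add: full_sub_def)

lemma full_sub_full_sub [simp]: "full_sub (full_sub C D) E = full_sub C E"
  by (simp add: full_sub_def)

lemma (in category) full_sub_category: "D \<subseteq> Obj C \<Longrightarrow> category (full_sub C D)"
  by unfold_locales (auto simp: subset_iff intro: id_in_hom comp_in_hom comp_assoc id_left id_right)

text \<open>
  On objects the inverse functor picks preimages up to isomorphism; on morphisms it is forced by
  making these isomorphisms natural.
\<close>

lemma equivalence_if_full_faithful_surj:
  fixes A :: "('o, 'm, 'y) cat_scheme" and B :: "('p, 'n, 'z) cat_scheme"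
  assumes A: "category A" and B: "category B" and F: "is_functor A B F"
    and full: "\<And>X Y g. X \<in> Obj A \<Longrightarrow> Y \<in> Obj A \<Longrightarrow> g \<in> Hom B (FO F X) (FO F Y) \<Longrightarrow> \<exists>f\<in>Hom A X Y. FM F X Y f = g"
    and faithful: "\<And>X Y f g. X \<in> Obj A \<Longrightarrow> Y \<in> Obj A \<Longrightarrow> f \<in> Hom A X Y \<Longrightarrow> g \<in> Hom A X Y
      \<Longrightarrow> FM F X Y f = FM F X Y g \<Longrightarrow> f = g"
    and surj: "\<And>Y. Y \<in> Obj B \<Longrightarrow> \<exists>X\<in>Obj A. \<exists>e. is_iso B (FO F X) Y e"
  shows "is_equivalence A B F"
proof -
  interpret A: category A by (rule A)
  interpret B: category B by (rule B)
  have Fo: "FO F X \<in> Obj B" and Fi: "FM F X X (Idm A X) = Idm B (FO F X)" if "X \<in> Obj A" for X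
    using F that by (auto simp: is_functor_def)
  have Fm: "FM F X Y f \<in> Hom B (FO F X) (FO F Y)"
    if "X \<in> Obj A" "Y \<in> Obj A" "f \<in> Hom A X Y" for X Y f
    using F that by (auto simp: is_functor_def)
  have Fc: "FM F X Z (g \<bullet>\<^bsub>A\<^esub> f) = FM F Y Z g \<bullet>\<^bsub>B\<^esub> FM F X Y f"
    if "X \<in> Obj A" "Y \<in> Obj A" "Z \<in> Obj A" "f \<in> Hom A X Y" "g \<in> Hom A Y Z" for X Y Z f g
    using F that by (auto simp: is_functor_def)
  have "\<forall>Y. \<exists>X e e'. Y \<in> Obj B \<longrightarrow> X \<in> Obj A \<and> e \<in> Hom B (FO F X) Y \<and> e' \<in> Hom B Y (FO F X) \<and>
      e' \<bullet>\<^bsub>B\<^esub> e = Idm B (FO F X) \<and> e \<bullet>\<^bsub>B\<^esub> e' = Idm B Y"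
    using surj unfolding is_iso_def by blast
  then obtain G e e' where "\<forall>Y. Y \<in> Obj B \<longrightarrow> G Y \<in> Obj A \<and> e Y \<in> Hom B (FO F (G Y)) Y \<and>
      e' Y \<in> Hom B Y (FO F (G Y)) \<and>
      e' Y \<bullet>\<^bsub>B\<^esub> e Y = Idm B (FO F (G Y)) \<and> e Y \<bullet>\<^bsub>B\<^esub> e' Y = Idm B Y"
    unfolding choice_iff by blast
  then have Go: "G Y \<in> Obj A" and e: "e Y \<in> Hom B (FO F (G Y)) Y" and e': "e' Y \<in> Hom B Y (FO F (G Y))"
    and e'e: "e' Y \<bullet>\<^bsub>B\<^esub> e Y = Idm B (FO F (G Y))" and ee': "e Y \<bullet>\<^bsub>B\<^esub> e' Y = Idm B Y"
    if "Y \<in> Obj B" for Y using that by blast+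
  let ?P = "\<lambda>Y Z f g. g \<in> Hom A (G Y) (G Z) \<and> e Z \<bullet>\<^bsub>B\<^esub> FM F (G Y) (G Z) g = f \<bullet>\<^bsub>B\<^esub> e Y"
  define GM where "GM Y Z f = (SOME g. ?P Y Z f g)" for Y Z f
  have e_iso: "is_iso B (FO F (G Y)) Y (e Y)" if "Y \<in> Obj B" for Y
    using e e' e'e ee' that unfolding is_iso_def by blast
  have e_cancel: "u = v"
    if "Y \<in> Obj B" "Z \<in> Obj B" "u \<in> Hom B Z (FO F (G Y))" "v \<in> Hom B Z (FO F (G Y))"
      "e Y \<bullet>\<^bsub>B\<^esub> u = e Y \<bullet>\<^bsub>B\<^esub> v" for Y Z u v
  proof -
    have "u = (e' Y \<bullet>\<^bsub>B\<^esub> e Y) \<bullet>\<^bsub>B\<^esub> u" using B.id_left that e'e Go Fo by simp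
    also have "\<dots> = (e' Y \<bullet>\<^bsub>B\<^esub> e Y) \<bullet>\<^bsub>B\<^esub> v"
      using B.comp_assoc[OF that(2) Fo[OF Go] that(1) Fo[OF Go] _ e e'] that by simp
    also have "\<dots> = v" using B.id_left that e'e Go Fo by simp
    finally show ?thesis .
  qed
  have GM: "?P Y Z f (GM Y Z f)" if ob: "Y \<in> Obj B" "Z \<in> Obj B" "f \<in> Hom B Y Z" for Y Z f
  proof -
    have fe: "f \<bullet>\<^bsub>B\<^esub> e Y \<in> Hom B (FO F (G Y)) Z"
      using that e Go Fo B.comp_in_hom by metis
    then have "e' Z \<bullet>\<^bsub>B\<^esub> (f \<bullet>\<^bsub>B\<^esub> e Y) \<in> Hom B (FO F (G Y)) (FO F (G Z))"
      using B.comp_in_hom[OF Fo[OF Go] _ Fo[OF Go] fe e'] that by simp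
    then obtain g where g: "g \<in> Hom A (G Y) (G Z)" "FM F (G Y) (G Z) g = e' Z \<bullet>\<^bsub>B\<^esub> (f \<bullet>\<^bsub>B\<^esub> e Y)"
      using full[OF Go[OF ob(1)] Go[OF ob(2)]] by blast
    have "e Z \<bullet>\<^bsub>B\<^esub> (e' Z \<bullet>\<^bsub>B\<^esub> (f \<bullet>\<^bsub>B\<^esub> e Y)) = f \<bullet>\<^bsub>B\<^esub> e Y"
      using B.comp_assoc[OF Fo[OF Go] _ Fo[OF Go] _ fe e' e] ee' that B.id_left[OF Fo[OF Go] _ fe] by simp
    then have "?P Y Z f g" using g by simp
    then show ?thesis unfolding GM_def by (rule someI)
  qed
  have GM_eq: "g = GM Y Z f" if "Y \<in> Obj B" "Z \<in> Obj B" "f \<in> Hom B Y Z" "?P Y Z f g" for Y Z f g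
  proof -
    note h = GM[OF that(1-3)]
    note GY = Go[OF that(1)] and GZ = Go[OF that(2)]
    have g: "g \<in> Hom A (G Y) (G Z)" and h': "GM Y Z f \<in> Hom A (G Y) (G Z)" using that h by simp_all
    have "FM F (G Y) (G Z) g = FM F (G Y) (G Z) (GM Y Z f)"
      by (rule e_cancel[OF that(2) Fo[OF GY] Fm[OF GY GZ g] Fm[OF GY GZ h']]) (use that h in simp)
    then show ?thesis by (rule faithful[OF GY GZ g h'])
  qed
  let ?G = "\<lparr>FO = G, FM = GM\<rparr>"
  have G: "is_functor B A ?G"
  proof -
    have "GM Y Y (Idm B Y) = Idm A (G Y)" if Y: "Y \<in> Obj B" for Y
    proof (rule GM_eq[symmetric, OF Y Y B.id_in_hom[OF Y]])
      show "?P Y Y (Idm B Y) (Idm A (G Y))"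
        using A.id_in_hom Go Fi Y B.id_left[OF Fo[OF Go] _ e] B.id_right[OF Fo[OF Go] _ e] by simp
    qed
    moreover have "GM X Z (g \<bullet>\<^bsub>B\<^esub> f) = GM Y Z g \<bullet>\<^bsub>A\<^esub> GM X Y f"
      if ob: "X \<in> Obj B" "Y \<in> Obj B" "Z \<in> Obj B" and f: "f \<in> Hom B X Y" and g: "g \<in> Hom B Y Z" for X Y Z f g
    proof (rule GM_eq[symmetric, OF ob(1,3) B.comp_in_hom[OF ob f g]])
      let ?f = "FM F (G X) (G Y) (GM X Y f)" and ?g = "FM F (G Y) (G Z) (GM Y Z g)"
      note Gf = GM[OF ob(1,2) f] and Gg = GM[OF ob(2,3) g]
      have Fg: "?g \<in> Hom B (FO F (G Y)) (FO F (G Z))" and Ff: "?f \<in> Hom B (FO F (G X)) (FO F (G Y))"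
        using Fm Go ob Gf Gg by auto
      have "e Z \<bullet>\<^bsub>B\<^esub> (?g \<bullet>\<^bsub>B\<^esub> ?f) = (g \<bullet>\<^bsub>B\<^esub> e Y) \<bullet>\<^bsub>B\<^esub> ?f"
        using B.comp_assoc[OF _ _ _ _ Ff Fg e] ob Go Fo Gg by simp
      also have "\<dots> = g \<bullet>\<^bsub>B\<^esub> (f \<bullet>\<^bsub>B\<^esub> e X)"
        using B.comp_assoc[OF _ _ _ _ Ff e g] ob Go Fo Gf by simp
      also have "\<dots> = (g \<bullet>\<^bsub>B\<^esub> f) \<bullet>\<^bsub>B\<^esub> e X"
        using B.comp_assoc[OF _ _ _ _ e f g] ob Go Fo by simp
      finally show "?P X Z (g \<bullet>\<^bsub>B\<^esub> f) (GM Y Z g \<bullet>\<^bsub>A\<^esub> GM X Y f)"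
        using Fc[OF Go Go Go] ob Gf Gg A.comp_in_hom[OF Go Go Go] by simp
    qed
    ultimately show ?thesis using Go GM by (simp add: is_functor_def)
  qed
  have FG: "is_functor B B (F \<circ>\<^sub>F ?G)" and GF: "is_functor A A (?G \<circ>\<^sub>F F)"
    using F G by (simp_all add: is_functor_def comp_functor_def)
  have "naturally_isomorphic B B (F \<circ>\<^sub>F ?G) id_functor"
    unfolding naturally_isomorphic_def
  proof (intro conjI exI[of _ e] FG ballI)
    show "is_functor B B id_functor" by (simp add: is_functor_def id_functor_def)
  qed (use e_iso GM in \<open>simp_all add: comp_functor_def id_functor_def\<close>)
  moreover have "naturally_isomorphic A A (?G \<circ>\<^sub>F F) id_functor"
  proof -
    have "\<forall>X. \<exists>n. X \<in> Obj A \<longrightarrow> n \<in> Hom A (G (FO F X)) X \<and> FM F (G (FO F X)) X n = e (FO F X)"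
      using full[OF Go _ e] Fo by blast
    then obtain n where "\<forall>X. X \<in> Obj A \<longrightarrow> n X \<in> Hom A (G (FO F X)) X \<and> FM F (G (FO F X)) X (n X) = e (FO F X)"
      unfolding choice_iff by blast
    then have n: "n X \<in> Hom A (G (FO F X)) X" and Fn: "FM F (G (FO F X)) X (n X) = e (FO F X)"
      if "X \<in> Obj A" for X using that by blast+
    have "is_iso A (G (FO F X)) X (n X)" if X: "X \<in> Obj A" for X
    proof -
      have GX: "G (FO F X) \<in> Obj A" using Go Fo X by blast
      obtain m where m: "m \<in> Hom A X (G (FO F X))" "FM F X (G (FO F X)) m = e' (FO F X)"
        using full[OF X GX e'] Fo X by blast
      have "m \<bullet>\<^bsub>A\<^esub> n X = Idm A (G (FO F X))"
        by (rule faithful[OF GX GX]) (use GX X n m Fn Fc Fi Fo e'e A.comp_in_hom A.id_in_hom in simp_all)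
      moreover have "n X \<bullet>\<^bsub>A\<^esub> m = Idm A X"
        by (rule faithful[OF X X]) (use GX X n m Fn Fc Fi Fo ee' A.comp_in_hom A.id_in_hom in simp_all)
      ultimately show ?thesis using n m X by (auto simp: is_iso_def)
    qed
    moreover have "n Y \<bullet>\<^bsub>A\<^esub> GM (FO F X) (FO F Y) (FM F X Y f) = f \<bullet>\<^bsub>A\<^esub> n X"
      if ob: "X \<in> Obj A" "Y \<in> Obj A" and f: "f \<in> Hom A X Y" for X Y f
    proof (rule faithful[OF Go[OF Fo[OF ob(1)]] ob(2)])
      note Gf = GM[OF Fo Fo Fm, OF ob ob f]
      have g: "GM (FO F X) (FO F Y) (FM F X Y f) \<in> Hom A (G (FO F X)) (G (FO F Y))" using Gf by simp
      note GX = Go[OF Fo[OF ob(1)]] and GY = Go[OF Fo[OF ob(2)]]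
      show "n Y \<bullet>\<^bsub>A\<^esub> GM (FO F X) (FO F Y) (FM F X Y f) \<in> Hom A (G (FO F X)) Y"
        by (rule A.comp_in_hom[OF GX GY ob(2) g n[OF ob(2)]])
      show "f \<bullet>\<^bsub>A\<^esub> n X \<in> Hom A (G (FO F X)) Y"
        by (rule A.comp_in_hom[OF GX ob n[OF ob(1)] f])
      show "FM F (G (FO F X)) Y (n Y \<bullet>\<^bsub>A\<^esub> GM (FO F X) (FO F Y) (FM F X Y f)) =
          FM F (G (FO F X)) Y (f \<bullet>\<^bsub>A\<^esub> n X)"
        using Fc[OF GX GY ob(2) g n[OF ob(2)]] Fc[OF GX ob n[OF ob(1)] f] Fn ob Gf by simp
    qed
    ultimately show ?thesis
      unfolding naturally_isomorphic_def
    proof (intro conjI exI[of _ n] GF ballI)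
      show "is_functor A A id_functor" by (simp add: is_functor_def id_functor_def)
    qed (simp_all add: comp_functor_def id_functor_def)
  qed
  ultimately show ?thesis
    unfolding is_equivalence_def using F G by blast
qed

section \<open>Karoubi envelopes and projective objects\<close>

lemma kar_simps [simp]:
  "x \<in> Obj (Kar C) \<longleftrightarrow> fst x \<in> Obj C \<and> snd x \<in> Hom C (fst x) (fst x) \<and> snd x \<bullet>\<^bsub>C\<^esub> snd x = snd x"
  "f \<in> Hom (Kar C) x y \<longleftrightarrow> f \<in> Hom C (fst x) (fst y) \<and> snd y \<bullet>\<^bsub>C\<^esub> (f \<bullet>\<^bsub>C\<^esub> snd x) = f"
  "Idm (Kar C) x = snd x" "Comp (Kar C) = Comp C"
  by (auto simp: Kar_def split: prod.splits)

lemma (in category) kar_hom_iff: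
  assumes "x \<in> Obj (Kar C)" "y \<in> Obj (Kar C)"
  shows "f \<in> Hom (Kar C) x y \<longleftrightarrow> f \<in> Hom C (fst x) (fst y) \<and> snd y \<bullet> f = f \<and> f \<bullet> snd x = f"
proof -
  have X: "\<guillemotleft>snd x : fst x \<rightarrow> fst x\<guillemotright>" "snd x \<bullet> snd x = snd x"
    and Y: "\<guillemotleft>snd y : fst y \<rightarrow> fst y\<guillemotright>" "snd y \<bullet> snd y = snd y"
    using assms by (auto simp: arr_def)
  show ?thesis
  proof
    assume "f \<in> Hom (Kar C) x y"
    then have f: "\<guillemotleft>f : fst x \<rightarrow> fst y\<guillemotright>" "snd y \<bullet> (f \<bullet> snd x) = f"
      using assms by (auto simp: arr_def)
    have "snd y \<bullet> f = f"
      using assoc[OF comp_arr[OF X(1) f(1)] Y(1) Y(1)] Y(2) f(2) by simp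
    moreover have "f \<bullet> snd x = f"
      using assoc[OF X(1) comp_arr[OF X(1) f(1)] Y(1)] assoc[OF X(1) X(1) f(1)] X(2) f(2) by simp
    ultimately show "f \<in> Hom C (fst x) (fst y) \<and> snd y \<bullet> f = f \<and> f \<bullet> snd x = f"
      using f(1) by (simp add: arr_def)
  qed simp
qed

lemma (in category) kar_category: "category (Kar C)"
proof (rule category.intro)
  fix X assume X: "X \<in> Obj (Kar C)"
  then show "Idm (Kar C) X \<in> Hom (Kar C) X X" by simp
next
  fix X Y f assume ob: "X \<in> Obj (Kar C)" "Y \<in> Obj (Kar C)" and f: "f \<in> Hom (Kar C) X Y"
  show "Idm (Kar C) Y \<bullet>\<^bsub>Kar C\<^esub> f = f" "f \<bullet>\<^bsub>Kar C\<^esub> Idm (Kar C) X = f"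
    using f[unfolded kar_hom_iff[OF ob]] by simp_all
next
  fix X Y Z f g
  assume ob: "X \<in> Obj (Kar C)" "Y \<in> Obj (Kar C)" "Z \<in> Obj (Kar C)"
    and "f \<in> Hom (Kar C) X Y" "g \<in> Hom (Kar C) Y Z"
  then have f: "f \<in> Hom C (fst X) (fst Y)" "f \<bullet> snd X = f"
    and g: "g \<in> Hom C (fst Y) (fst Z)" "snd Z \<bullet> g = g"
    using kar_hom_iff by blast+
  show "g \<bullet>\<^bsub>Kar C\<^esub> f \<in> Hom (Kar C) X Z"
    unfolding kar_hom_iff[OF ob(1,3)]
    using ob f g comp_in_hom[of "fst X" "fst Y" "fst Z" f g]
      comp_assoc[of "fst X" "fst X" "fst Y" "fst Z" "snd X" f g]
      comp_assoc[of "fst X" "fst Y" "fst Z" "fst Z" f g "snd Z"] by simp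
next
  fix X Y Z W f g h
  assume "X \<in> Obj (Kar C)" "Y \<in> Obj (Kar C)" "Z \<in> Obj (Kar C)" "W \<in> Obj (Kar C)"
    and "f \<in> Hom (Kar C) X Y" "g \<in> Hom (Kar C) Y Z" "h \<in> Hom (Kar C) Z W"
  then show "(h \<bullet>\<^bsub>Kar C\<^esub> g) \<bullet>\<^bsub>Kar C\<^esub> f = h \<bullet>\<^bsub>Kar C\<^esub> (g \<bullet>\<^bsub>Kar C\<^esub> f)"
    using comp_assoc[of "fst X" "fst Y" "fst Z" "fst W" f g h] by simp
qed

lemma (in category) kar_embedding_functor: "is_functor C (Kar C) (kar_embedding C)"
  using id_in_hom id_left id_right by (auto simp: is_functor_def kar_embedding_def)

text \<open>
  The categorical core of the comparison between the two hearts.  Two full subcategories \<open>A\<close> and \<open>B\<close>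
  of one category are related by a functor \<open>H\<close> together with maps \<open>\<eta>\<^sub>P : P \<rightarrow> H P\<close> that are universal
  from \<open>P\<close> to \<open>B\<close> and invisible to objects of \<open>A\<close>.  Both functor laws for \<open>H\<close> follow
  from naturality of \<open>\<eta>\<close> and universality.
\<close>

locale lifted_projectives = category C
  for C :: "('o, 'm, 'z) cat_scheme" (structure) +
  fixes A B :: "'o set" and H :: "('o, 'm, 'o, 'm) functor_data" and \<eta> :: "'o \<Rightarrow> 'm"
  assumes A_obj: "A \<subseteq> Obj C" and B_obj: "B \<subseteq> Obj C"
    and H_obj: "P \<in> A \<Longrightarrow> FO H P \<in> B"
    and H_map: "P \<in> A \<Longrightarrow> Q \<in> A \<Longrightarrow> \<guillemotleft>f : P \<rightarrow> Q\<guillemotright> \<Longrightarrow> \<guillemotleft>FM H P Q f : FO H P \<rightarrow> FO H Q\<guillemotright>"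
    and eta_arr: "P \<in> A \<Longrightarrow> \<guillemotleft>\<eta> P : P \<rightarrow> FO H P\<guillemotright>"
    and eta_natural: "P \<in> A \<Longrightarrow> Q \<in> A \<Longrightarrow> \<guillemotleft>f : P \<rightarrow> Q\<guillemotright> \<Longrightarrow> FM H P Q f \<bullet> \<eta> P = \<eta> Q \<bullet> f"
    and eta_epic: "P \<in> A \<Longrightarrow> N \<in> B \<Longrightarrow> \<guillemotleft>u : FO H P \<rightarrow> N\<guillemotright> \<Longrightarrow> \<guillemotleft>v : FO H P \<rightarrow> N\<guillemotright>
      \<Longrightarrow> u \<bullet> \<eta> P = v \<bullet> \<eta> P \<Longrightarrow> u = v"
    and eta_lift: "P \<in> A \<Longrightarrow> Q \<in> A \<Longrightarrow> \<guillemotleft>u : Q \<rightarrow> FO H P\<guillemotright> \<Longrightarrow> \<exists>v. \<guillemotleft>v : Q \<rightarrow> P\<guillemotright> \<and> \<eta> P \<bullet> v = u"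
    and eta_monic: "P \<in> A \<Longrightarrow> Q \<in> A \<Longrightarrow> \<guillemotleft>u : Q \<rightarrow> P\<guillemotright> \<Longrightarrow> \<guillemotleft>v : Q \<rightarrow> P\<guillemotright>
      \<Longrightarrow> \<eta> P \<bullet> u = \<eta> P \<bullet> v \<Longrightarrow> u = v"
    and split: "N \<in> B \<Longrightarrow> \<guillemotleft>e : N \<rightarrow> N\<guillemotright> \<Longrightarrow> e \<bullet> e = e
      \<Longrightarrow> \<exists>Y\<in>B. \<exists>i p. \<guillemotleft>i : Y \<rightarrow> N\<guillemotright> \<and> \<guillemotleft>p : N \<rightarrow> Y\<guillemotright> \<and> p \<bullet> i = Idm C Y \<and> i \<bullet> p = e"
    and H_projective: "P \<in> A \<Longrightarrow> projective (full_sub C B) (FO H P)"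
    and cover: "N \<in> B \<Longrightarrow> \<exists>P\<in>A. \<exists>f. is_epi (full_sub C B) (FO H P) N f"
begin

lemma H_id:
  assumes P: "P \<in> A"
  shows "FM H P P (Idm C P) = Idm C (FO H P)"
proof -
  have Po: "P \<in> Obj C" "FO H P \<in> Obj C" using A_obj B_obj H_obj P by blast+
  show ?thesis
    by (rule eta_epic[OF P H_obj[OF P] H_map[OF P P idm_arr] idm_arr])
      (use Po eta_natural[OF P P idm_arr] idl[OF eta_arr[OF P]] idr[OF eta_arr[OF P]] in simp_all)
qed

lemma H_comp:
  assumes ob: "P \<in> A" "Q \<in> A" "R \<in> A" and f: "\<guillemotleft>f : P \<rightarrow> Q\<guillemotright>" and g: "\<guillemotleft>g : Q \<rightarrow> R\<guillemotright>"
  shows "FM H P R (g \<bullet> f) = FM H Q R g \<bullet> FM H P Q f"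
proof (rule eta_epic[OF ob(1) H_obj[OF ob(3)]])
  note gf = comp_arr[OF f g] and hf = H_map[OF ob(1,2) f] and hg = H_map[OF ob(2,3) g]
  show "\<guillemotleft>FM H P R (g \<bullet> f) : FO H P \<rightarrow> FO H R\<guillemotright>"
    "\<guillemotleft>FM H Q R g \<bullet> FM H P Q f : FO H P \<rightarrow> FO H R\<guillemotright>"
    using H_map gf comp_arr[OF hf hg] ob by blast+
  show "FM H P R (g \<bullet> f) \<bullet> \<eta> P = (FM H Q R g \<bullet> FM H P Q f) \<bullet> \<eta> P"
    using assoc[OF eta_arr[OF ob(1)] hf hg] assoc[OF f eta_arr[OF ob(2)] hg]
      assoc[OF f g eta_arr[OF ob(3)]] eta_natural[OF ob(1,3) gf] eta_natural[OF ob(1,2) f]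
      eta_natural[OF ob(2,3) g] by simp
qed

lemma H_functor: "is_functor (full_sub C A) (Proj (full_sub C B)) H"
  unfolding is_functor_def Proj_def
  using H_projective H_id H_comp H_map A_obj by (auto simp: arr_def subset_iff)

text \<open>
  A map \<open>H P \<rightarrow> H Q\<close> is determined by its restriction to \<open>P\<close>, and this restriction lifts along
  \<open>\<eta>\<^sub>Q\<close>.
\<close>

lemma H_full:
  assumes "P \<in> A" "Q \<in> A" and g: "\<guillemotleft>g : FO H P \<rightarrow> FO H Q\<guillemotright>"
  obtains f where "\<guillemotleft>f : P \<rightarrow> Q\<guillemotright>" "FM H P Q f = g"
proof -
  obtain f where f: "\<guillemotleft>f : P \<rightarrow> Q\<guillemotright>" "\<eta> Q \<bullet> f = g \<bullet> \<eta> P"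
    using eta_lift[OF assms(2,1) comp_arr[OF eta_arr[OF assms(1)] g]] by blast
  have "FM H P Q f = g"
    by (rule eta_epic[OF assms(1) H_obj[OF assms(2)] H_map g])
      (use assms f eta_natural in simp_all)
  then show thesis using that f by blast
qed

lemma H_faithful:
  assumes "P \<in> A" "Q \<in> A" and f: "\<guillemotleft>f : P \<rightarrow> Q\<guillemotright>" "\<guillemotleft>g : P \<rightarrow> Q\<guillemotright>" "FM H P Q f = FM H P Q g"
  shows "f = g"
  using eta_monic[OF assms(2,1) f(1,2)] eta_natural[OF assms(1,2) f(1)] eta_natural[OF assms(1,2) f(2)] f(3)
  by simp

lemma projective_retract:
  assumes P: "projective (full_sub C B) P" and Y: "Y \<in> B"
    and i: "\<guillemotleft>i : Y \<rightarrow> P\<guillemotright>" and p: "\<guillemotleft>p : P \<rightarrow> Y\<guillemotright>" and pi: "p \<bullet> i = Idm C Y"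
  shows "projective (full_sub C B) Y"
proof -
  have "\<exists>h\<in>Hom C Y M. f \<bullet> h = g"
    if M: "M \<in> B" and N: "N \<in> B" and f: "is_epi (full_sub C B) M N f" and g: "g \<in> Hom C Y N" for M N f g
  proof -
    have ga: "\<guillemotleft>g : Y \<rightarrow> N\<guillemotright>" and fa: "\<guillemotleft>f : M \<rightarrow> N\<guillemotright>"
      using M N Y g f B_obj by (auto simp: arr_def is_epi_def)
    have "g \<bullet> p \<in> Hom C P N" using comp_arr[OF p ga] arr_hom by blast
    then obtain h where "h \<in> Hom C P M" "f \<bullet> h = g \<bullet> p"
      using P M N f unfolding projective_def full_sub_simps by blast
    then have h: "\<guillemotleft>h : P \<rightarrow> M\<guillemotright>" "f \<bullet> h = g \<bullet> p"
      using P M B_obj by (auto simp: arr_def projective_def)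
    have "f \<bullet> (h \<bullet> i) = g"
      using assoc[OF i h(1) fa] assoc[OF i p ga] h(2) pi idr[OF ga] by simp
    then show ?thesis using comp_arr[OF i h(1)] arr_hom by blast
  qed
  then show ?thesis using Y unfolding projective_def full_sub_simps by blast
qed

lemma split_cover:
  assumes X: "projective (full_sub C B) X"
  obtains P \<epsilon> s where "P \<in> A" "\<guillemotleft>\<epsilon> : FO H P \<rightarrow> X\<guillemotright>" "\<guillemotleft>s : X \<rightarrow> FO H P\<guillemotright>" "\<epsilon> \<bullet> s = Idm C X"
proof -
  have XB: "X \<in> B" using X by (simp add: projective_def)
  then obtain P \<epsilon> where P: "P \<in> A" and e: "is_epi (full_sub C B) (FO H P) X \<epsilon>"
    using cover by blast
  have "Idm C X \<in> Hom C X X" using XB B_obj id_in_hom by blast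
  then obtain s where "s \<in> Hom C X (FO H P)" "\<epsilon> \<bullet> s = Idm C X"
    using X e H_obj[OF P] XB unfolding projective_def full_sub_simps by blast
  then show thesis
    using that[OF P, of \<epsilon> s] e H_obj[OF P] XB B_obj by (auto simp: arr_def is_epi_def)
qed

text \<open>
  A projective object \<open>X\<close> is a retract of \<open>H P\<close> for any \<open>P\<close> that covers it; the resulting idempotent
  of \<open>H P\<close> comes from one of \<open>P\<close> because \<open>H\<close> is fully faithful.
\<close>

lemma split_cover_idempotent:
  assumes X: "projective (full_sub C B) X"
  obtains P \<epsilon> s e where "P \<in> A" "\<guillemotleft>\<epsilon> : FO H P \<rightarrow> X\<guillemotright>" "\<guillemotleft>s : X \<rightarrow> FO H P\<guillemotright>" "\<epsilon> \<bullet> s = Idm C X"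
    "\<guillemotleft>e : P \<rightarrow> P\<guillemotright>" "e \<bullet> e = e" "FM H P P e = s \<bullet> \<epsilon>"
proof -
  obtain P \<epsilon> s where P: "P \<in> A" and \<epsilon>: "\<guillemotleft>\<epsilon> : FO H P \<rightarrow> X\<guillemotright>" and s: "\<guillemotleft>s : X \<rightarrow> FO H P\<guillemotright>"
    and id: "\<epsilon> \<bullet> s = Idm C X"
    using split_cover[OF X] by blast
  obtain e where e: "\<guillemotleft>e : P \<rightarrow> P\<guillemotright>" "FM H P P e = s \<bullet> \<epsilon>"
    by (rule H_full[OF P P comp_arr[OF \<epsilon> s]])
  have "(s \<bullet> \<epsilon>) \<bullet> (s \<bullet> \<epsilon>) = s \<bullet> \<epsilon>"
    using assoc[OF comp_arr[OF \<epsilon> s] \<epsilon> s] assoc[OF \<epsilon> s \<epsilon>] id idl[OF \<epsilon>] by simp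
  then have "e \<bullet> e = e"
    using H_faithful[OF P P comp_arr[OF e(1) e(1)] e(1)] H_comp[OF P P P e(1) e(1)] e(2) by simp
  then show thesis using that P \<epsilon> s id e by blast
qed

lemma splittings_iso:
  assumes i: "\<guillemotleft>i : Y \<rightarrow> N\<guillemotright>" and p: "\<guillemotleft>p : N \<rightarrow> Y\<guillemotright>" and pi: "p \<bullet> i = Idm C Y"
    and s: "\<guillemotleft>s : X \<rightarrow> N\<guillemotright>" and r: "\<guillemotleft>r : N \<rightarrow> X\<guillemotright>" and rs: "r \<bullet> s = Idm C X"
    and e: "i \<bullet> p = s \<bullet> r"
  shows "is_iso C Y X (r \<bullet> i)"
proof (rule isoI[OF comp_arr[OF i r] comp_arr[OF s p]])
  show "(p \<bullet> s) \<bullet> (r \<bullet> i) = Idm C Y"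
    using assoc[OF comp_arr[OF i r] s p] assoc[OF i r s] assoc[OF i p i] e[symmetric] pi idr[OF i] by simp
  show "(r \<bullet> i) \<bullet> (p \<bullet> s) = Idm C X"
    using assoc[OF comp_arr[OF s p] i r] assoc[OF s p i] assoc[OF s r s] e rs idr[OF s] by simp
qed

lemma enough: "enough_projectives (full_sub C B)"
  unfolding enough_projectives_def using cover H_projective by fastforce

text \<open>
  If idempotents split in \<open>A\<close>, then \<open>H\<close> itself reaches every projective object: the idempotent cutting
  out \<open>X\<close> from \<open>H P\<close> is \<open>H e\<close>, and \<open>H\<close> carries a splitting of \<open>e\<close> to a splitting of \<open>H e\<close>.
\<close>

lemma karoubian_equivalence:
  assumes "\<And>P e. P \<in> A \<Longrightarrow> \<guillemotleft>e : P \<rightarrow> P\<guillemotright> \<Longrightarrow> e \<bullet> e = e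
      \<Longrightarrow> \<exists>Y\<in>A. \<exists>i p. \<guillemotleft>i : Y \<rightarrow> P\<guillemotright> \<and> \<guillemotleft>p : P \<rightarrow> Y\<guillemotright> \<and> p \<bullet> i = Idm C Y \<and> i \<bullet> p = e"
  shows "is_equivalence (full_sub C A) (Proj (full_sub C B)) H"
proof (rule equivalence_if_full_faithful_surj)
  show "category (full_sub C A)" using full_sub_category A_obj by blast
  show "category (Proj (full_sub C B))"
    unfolding Proj_def full_sub_full_sub
    using full_sub_category B_obj by (auto simp: projective_def subset_iff)
  show "is_functor (full_sub C A) (Proj (full_sub C B)) H" by (rule H_functor)
next
  fix P Q g
  assume "P \<in> Obj (full_sub C A)" "Q \<in> Obj (full_sub C A)" "g \<in> Hom (Proj (full_sub C B)) (FO H P) (FO H Q)"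
  then have "P \<in> A" "Q \<in> A" "\<guillemotleft>g : FO H P \<rightarrow> FO H Q\<guillemotright>"
    using H_obj B_obj by (auto simp: Proj_def arr_def)
  then show "\<exists>f\<in>Hom (full_sub C A) P Q. FM H P Q f = g"
    using H_full arr_hom unfolding full_sub_simps by metis
next
  fix P Q f g
  assume "P \<in> Obj (full_sub C A)" "Q \<in> Obj (full_sub C A)" "f \<in> Hom (full_sub C A) P Q"
    "g \<in> Hom (full_sub C A) P Q" "FM H P Q f = FM H P Q g"
  then show "f = g"
    using H_faithful[of P Q f g] A_obj by (auto simp: arr_def)
next
  fix X assume "X \<in> Obj (Proj (full_sub C B))"
  then have "projective (full_sub C B) X" by (simp add: Proj_def)
  then obtain P \<epsilon> s e where P: "P \<in> A" and \<epsilon>: "\<guillemotleft>\<epsilon> : FO H P \<rightarrow> X\<guillemotright>" "\<guillemotleft>s : X \<rightarrow> FO H P\<guillemotright>" "\<epsilon> \<bullet> s = Idm C X"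
    and e: "\<guillemotleft>e : P \<rightarrow> P\<guillemotright>" "e \<bullet> e = e" "FM H P P e = s \<bullet> \<epsilon>"
    by (rule split_cover_idempotent)
  obtain Y i p where Y: "Y \<in> A" and i: "\<guillemotleft>i : Y \<rightarrow> P\<guillemotright>" and p: "\<guillemotleft>p : P \<rightarrow> Y\<guillemotright>"
    and pi: "p \<bullet> i = Idm C Y" "i \<bullet> p = e"
    using assms[OF P e(1,2)] by blast
  note Hi = H_map[OF Y P i] and Hp = H_map[OF P Y p]
  have "is_iso C (FO H Y) X (\<epsilon> \<bullet> FM H Y P i)"
    by (rule splittings_iso[OF Hi Hp _ \<epsilon>(2,1,3)])
      (use H_comp[OF Y P Y i p] H_comp[OF P Y P p i] pi e(3) H_id[OF Y] in simp_all)
  then show "\<exists>Y\<in>Obj (full_sub C A). \<exists>e. is_iso (Proj (full_sub C B)) (FO H Y) X e"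
    using Y by (auto simp: is_iso_def Proj_def)
qed

text \<open>
  The functor sends \<open>(P, e)\<close> to a chosen object splitting \<open>H e\<close>.  Its action on morphisms is
  characterised by compatibility with the inclusions \<open>i\<close> of these objects into the \<open>H P\<close>, and all
  identities are checked after composing with the split monomorphism \<open>i\<close>.
\<close>

lemma kar_equivalence:
  "\<exists>F. is_equivalence (Kar (full_sub C A)) (Proj (full_sub C B)) F \<and>
    naturally_isomorphic (full_sub C A) (Proj (full_sub C B)) (F \<circ>\<^sub>F kar_embedding (full_sub C A)) H"
proof -
  let ?A = "full_sub C A" and ?P = "Proj (full_sub C B)"
  interpret A: category ?A using full_sub_category A_obj by blast
  have P_cat: "category ?P"
    unfolding Proj_def full_sub_full_sub
    using full_sub_category B_obj by (auto simp: projective_def subset_iff)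
  have Psimps: "Obj ?P = {X. projective (full_sub C B) X}" "Hom ?P = Hom C" "Idm ?P = Idm C" "Comp ?P = Comp C"
    by (simp_all add: Proj_def)
  have PB: "X \<in> B" if "projective (full_sub C B) X" for X using that by (simp add: projective_def)
  have xA: "fst x \<in> A" and xe: "\<guillemotleft>snd x : fst x \<rightarrow> fst x\<guillemotright>" and xi: "snd x \<bullet> snd x = snd x"
    if "x \<in> Obj (Kar ?A)" for x
    using that A_obj by (auto simp: arr_def)
  have "\<forall>x. \<exists>Y i p. x \<in> Obj (Kar ?A) \<longrightarrow> Y \<in> B \<and> \<guillemotleft>i : Y \<rightarrow> FO H (fst x)\<guillemotright> \<and> \<guillemotleft>p : FO H (fst x) \<rightarrow> Y\<guillemotright> \<and>
      p \<bullet> i = Idm C Y \<and> i \<bullet> p = FM H (fst x) (fst x) (snd x)"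
    using split[OF H_obj[OF xA] H_map[OF xA xA xe]] H_comp[OF xA xA xA xe xe] xi by metis
  then obtain Y i p where "\<forall>x. x \<in> Obj (Kar ?A) \<longrightarrow> Y x \<in> B \<and> \<guillemotleft>i x : Y x \<rightarrow> FO H (fst x)\<guillemotright> \<and>
      \<guillemotleft>p x : FO H (fst x) \<rightarrow> Y x\<guillemotright> \<and> p x \<bullet> i x = Idm C (Y x) \<and> i x \<bullet> p x = FM H (fst x) (fst x) (snd x)"
    unfolding choice_iff by blast
  then have Y: "Y x \<in> B" and i: "\<guillemotleft>i x : Y x \<rightarrow> FO H (fst x)\<guillemotright>" and p: "\<guillemotleft>p x : FO H (fst x) \<rightarrow> Y x\<guillemotright>"
    and pi: "p x \<bullet> i x = Idm C (Y x)" and ip: "i x \<bullet> p x = FM H (fst x) (fst x) (snd x)"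
    if "x \<in> Obj (Kar ?A)" for x using that by blast+
  have Y_proj: "projective (full_sub C B) (Y x)" if "x \<in> Obj (Kar ?A)" for x
    using projective_retract[OF H_projective[OF xA] Y i p pi] that by blast
  have i_cancel: "u = v" if "x \<in> Obj (Kar ?A)" "\<guillemotleft>u : X \<rightarrow> Y x\<guillemotright>" "\<guillemotleft>v : X \<rightarrow> Y x\<guillemotright>" "i x \<bullet> u = i x \<bullet> v" for x X u v
    using assoc[OF that(2) i p] assoc[OF that(3) i p] that pi idl by metis
  define F where "F = \<lparr>FO = Y, FM = \<lambda>x y f. p y \<bullet> (FM H (fst x) (fst y) f \<bullet> i x)\<rparr>"
  have FO_F: "FO F = Y" by (simp add: F_def)
  have arrs: "\<guillemotleft>f : fst x \<rightarrow> fst y\<guillemotright>" "snd y \<bullet> f = f" "f \<bullet> snd x = f"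
    if "x \<in> Obj (Kar ?A)" "y \<in> Obj (Kar ?A)" "f \<in> Hom (Kar ?A) x y" for x y f
    using A.kar_hom_iff[OF that(1,2), of f] that xA A_obj by (auto simp: arr_def)
  have F_map: "\<guillemotleft>FM F x y f : Y x \<rightarrow> Y y\<guillemotright>" "i y \<bullet> FM F x y f = FM H (fst x) (fst y) f \<bullet> i x"
    if x: "x \<in> Obj (Kar ?A)" and y: "y \<in> Obj (Kar ?A)" and f': "f \<in> Hom (Kar ?A) x y" for x y f
  proof -
    note f = arrs[OF that]
    note h = H_map[OF xA[OF x] xA[OF y] f(1)]
    note hi = comp_arr[OF i[OF x] h]
    show "\<guillemotleft>FM F x y f : Y x \<rightarrow> Y y\<guillemotright>"
      unfolding F_def using comp_arr[OF hi p[OF y]] by simp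
    have "i y \<bullet> FM F x y f = (i y \<bullet> p y) \<bullet> (FM H (fst x) (fst y) f \<bullet> i x)"
      unfolding F_def using assoc[OF hi p[OF y] i[OF y]] by simp
    also have "\<dots> = FM H (fst x) (fst y) (snd y \<bullet> f) \<bullet> i x"
      using ip[OF y] H_comp[OF xA[OF x] xA[OF y] xA[OF y] f(1) xe[OF y]]
        assoc[OF i[OF x] h H_map[OF xA[OF y] xA[OF y] xe[OF y]]] by simp
    finally show "i y \<bullet> FM F x y f = FM H (fst x) (fst y) f \<bullet> i x" using f(2) by simp
  qed
  have F_fun: "is_functor (Kar ?A) ?P F"
  proof -
    have "FM F x x (snd x) = Idm C (Y x)" if x: "x \<in> Obj (Kar ?A)" for x
    proof (rule i_cancel[OF x])
      have s: "snd x \<in> Hom (Kar ?A) x x" using x by simp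
      show "\<guillemotleft>FM F x x (snd x) : Y x \<rightarrow> Y x\<guillemotright>" "\<guillemotleft>Idm C (Y x) : Y x \<rightarrow> Y x\<guillemotright>"
        using F_map(1)[OF x x s] Y[OF x] B_obj idm_arr by blast+
      show "i x \<bullet> FM F x x (snd x) = i x \<bullet> Idm C (Y x)"
        using F_map(2)[OF x x s] ip[OF x, symmetric] assoc[OF i[OF x] p[OF x] i[OF x]] pi[OF x] by simp
    qed
    moreover have "FM F x z (g \<bullet> f) = FM F y z g \<bullet> FM F x y f"
      if ob: "x \<in> Obj (Kar ?A)" "y \<in> Obj (Kar ?A)" "z \<in> Obj (Kar ?A)"
        and f: "f \<in> Hom (Kar ?A) x y" and g: "g \<in> Hom (Kar ?A) y z" for x y z f g
    proof (rule i_cancel[OF ob(3)])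
      note Ff = F_map[OF ob(1,2) f] and Fg = F_map[OF ob(2,3) g]
      have gf: "g \<bullet> f \<in> Hom (Kar ?A) x z"
        using category.comp_in_hom[OF A.kar_category ob f g] by simp
      note Fgf = F_map[OF ob(1,3) gf]
      note fa = arrs(1)[OF ob(1,2) f] and ga = arrs(1)[OF ob(2,3) g]
      note hf = H_map[OF xA[OF ob(1)] xA[OF ob(2)] fa] and hg = H_map[OF xA[OF ob(2)] xA[OF ob(3)] ga]
      show "\<guillemotleft>FM F x z (g \<bullet> f) : Y x \<rightarrow> Y z\<guillemotright>" by (rule Fgf(1))
      show "\<guillemotleft>FM F y z g \<bullet> FM F x y f : Y x \<rightarrow> Y z\<guillemotright>" by (rule comp_arr[OF Ff(1) Fg(1)])
      have "i z \<bullet> (FM F y z g \<bullet> FM F x y f) = FM H (fst y) (fst z) g \<bullet> (i y \<bullet> FM F x y f)"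
        using assoc[OF Ff(1) Fg(1) i[OF ob(3)]] assoc[OF Ff(1) i[OF ob(2)] hg] Fg(2) by simp
      also have "\<dots> = FM H (fst x) (fst z) (g \<bullet> f) \<bullet> i x"
        using assoc[OF i[OF ob(1)] hf hg] H_comp[OF xA[OF ob(1)] xA[OF ob(2)] xA[OF ob(3)] fa ga] Ff(2) by simp
      finally show "i z \<bullet> FM F x z (g \<bullet> f) = i z \<bullet> (FM F y z g \<bullet> FM F x y f)"
        using Fgf(2) by simp
    qed
    ultimately show ?thesis
      unfolding is_functor_def Psimps FO_F
      using Y_proj F_map(1) by (auto simp del: kar_simps(1,2) intro: arr_hom)
  qed
  have F_eq: "is_equivalence (Kar ?A) ?P F"
  proof (rule equivalence_if_full_faithful_surj[OF A.kar_category P_cat F_fun])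
    fix x y k assume x: "x \<in> Obj (Kar ?A)" and y: "y \<in> Obj (Kar ?A)" and "k \<in> Hom ?P (FO F x) (FO F y)"
    then have k: "\<guillemotleft>k : Y x \<rightarrow> Y y\<guillemotright>"
      using Y[OF x] Y[OF y] B_obj by (auto simp: Psimps FO_F arr_def)
    \<comment> \<open>Conjugating \<open>k\<close> into a map \<open>H P \<rightarrow> H Q\<close> absorbs both idempotents.\<close>
    note ikp = comp_arr[OF p[OF x] comp_arr[OF k i[OF y]]]
    obtain f where f: "\<guillemotleft>f : fst x \<rightarrow> fst y\<guillemotright>" and Hf: "FM H (fst x) (fst y) f = (i y \<bullet> k) \<bullet> p x"
      by (rule H_full[OF xA[OF x] xA[OF y] ikp])
    have "snd y \<bullet> f = f"
    proof (rule H_faithful[OF xA[OF x] xA[OF y] comp_arr[OF f xe[OF y]] f])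
      have "(i y \<bullet> p y) \<bullet> ((i y \<bullet> k) \<bullet> p x) = ((i y \<bullet> p y) \<bullet> (i y \<bullet> k)) \<bullet> p x"
        by (rule assoc[OF p[OF x] comp_arr[OF k i[OF y]] comp_arr[OF p[OF y] i[OF y]], symmetric])
      also have "(i y \<bullet> p y) \<bullet> (i y \<bullet> k) = ((i y \<bullet> p y) \<bullet> i y) \<bullet> k"
        by (rule assoc[OF k i[OF y] comp_arr[OF p[OF y] i[OF y]], symmetric])
      also have "(i y \<bullet> p y) \<bullet> i y = i y"
        using assoc[OF i[OF y] p[OF y] i[OF y]] pi[OF y] idr[OF i[OF y]] by simp
      finally show "FM H (fst x) (fst y) (snd y \<bullet> f) = FM H (fst x) (fst y) f"
        using H_comp[OF xA[OF x] xA[OF y] xA[OF y] f xe[OF y]] Hf ip[OF y] by simp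
    qed
    moreover have "f \<bullet> snd x = f"
    proof (rule H_faithful[OF xA[OF x] xA[OF y] comp_arr[OF xe[OF x] f] f])
      have "((i y \<bullet> k) \<bullet> p x) \<bullet> (i x \<bullet> p x) = (i y \<bullet> k) \<bullet> (p x \<bullet> (i x \<bullet> p x))"
        by (rule assoc[OF comp_arr[OF p[OF x] i[OF x]] p[OF x] comp_arr[OF k i[OF y]]])
      also have "p x \<bullet> (i x \<bullet> p x) = p x"
        using assoc[OF p[OF x] i[OF x] p[OF x]] pi[OF x] idl[OF p[OF x]] by simp
      finally show "FM H (fst x) (fst y) (f \<bullet> snd x) = FM H (fst x) (fst y) f"
        using H_comp[OF xA[OF x] xA[OF x] xA[OF y] xe[OF x] f] Hf ip[OF x] by simp
    qed
    ultimately have fK: "f \<in> Hom (Kar ?A) x y"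
      using A.kar_hom_iff[OF x y, of f] arr_hom[OF f] by simp
    have "FM F x y f = k"
    proof (rule i_cancel[OF y F_map(1)[OF x y fK] k])
      have "((i y \<bullet> k) \<bullet> p x) \<bullet> i x = i y \<bullet> k"
        using assoc[OF i[OF x] p[OF x] comp_arr[OF k i[OF y]]] pi[OF x] idr[OF comp_arr[OF k i[OF y]]] by simp
      then show "i y \<bullet> FM F x y f = i y \<bullet> k"
        using F_map(2)[OF x y fK] Hf by simp
    qed
    then show "\<exists>f\<in>Hom (Kar ?A) x y. FM F x y f = k" using fK by blast
  next
    fix x y f g
    assume x: "x \<in> Obj (Kar ?A)" and y: "y \<in> Obj (Kar ?A)" and f: "f \<in> Hom (Kar ?A) x y"
      and g: "g \<in> Hom (Kar ?A) x y" and eq: "FM F x y f = FM F x y g"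
    \<comment> \<open>As \<open>h\<close> absorbs the idempotent of \<open>x\<close>, \<open>H h\<close> is recovered from its restriction along \<open>i\<close>.\<close>
    have c: "FM H (fst x) (fst y) h = (FM H (fst x) (fst y) h \<bullet> i x) \<bullet> p x"
      if h: "h \<in> Hom (Kar ?A) x y" for h
      using H_comp[OF xA[OF x] xA[OF x] xA[OF y] xe[OF x] arrs(1)[OF x y h]] arrs(3)[OF x y h] ip[OF x, symmetric]
        assoc[OF p[OF x] i[OF x] H_map[OF xA[OF x] xA[OF y] arrs(1)[OF x y h]]] by simp
    have "FM H (fst x) (fst y) f = FM H (fst x) (fst y) g"
      using c[OF f] c[OF g] F_map(2)[OF x y f] F_map(2)[OF x y g] eq by simp
    then show "f = g"
      using H_faithful[OF xA[OF x] xA[OF y] arrs(1)[OF x y f] arrs(1)[OF x y g]] by blast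
  next
    fix X assume "X \<in> Obj ?P"
    then have "projective (full_sub C B) X" by (simp add: Psimps)
    then obtain P \<epsilon> s e where P: "P \<in> A" and \<epsilon>: "\<guillemotleft>\<epsilon> : FO H P \<rightarrow> X\<guillemotright>" "\<guillemotleft>s : X \<rightarrow> FO H P\<guillemotright>" "\<epsilon> \<bullet> s = Idm C X"
      and e: "\<guillemotleft>e : P \<rightarrow> P\<guillemotright>" "e \<bullet> e = e" "FM H P P e = s \<bullet> \<epsilon>"
      by (rule split_cover_idempotent)
    have x: "(P, e) \<in> Obj (Kar ?A)" using P e arr_hom by simp
    have "is_iso C (Y (P, e)) X (\<epsilon> \<bullet> i (P, e))"
      by (rule splittings_iso[OF i[OF x, simplified] p[OF x, simplified] pi[OF x] \<epsilon>(2,1,3)]) (use ip[OF x] e in simp)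
    then show "\<exists>x\<in>Obj (Kar ?A). \<exists>e. is_iso ?P (FO F x) X e"
      using x unfolding is_iso_def Psimps FO_F by blast
  qed
  moreover have "naturally_isomorphic ?A ?P (F \<circ>\<^sub>F kar_embedding ?A) H"
    unfolding naturally_isomorphic_def
  proof (intro conjI exI[of _ "\<lambda>P. i (P, Idm C P)"] ballI)
    show "is_functor ?A ?P (F \<circ>\<^sub>F kar_embedding ?A)"
      using F_fun A.kar_embedding_functor unfolding is_functor_def comp_functor_def by simp
    show "is_functor ?A ?P H" by (rule H_functor)
    have x: "(P, Idm C P) \<in> Obj (Kar ?A)" if "P \<in> A" for P
      using that A_obj id_in_hom[of P] id_left[of P P "Idm C P"] by auto
    show "is_iso ?P (FO (F \<circ>\<^sub>F kar_embedding ?A) P) (FO H P) (i (P, Idm C P))" if "P \<in> Obj ?A" for P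
    proof -
      have P: "P \<in> A" using that by simp
      show ?thesis
        using i[OF x[OF P]] p[OF x[OF P]] pi[OF x[OF P]] ip[OF x[OF P]] H_id[OF P]
        by (auto simp: is_iso_def Psimps comp_functor_def kar_embedding_def FO_F arr_def)
    qed
    show "i (Q, Idm C Q) \<bullet>\<^bsub>?P\<^esub> FM (F \<circ>\<^sub>F kar_embedding ?A) P Q f = FM H P Q f \<bullet>\<^bsub>?P\<^esub> i (P, Idm C P)"
      if "P \<in> Obj ?A" "Q \<in> Obj ?A" "f \<in> Hom ?A P Q" for P Q f
    proof -
      have P: "P \<in> A" "Q \<in> A" and f: "\<guillemotleft>f : P \<rightarrow> Q\<guillemotright>" using that A_obj by (auto simp: arr_def)
      have "f \<in> Hom (Kar ?A) (P, Idm C P) (Q, Idm C Q)"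
        using arr_hom[OF f] idl[OF f] idr[OF f] by simp
      from F_map(2)[OF x[OF P(1)] x[OF P(2)] this] show ?thesis
        by (simp add: comp_functor_def kar_embedding_def Psimps)
    qed
  qed
  ultimately show ?thesis by blast
qed

end

section \<open>Additive categories\<close>

context additive_category
begin

definition neg :: "'o \<Rightarrow> 'o \<Rightarrow> 'm \<Rightarrow> 'm" where
  "neg X Y f = inv\<^bsub>hom_group C X Y\<^esub> f"

text \<open>
  Between objects this is triviality of the hom-group; quantifying over typed morphisms keeps the
  membership conditions inside the relation.
\<close>

definition perp :: "'o \<Rightarrow> 'o \<Rightarrow> bool"  (infix \<open>\<perp>\<close> 50) where
  "X \<perp> Y \<longleftrightarrow> (\<forall>f. \<guillemotleft>f : X \<rightarrow> Y\<guillemotright> \<longrightarrow> f = Zero C X Y)"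

lemma perpD: "X \<perp> Y \<Longrightarrow> \<guillemotleft>f : X \<rightarrow> Y\<guillemotright> \<Longrightarrow> f = Zero C X Y"
  by (simp add: perp_def)

lemma add_arr: "\<guillemotleft>f : X \<rightarrow> Y\<guillemotright> \<Longrightarrow> \<guillemotleft>g : X \<rightarrow> Y\<guillemotright> \<Longrightarrow> \<guillemotleft>Add C f g : X \<rightarrow> Y\<guillemotright>"
  using comm_group.axioms(2)[OF hom_comm_group, of X Y, THEN group.is_monoid, THEN monoid.m_closed, of f g]
  by (auto simp: arr_def hom_group_def)

lemma zero_arr: "X \<in> Obj C \<Longrightarrow> Y \<in> Obj C \<Longrightarrow> \<guillemotleft>Zero C X Y : X \<rightarrow> Y\<guillemotright>"
  using comm_group.axioms(2)[OF hom_comm_group, of X Y, THEN group.is_monoid, THEN monoid.one_closed]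
  by (auto simp: arr_def hom_group_def)

lemma neg_arr: "\<guillemotleft>f : X \<rightarrow> Y\<guillemotright> \<Longrightarrow> \<guillemotleft>neg X Y f : X \<rightarrow> Y\<guillemotright>"
  using comm_group.axioms(2)[OF hom_comm_group, of X Y, THEN group.inv_closed, of f]
  by (auto simp: arr_def hom_group_def neg_def)

lemma add_zero: "\<guillemotleft>f : X \<rightarrow> Y\<guillemotright> \<Longrightarrow> Add C (Zero C X Y) f = f"
  using comm_group.axioms(2)[OF hom_comm_group, of X Y, THEN group.is_monoid, THEN monoid.l_one, of f]
  by (auto simp: arr_def hom_group_def)

lemma add_neg: "\<guillemotleft>f : X \<rightarrow> Y\<guillemotright> \<Longrightarrow> Add C (neg X Y f) f = Zero C X Y"
  using comm_group.axioms(2)[OF hom_comm_group, of X Y, THEN group.l_inv, of f]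
  by (auto simp: arr_def hom_group_def neg_def)

lemma add_right_cancel:
  "\<guillemotleft>f : X \<rightarrow> Y\<guillemotright> \<Longrightarrow> \<guillemotleft>g : X \<rightarrow> Y\<guillemotright> \<Longrightarrow> \<guillemotleft>h : X \<rightarrow> Y\<guillemotright> \<Longrightarrow> Add C f h = Add C g h \<longleftrightarrow> f = g"
  using comm_group.axioms(2)[OF hom_comm_group, of X Y, THEN group.right_cancel, of h f g]
  by (auto simp: arr_def hom_group_def)

lemma add_distrib_right: "\<guillemotleft>f : X \<rightarrow> Y\<guillemotright> \<Longrightarrow> \<guillemotleft>g : Y \<rightarrow> Z\<guillemotright> \<Longrightarrow> \<guillemotleft>g' : Y \<rightarrow> Z\<guillemotright>
    \<Longrightarrow> Add C g g' \<bullet> f = Add C (g \<bullet> f) (g' \<bullet> f)"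
  and add_distrib_left: "\<guillemotleft>u : X \<rightarrow> Y\<guillemotright> \<Longrightarrow> \<guillemotleft>u' : X \<rightarrow> Y\<guillemotright> \<Longrightarrow> \<guillemotleft>v : Y \<rightarrow> Z\<guillemotright>
    \<Longrightarrow> v \<bullet> Add C u u' = Add C (v \<bullet> u) (v \<bullet> u')"
  by (auto simp: arr_def intro: add_comp_left add_comp_right)

lemma add_eq_right_iff: "\<guillemotleft>f : X \<rightarrow> Y\<guillemotright> \<Longrightarrow> \<guillemotleft>g : X \<rightarrow> Y\<guillemotright> \<Longrightarrow> Add C f g = g \<longleftrightarrow> f = Zero C X Y"
  by (metis add_right_cancel add_zero arr_dom arr_cod zero_arr)

lemma zero_comp:
  assumes f: "\<guillemotleft>f : X \<rightarrow> Y\<guillemotright>" and Z: "Z \<in> Obj C"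
  shows "Zero C Y Z \<bullet> f = Zero C X Z"
proof -
  have z: "\<guillemotleft>Zero C Y Z : Y \<rightarrow> Z\<guillemotright>" using zero_arr Z arr_cod f by blast
  show ?thesis
    using add_distrib_right[OF f z z] add_eq_right_iff[OF comp_arr[OF f z] comp_arr[OF f z]]
    by (simp add: add_zero[OF z])
qed

lemma comp_zero:
  assumes g: "\<guillemotleft>g : Y \<rightarrow> Z\<guillemotright>" and X: "X \<in> Obj C"
  shows "g \<bullet> Zero C X Y = Zero C X Z"
proof -
  have z: "\<guillemotleft>Zero C X Y : X \<rightarrow> Y\<guillemotright>" using zero_arr X arr_dom g by blast
  show ?thesis
    using add_distrib_left[OF z z g] add_eq_right_iff[OF comp_arr[OF z g] comp_arr[OF z g]]
    by (simp add: add_zero[OF z])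
qed

lemma neg_unique:
  assumes "\<guillemotleft>f : X \<rightarrow> Y\<guillemotright>" "\<guillemotleft>g : X \<rightarrow> Y\<guillemotright>" "Add C g f = Zero C X Y"
  shows "neg X Y f = g"
  using add_right_cancel[OF neg_arr[OF assms(1)] assms(2,1)] add_neg[OF assms(1)] assms(3) by simp

lemma neg_comp:
  assumes f: "\<guillemotleft>f : X \<rightarrow> Y\<guillemotright>" and g: "\<guillemotleft>g : Y \<rightarrow> Z\<guillemotright>"
  shows "neg Y Z g \<bullet> f = neg X Z (g \<bullet> f)"
proof (rule neg_unique[symmetric])
  show "Add C (neg Y Z g \<bullet> f) (g \<bullet> f) = Zero C X Z"
    using add_distrib_right[OF f neg_arr[OF g] g] add_neg[OF g] zero_comp[OF f arr_cod[OF g]] by simp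
qed (use comp_arr f g neg_arr in blast)+

lemma comp_neg:
  assumes f: "\<guillemotleft>f : X \<rightarrow> Y\<guillemotright>" and g: "\<guillemotleft>g : Y \<rightarrow> Z\<guillemotright>"
  shows "g \<bullet> neg X Y f = neg X Z (g \<bullet> f)"
proof (rule neg_unique[symmetric])
  show "Add C (g \<bullet> neg X Y f) (g \<bullet> f) = Zero C X Z"
    using add_distrib_left[OF neg_arr[OF f] f g] add_neg[OF f] comp_zero[OF g arr_dom[OF f]] by simp
qed (use comp_arr f g neg_arr in blast)+

lemma add_comm: "\<guillemotleft>f : X \<rightarrow> Y\<guillemotright> \<Longrightarrow> \<guillemotleft>g : X \<rightarrow> Y\<guillemotright> \<Longrightarrow> Add C f g = Add C g f"
  using comm_group.axioms(1)[OF hom_comm_group, of X Y, THEN comm_monoid.m_comm, of f g]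
  by (auto simp: arr_def hom_group_def)

lemma neg_neg: "\<guillemotleft>f : X \<rightarrow> Y\<guillemotright> \<Longrightarrow> neg X Y (neg X Y f) = f"
  using neg_unique[of "neg X Y f" X Y f] add_comm[of "neg X Y f" X Y f] add_neg[of f X Y] neg_arr
  by simp

lemma neg_zero: "X \<in> Obj C \<Longrightarrow> Y \<in> Obj C \<Longrightarrow> neg X Y (Zero C X Y) = Zero C X Y"
  using neg_unique[of "Zero C X Y" X Y "Zero C X Y"] add_zero zero_arr by simp

lemma difference_ex:
  assumes "\<guillemotleft>g : X \<rightarrow> Y\<guillemotright>" and "\<guillemotleft>h : X \<rightarrow> Y\<guillemotright>"
  obtains d where "\<guillemotleft>d : X \<rightarrow> Y\<guillemotright>" and "Add C d h = g"
proof -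
  interpret G: comm_group "hom_group C X Y"
    using assms by (intro hom_comm_group) (auto simp: arr_def)
  show thesis
    using that[of "Add C g (neg X Y h)"] add_arr neg_arr assms
      G.inv_solve_right[of g "Add C g (neg X Y h)" h] G.m_assoc[of g "neg X Y h" h] G.l_inv[of h] G.r_one[of g] neg_arr[OF assms(2)]
    by (auto simp: hom_group_def neg_def arr_def)
qed

text \<open>
  In an additive category it suffices to test cancellation on zero.
\<close>

lemma right_cancel:
  assumes "\<guillemotleft>f : X \<rightarrow> Y\<guillemotright>" "\<guillemotleft>g : Y \<rightarrow> Z\<guillemotright>" "\<guillemotleft>h : Y \<rightarrow> Z\<guillemotright>" "g \<bullet> f = h \<bullet> f"
    and "\<And>d. \<guillemotleft>d : Y \<rightarrow> Z\<guillemotright> \<Longrightarrow> d \<bullet> f = Zero C X Z \<Longrightarrow> d = Zero C Y Z"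
  shows "g = h"
proof -
  obtain d where d: "\<guillemotleft>d : Y \<rightarrow> Z\<guillemotright>" "Add C d h = g"
    using difference_ex assms(2,3) by blast
  then have "d \<bullet> f = Zero C X Z"
    using add_distrib_right[OF assms(1) d(1) assms(3)] assms(4)
      add_eq_right_iff[OF comp_arr[OF assms(1) d(1)] comp_arr[OF assms(1,3)]] by simp
  then show ?thesis
    using d assms(3,5) add_zero by blast
qed

lemma left_cancel:
  assumes "\<guillemotleft>f : Y \<rightarrow> Z\<guillemotright>" "\<guillemotleft>g : X \<rightarrow> Y\<guillemotright>" "\<guillemotleft>h : X \<rightarrow> Y\<guillemotright>" "f \<bullet> g = f \<bullet> h"
    and "\<And>d. \<guillemotleft>d : X \<rightarrow> Y\<guillemotright> \<Longrightarrow> f \<bullet> d = Zero C X Z \<Longrightarrow> d = Zero C X Y"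
  shows "g = h"
proof -
  obtain d where d: "\<guillemotleft>d : X \<rightarrow> Y\<guillemotright>" "Add C d h = g"
    using difference_ex assms(2,3) by blast
  then have "f \<bullet> d = Zero C X Z"
    using add_distrib_left[OF d(1) assms(3,1)] assms(4)
      add_eq_right_iff[OF comp_arr[OF d(1) assms(1)] comp_arr[OF assms(3,1)]] by simp
  then show ?thesis
    using d assms(3,5) add_zero by blast
qed

lemma zero_object_obj: "is_zero_object C Z \<Longrightarrow> Z \<in> Obj C"
  by (simp add: is_zero_object_def)

lemma zero_object_perp: "is_zero_object C Z \<Longrightarrow> X \<in> Obj C \<Longrightarrow> X \<perp> Z"
  unfolding perp_def is_zero_object_def by (metis arr_def zero_arr)

lemma zero_object_perp': "is_zero_object C Z \<Longrightarrow> X \<in> Obj C \<Longrightarrow> Z \<perp> X"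
  unfolding perp_def is_zero_object_def by (metis arr_def zero_arr)

lemma zero_object_iff: "is_zero_object C X \<longleftrightarrow> X \<in> Obj C \<and> Idm C X = Zero C X X"
proof
  assume "is_zero_object C X"
  then show "X \<in> Obj C \<and> Idm C X = Zero C X X"
    using zero_object_obj zero_object_perp perpD idm_arr by metis
next
  assume X: "X \<in> Obj C \<and> Idm C X = Zero C X X"
  have "\<exists>!f. f \<in> Hom C Y X" if Y: "Y \<in> Obj C" for Y
  proof (rule ex1I[of _ "Zero C Y X"])
    show "Zero C Y X \<in> Hom C Y X" using zero_arr X Y arr_hom by blast
    show "f = Zero C Y X" if "f \<in> Hom C Y X" for f
      using idl[of f Y X] zero_comp[of f Y X X] arrI[of Y X f] that X Y by simp
  qed
  moreover have "\<exists>!f. f \<in> Hom C X Y" if Y: "Y \<in> Obj C" for Y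
  proof (rule ex1I[of _ "Zero C X Y"])
    show "Zero C X Y \<in> Hom C X Y" using zero_arr X Y arr_hom by blast
    show "f = Zero C X Y" if "f \<in> Hom C X Y" for f
      using idr[of f X Y] comp_zero[of f X Y X] arrI[of X Y f] that X Y by simp
  qed
  ultimately show "is_zero_object C X"
    unfolding is_zero_object_def using X by blast
qed

lemma hom_zero_iff_perp: "X \<in> Obj C \<Longrightarrow> Y \<in> Obj C \<Longrightarrow> Hom C X Y = {Zero C X Y} \<longleftrightarrow> X \<perp> Y"
  using zero_arr[of X Y] unfolding perp_def arr_def by blast

end

section \<open>Exactness in triangulated categories\<close>

lemma shift_class_1: "shift_class C 1 D = ShO C ` D"
  by (simp add: shift_class_def shift_obj_def)

context triangulated_category
begin

lemma sh_obj: "X \<in> Obj C \<Longrightarrow> ShO C X \<in> Obj C"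
  using shift_bij by (auto simp: bij_betw_def)

lemma sh_inj: "X \<in> Obj C \<Longrightarrow> Y \<in> Obj C \<Longrightarrow> ShO C X = ShO C Y \<Longrightarrow> X = Y"
  using shift_bij by (auto simp: bij_betw_def inj_on_def)

lemma sh_surj:
  assumes "X \<in> Obj C" obtains Y where "Y \<in> Obj C" "X = ShO C Y"
  using shift_bij assms by (auto simp: bij_betw_def)

lemma sh_arr: "\<guillemotleft>f : X \<rightarrow> Y\<guillemotright> \<Longrightarrow> \<guillemotleft>ShM C f : ShO C X \<rightarrow> ShO C Y\<guillemotright>"
  using shift_hom_bij[of X Y] sh_obj by (auto simp: arr_def bij_betw_def)

lemma sh_arr_inj: "\<guillemotleft>f : X \<rightarrow> Y\<guillemotright> \<Longrightarrow> \<guillemotleft>g : X \<rightarrow> Y\<guillemotright> \<Longrightarrow> ShM C f = ShM C g \<Longrightarrow> f = g"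
  using shift_hom_bij[of X Y] sh_obj by (auto simp: arr_def bij_betw_def inj_on_def)

lemma sh_arr_surj:
  assumes "X \<in> Obj C" "Y \<in> Obj C" "\<guillemotleft>f : ShO C X \<rightarrow> ShO C Y\<guillemotright>"
  obtains g where "\<guillemotleft>g : X \<rightarrow> Y\<guillemotright>" "f = ShM C g"
  using shift_hom_bij[OF assms(1,2)] assms by (auto simp: arr_def bij_betw_def)

lemma sh_comp: "\<guillemotleft>f : X \<rightarrow> Y\<guillemotright> \<Longrightarrow> \<guillemotleft>g : Y \<rightarrow> Z\<guillemotright> \<Longrightarrow> ShM C (g \<bullet> f) = ShM C g \<bullet> ShM C f"
  by (auto simp: arr_def intro: shift_comp)

lemma sh_zero: "X \<in> Obj C \<Longrightarrow> Y \<in> Obj C \<Longrightarrow> ShM C (Zero C X Y) = Zero C (ShO C X) (ShO C Y)"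
  by (metis add_eq_right_iff add_zero arr_def sh_arr shift_add zero_arr)

lemma sh_perp_iff: "X \<in> Obj C \<Longrightarrow> Y \<in> Obj C \<Longrightarrow> ShO C X \<perp> ShO C Y \<longleftrightarrow> X \<perp> Y"
  unfolding perp_def by (metis sh_arr sh_arr_inj sh_arr_surj sh_zero zero_arr)

lemma sh_zero_object: "is_zero_object C Z \<Longrightarrow> is_zero_object C (ShO C Z)"
  unfolding zero_object_iff by (metis sh_obj sh_zero shift_id)

lemma tri_arr:
  assumes "(X, Y, Z, f, g, h) \<in> Tri C"
  shows "\<guillemotleft>f : X \<rightarrow> Y\<guillemotright>" "\<guillemotleft>g : Y \<rightarrow> Z\<guillemotright>" "\<guillemotleft>h : Z \<rightarrow> ShO C X\<guillemotright>"
  using tri_is_triangle[OF assms] sh_obj by (auto simp: is_triangle_def arr_def)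

lemma tri_triangle:
  "\<guillemotleft>f : X \<rightarrow> Y\<guillemotright> \<Longrightarrow> \<guillemotleft>g : Y \<rightarrow> Z\<guillemotright> \<Longrightarrow> \<guillemotleft>h : Z \<rightarrow> ShO C X\<guillemotright> \<Longrightarrow> is_triangle C (X, Y, Z, f, g, h)"
  by (auto simp: is_triangle_def arr_def)

lemma tri_rot:
  assumes "(X, Y, Z, f, g, h) \<in> Tri C"
  shows "(Y, Z, ShO C X, g, h, neg (ShO C X) (ShO C Y) (ShM C f)) \<in> Tri C"
  using tri_rotate[OF tri_is_triangle[OF assms]] assms by (simp add: neg_def)

lemma tri_fill:
  assumes "(X, Y, Z, f, g, h) \<in> Tri C" "(X', Y', Z', f', g', h') \<in> Tri C"
    and "\<guillemotleft>a : X \<rightarrow> X'\<guillemotright>" "\<guillemotleft>b : Y \<rightarrow> Y'\<guillemotright>" "b \<bullet> f = f' \<bullet> a"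
  obtains c where "\<guillemotleft>c : Z \<rightarrow> Z'\<guillemotright>" "c \<bullet> g = g' \<bullet> b" "ShM C a \<bullet> h = h' \<bullet> c"
  using tri_morphism[OF assms(1,2), of a b] assms(3-) tri_arr[OF assms(1)] tri_arr[OF assms(2)]
  by (auto simp: triangle_hom_def arr_def)

lemma tri_comp_zero:
  assumes "(X, Y, Z, f, g, h) \<in> Tri C"
  shows "g \<bullet> f = Zero C X Z"
proof -
  note a = tri_arr[OF assms]
  obtain N where N: "is_zero_object C N" using zero_object_ex by blast
  have X: "X \<in> Obj C" using a arr_dom by blast
  obtain c where "\<guillemotleft>c : N \<rightarrow> Z\<guillemotright>" "c \<bullet> Zero C X N = g \<bullet> f"
    using tri_fill[OF tri_trivial[OF X N] assms idm_arr[OF X] a(1)] by auto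
  then show ?thesis using comp_zero X by metis
qed

text \<open>
  Exactness of \<open>Hom(W,-)\<close> in the middle term: a square from the rotated trivial triangle on \<open>W\<close> to the
  rotated given triangle is completed by a map \<open>W[1] \<rightarrow> X[1]\<close>, which is the shift of the wanted one.
\<close>

lemma tri_lift:
  assumes T: "(X, Y, Z, f, g, h) \<in> Tri C" and u: "\<guillemotleft>u : W \<rightarrow> Y\<guillemotright>" "g \<bullet> u = Zero C W Z"
  obtains v where "\<guillemotleft>v : W \<rightarrow> X\<guillemotright>" "f \<bullet> v = u"
proof -
  note a = tri_arr[OF T]
  obtain N where N: "is_zero_object C N" using zero_object_ex by blast
  have ob: "W \<in> Obj C" "X \<in> Obj C" "Y \<in> Obj C" "Z \<in> Obj C" "N \<in> Obj C"
    using a u N arr_dom arr_cod zero_object_obj by blast+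
  have "Zero C N Z \<bullet> Zero C W N = g \<bullet> u"
    using zero_comp[OF zero_arr[OF ob(1,5)] ob(4)] u(2) by simp
  then obtain c where c: "\<guillemotleft>c : ShO C W \<rightarrow> ShO C X\<guillemotright>"
    "ShM C u \<bullet> neg (ShO C W) (ShO C W) (ShM C (Idm C W)) = neg (ShO C X) (ShO C Y) (ShM C f) \<bullet> c"
    by (rule tri_fill[OF tri_rot[OF tri_trivial[OF ob(1) N]] tri_rot[OF T] u(1) zero_arr[OF ob(5,4)]])
  obtain v where v: "\<guillemotleft>v : W \<rightarrow> X\<guillemotright>" "c = ShM C v"
    using sh_arr_surj c ob by blast
  note fv = comp_arr[OF v(1) a(1)]
  have "neg (ShO C W) (ShO C Y) (ShM C u) = neg (ShO C W) (ShO C Y) (ShM C (f \<bullet> v))"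
    using c(2) comp_neg[OF sh_arr[OF idm_arr[OF ob(1)]] sh_arr[OF u(1)]] idr[OF sh_arr[OF u(1)]]
      neg_comp[OF sh_arr[OF v(1)] sh_arr[OF a(1)]] sh_comp[OF v(1) a(1)]
    by (simp add: shift_id ob v(2))
  then have "ShM C u = ShM C (f \<bullet> v)"
    using neg_neg[OF sh_arr[OF u(1)]] neg_neg[OF sh_arr[OF fv]] by metis
  then show thesis
    using that[OF v(1)] sh_arr_inj[OF u(1) fv] by simp
qed

text \<open>
  Exactness of \<open>Hom(-,W)\<close>, dually: the square now ends in the triangle \<open>0 \<rightarrow> W \<rightarrow> W\<close>.
\<close>

lemma tri_extend:
  assumes T: "(X, Y, Z, f, g, h) \<in> Tri C" and u: "\<guillemotleft>u : Y \<rightarrow> W\<guillemotright>" "u \<bullet> f = Zero C X W"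
  obtains v where "\<guillemotleft>v : Z \<rightarrow> W\<guillemotright>" "v \<bullet> g = u"
proof -
  note a = tri_arr[OF T]
  obtain N where N: "is_zero_object C N" using zero_object_ex by blast
  have ob: "W \<in> Obj C" "X \<in> Obj C" "Y \<in> Obj C" "Z \<in> Obj C" "N \<in> Obj C"
    using a u N arr_dom arr_cod zero_object_obj by blast+
  have t: "is_triangle C (N, W, W, Zero C N W, Idm C W, Zero C W (ShO C N))"
    by (intro tri_triangle zero_arr idm_arr ob sh_obj)
  have "(W, W, ShO C N, Idm C W, Zero C W (ShO C N), neg (ShO C N) (ShO C W) (ShM C (Zero C N W))) \<in> Tri C"
    using tri_trivial[OF ob(1) sh_zero_object[OF N]] ob by (simp add: sh_zero neg_zero sh_obj)
  then have T2: "(N, W, W, Zero C N W, Idm C W, Zero C W (ShO C N)) \<in> Tri C"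
    using tri_rotate[OF t] by (simp add: neg_def)
  have "u \<bullet> f = Zero C N W \<bullet> Zero C X N"
    using zero_comp[OF zero_arr[OF ob(2,5)] ob(1)] u(2) by simp
  then obtain c where "\<guillemotleft>c : Z \<rightarrow> W\<guillemotright>" "c \<bullet> g = Idm C W \<bullet> u"
    by (rule tri_fill[OF T T2 zero_arr[OF ob(2,5)] u(1)])
  then show thesis using that idl[OF u(1)] by simp
qed

text \<open>
  Rotating three times shifts the triangle and changes the sign of all three maps; the isomorphism
  that is \<open>-1\<close> on the middle term removes the signs of the first two.
\<close>

lemma tri_shift:
  assumes T: "(X, Y, Z, f, g, h) \<in> Tri C"
  obtains h' where "(ShO C X, ShO C Y, ShO C Z, ShM C f, ShM C g, h') \<in> Tri C"
proof -
  note a = tri_arr[OF T]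
  have ob: "ShO C X \<in> Obj C" "ShO C Y \<in> Obj C" "ShO C Z \<in> Obj C"
    using a arr_dom arr_cod sh_obj by blast+
  let ?f = "neg (ShO C X) (ShO C Y) (ShM C f)" and ?g = "neg (ShO C Y) (ShO C Z) (ShM C g)"
    and ?h = "neg (ShO C Z) (ShO C (ShO C X)) (ShM C h)"
    and ?n = "neg (ShO C Y) (ShO C Y) (Idm C (ShO C Y))"
  have R: "(ShO C X, ShO C Y, ShO C Z, ?f, ?g, ?h) \<in> Tri C"
    using tri_rot[OF tri_rot[OF tri_rot[OF T]]] .
  note b = tri_arr[OF R] and s = sh_arr[OF a(1)] sh_arr[OF a(2)] sh_arr[OF a(3)]
  have n: "\<guillemotleft>?n : ShO C Y \<rightarrow> ShO C Y\<guillemotright>" using neg_arr idm_arr ob by blast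
  have nn: "?n \<bullet> ?n = Idm C (ShO C Y)"
    using neg_comp[OF n idm_arr[OF ob(2)]] idl[OF n] neg_neg[OF idm_arr[OF ob(2)]] by simp
  have "triangle_hom C (ShO C X, ShO C Y, ShO C Z, ?f, ?g, ?h)
      (ShO C X, ShO C Y, ShO C Z, ShM C f, ShM C g, ?h) (Idm C (ShO C X)) ?n (Idm C (ShO C Z))"
  proof -
    have "?n \<bullet> ?f = ShM C f \<bullet> Idm C (ShO C X)"
      using neg_comp[OF b(1) idm_arr[OF ob(2)]] idl[OF b(1)] neg_neg[OF s(1)] idr[OF s(1)] by simp
    moreover have "Idm C (ShO C Z) \<bullet> ?g = ShM C g \<bullet> ?n"
      using comp_neg[OF idm_arr[OF ob(2)] s(2)] idl[OF b(2)] idr[OF s(2)] by simp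
    moreover have "ShM C (Idm C (ShO C X)) \<bullet> ?h = ?h \<bullet> Idm C (ShO C Z)"
      using idl[OF b(3)] idr[OF b(3)] shift_id[OF ob(1)] by simp
    ultimately show ?thesis
      using n idm_arr ob by (auto simp: triangle_hom_def arr_def)
  qed
  moreover have "is_iso C (ShO C Y) (ShO C Y) ?n"
    using n nn unfolding is_iso_def arr_def by blast
  moreover have "is_iso C W W (Idm C W)" if "W \<in> Obj C" for W
    using that idm_arr[OF that] idl[OF idm_arr[OF that]] unfolding is_iso_def arr_def by blast
  ultimately have "triangle_iso C (ShO C X, ShO C Y, ShO C Z, ?f, ?g, ?h)
      (ShO C X, ShO C Y, ShO C Z, ShM C f, ShM C g, ?h)"
    unfolding triangle_iso_def using ob by blast
  then show thesis
    using that tri_iso_closed[OF R] tri_triangle s b(3) by blast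
qed

text \<open>
  Each of the following closure properties reads off one exact piece of the long sequence of a
  functor \<open>Hom(W,-)\<close> or \<open>Hom(-,W)\<close>.  Those for the fibre are stated with \<open>W[1]\<close> instead of a negative
  shift of the cone.
\<close>

lemma perp_middle:
  assumes T: "(X, Y, Z, f, g, h) \<in> Tri C" and "W \<perp> X" "W \<perp> Z"
  shows "W \<perp> Y"
  unfolding perp_def
proof (intro allI impI)
  fix u assume u: "\<guillemotleft>u : W \<rightarrow> Y\<guillemotright>"
  note a = tri_arr[OF T]
  have "g \<bullet> u = Zero C W Z" using perpD[OF assms(3) comp_arr[OF u a(2)]] .
  then obtain v where v: "\<guillemotleft>v : W \<rightarrow> X\<guillemotright>" "f \<bullet> v = u"
    using tri_lift[OF T u] by blast
  then show "u = Zero C W Y"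
    using perpD[OF assms(2) v(1)] comp_zero[OF a(1) arr_dom[OF u]] by simp
qed

lemma middle_perp:
  assumes T: "(X, Y, Z, f, g, h) \<in> Tri C" and "X \<perp> W" "Z \<perp> W"
  shows "Y \<perp> W"
  unfolding perp_def
proof (intro allI impI)
  fix u assume u: "\<guillemotleft>u : Y \<rightarrow> W\<guillemotright>"
  note a = tri_arr[OF T]
  have "u \<bullet> f = Zero C X W" using perpD[OF assms(2) comp_arr[OF a(1) u]] .
  then obtain v where v: "\<guillemotleft>v : Z \<rightarrow> W\<guillemotright>" "v \<bullet> g = u"
    using tri_extend[OF T u] by blast
  then show "u = Zero C Y W"
    using perpD[OF assms(3) v(1)] zero_comp[OF a(2) arr_cod[OF u]] by simp
qed

lemma cone_perp:
  assumes T: "(X, Y, Z, f, g, h) \<in> Tri C" and "ShO C X \<perp> W" "Y \<perp> W"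
  shows "Z \<perp> W"
  using middle_perp[OF tri_rot[OF T]] assms by blast

lemma perp_cone:
  assumes T: "(X, Y, Z, f, g, h) \<in> Tri C" and "W \<perp> ShO C X" "W \<perp> Y"
  shows "W \<perp> Z"
  using perp_middle[OF tri_rot[OF T]] assms by blast

lemma fibre_perp:
  assumes T: "(X, Y, Z, f, g, h) \<in> Tri C" and W: "W \<in> Obj C" and "Z \<perp> ShO C W" "Y \<perp> W"
  shows "X \<perp> W"
  using middle_perp[OF tri_rot[OF tri_rot[OF T]], of "ShO C W"] assms sh_perp_iff tri_arr[OF T] arr_dom by metis

lemma perp_fibre:
  assumes T: "(X, Y, Z, f, g, h) \<in> Tri C" and W: "W \<in> Obj C" and "ShO C W \<perp> Z" "W \<perp> Y"
  shows "W \<perp> X"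
  using perp_middle[OF tri_rot[OF tri_rot[OF T]], of "ShO C W"] assms sh_perp_iff tri_arr[OF T] arr_dom by metis

text \<open>
  The kernel of \<open>Hom(W,X) \<rightarrow> Hom(W,Y)\<close> comes from \<open>Hom(W[1],Z)\<close>.
\<close>

lemma tri_monic:
  assumes T: "(X, Y, Z, f, g, h) \<in> Tri C" and "ShO C W \<perp> Z"
    and u: "\<guillemotleft>u : W \<rightarrow> X\<guillemotright>" "\<guillemotleft>v : W \<rightarrow> X\<guillemotright>" "f \<bullet> u = f \<bullet> v"
  shows "u = v"
proof (rule left_cancel[OF tri_arr(1)[OF T] u])
  fix d assume d: "\<guillemotleft>d : W \<rightarrow> X\<guillemotright>" "f \<bullet> d = Zero C W Y"
  note a = tri_arr[OF T] and R = tri_rot[OF tri_rot[OF T]]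
  have ob: "W \<in> Obj C" "X \<in> Obj C" "Y \<in> Obj C"
    using a d arr_dom arr_cod by blast+
  have "neg (ShO C X) (ShO C Y) (ShM C f) \<bullet> ShM C d = Zero C (ShO C W) (ShO C Y)"
    using neg_comp[OF sh_arr[OF d(1)] sh_arr[OF a(1)]]
    by (simp add: sh_comp[OF d(1) a(1), symmetric] d(2) sh_zero neg_zero sh_obj ob)
  then obtain e where e: "\<guillemotleft>e : ShO C W \<rightarrow> Z\<guillemotright>" "h \<bullet> e = ShM C d"
    using tri_lift[OF tri_rot[OF tri_rot[OF T]] sh_arr[OF d(1)]] by blast
  then have "ShM C d = ShM C (Zero C W X)"
    using perpD[OF assms(2) e(1)] comp_zero[OF a(3) sh_obj[OF ob(1)]] sh_zero ob by simp
  then show "d = Zero C W X"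
    using sh_arr_inj[OF d(1) zero_arr[OF ob(1,2)]] by simp
qed

text \<open>
  The kernel of \<open>Hom(Z,W) \<rightarrow> Hom(Y,W)\<close> comes from \<open>Hom(X[1],W)\<close>.
\<close>

lemma tri_epic:
  assumes T: "(X, Y, Z, f, g, h) \<in> Tri C" and "ShO C X \<perp> W"
    and u: "\<guillemotleft>u : Z \<rightarrow> W\<guillemotright>" "\<guillemotleft>v : Z \<rightarrow> W\<guillemotright>" "u \<bullet> g = v \<bullet> g"
  shows "u = v"
proof (rule right_cancel[OF tri_arr(2)[OF T] u])
  fix d assume d: "\<guillemotleft>d : Z \<rightarrow> W\<guillemotright>" "d \<bullet> g = Zero C Y W"
  then obtain e where e: "\<guillemotleft>e : ShO C X \<rightarrow> W\<guillemotright>" "e \<bullet> h = d"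
    using tri_extend[OF tri_rot[OF T] d] by blast
  then show "d = Zero C Z W"
    using perpD[OF assms(2) e(1)] zero_comp[OF tri_arr(3)[OF T] arr_cod[OF d(1)]] by simp
qed

lemma unsh_obj: "X \<in> Obj C \<Longrightarrow> shift_obj C (-1) X \<in> Obj C"
  and sh_unsh: "X \<in> Obj C \<Longrightarrow> ShO C (shift_obj C (-1) X) = X"
  using shift_bij inv_into_into[of X "ShO C" "Obj C"] f_inv_into_f[of X "ShO C" "Obj C"]
  by (auto simp: shift_obj_def bij_betw_def)

lemma mem_shift_class_minus:
  assumes "D \<subseteq> Obj C"
  shows "X \<in> shift_class C (-1) D \<longleftrightarrow> X \<in> Obj C \<and> ShO C X \<in> D"
proof
  assume "X \<in> shift_class C (-1) D"
  then show "X \<in> Obj C \<and> ShO C X \<in> D"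
    using assms unsh_obj sh_unsh by (auto simp: shift_class_def)
next
  assume X: "X \<in> Obj C \<and> ShO C X \<in> D"
  then have "X = shift_obj C (-1) (ShO C X)"
    using unsh_obj sh_unsh sh_inj sh_obj by metis
  then show "X \<in> shift_class C (-1) D"
    using X unfolding shift_class_def by blast
qed

lemma unsh_arr:
  assumes "\<guillemotleft>f : X \<rightarrow> Y\<guillemotright>"
  shows "\<guillemotleft>FM (unshift_functor C) X Y f : shift_obj C (-1) X \<rightarrow> shift_obj C (-1) Y\<guillemotright>"
    and "ShM C (FM (unshift_functor C) X Y f) = f"
proof -
  have ob: "X \<in> Obj C" "Y \<in> Obj C" using assms arr_dom arr_cod by blast+
  then have "f \<in> ShM C ` Hom C (shift_obj C (-1) X) (shift_obj C (-1) Y)"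
    using shift_hom_bij[OF unsh_obj unsh_obj, OF ob] sh_unsh arr_hom[OF assms] by (simp add: bij_betw_def)
  then show "\<guillemotleft>FM (unshift_functor C) X Y f : shift_obj C (-1) X \<rightarrow> shift_obj C (-1) Y\<guillemotright>"
    and "ShM C (FM (unshift_functor C) X Y f) = f"
    using ob unsh_obj by (auto simp: arr_def unshift_functor_def inv_into_into f_inv_into_f)
qed

text \<open>
  If the second map vanishes, then the first one has a section; the other condition makes it a
  monomorphism for maps out of \<open>X\<close>, so the section is an inverse.
\<close>

lemma tri_iso_left:
  assumes T: "(X, Y, Z, f, g, h) \<in> Tri C" and "Y \<perp> Z" "ShO C X \<perp> Z"
  shows "is_iso C X Y f"
proof -
  note a = tri_arr[OF T]
  have iY: "\<guillemotleft>Idm C Y : Y \<rightarrow> Y\<guillemotright>" and iX: "\<guillemotleft>Idm C X : X \<rightarrow> X\<guillemotright>"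
    using idm_arr a arr_dom by blast+
  have "g \<bullet> Idm C Y = Zero C Y Z"
    using idr[OF a(2)] perpD[OF assms(2) a(2)] by simp
  then obtain s where s: "\<guillemotleft>s : Y \<rightarrow> X\<guillemotright>" "f \<bullet> s = Idm C Y"
    using tri_lift[OF T iY] by blast
  have "f \<bullet> (s \<bullet> f) = f \<bullet> Idm C X"
    using assoc[OF a(1) s(1) a(1)] s(2) idl[OF a(1)] idr[OF a(1)] by simp
  then have "s \<bullet> f = Idm C X"
    using tri_monic[OF T assms(3) comp_arr[OF a(1) s(1)] iX] by blast
  then show ?thesis using isoI[OF a(1) s(1)] s(2) by blast
qed

lemma tri_iso_right:
  assumes T: "(X, Y, Z, f, g, h) \<in> Tri C" and "X \<perp> Y" "ShO C X \<perp> Z"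
  shows "is_iso C Y Z g"
proof -
  note a = tri_arr[OF T]
  have iY: "\<guillemotleft>Idm C Y : Y \<rightarrow> Y\<guillemotright>" and iZ: "\<guillemotleft>Idm C Z : Z \<rightarrow> Z\<guillemotright>"
    using idm_arr a arr_dom arr_cod by blast+
  have "Idm C Y \<bullet> f = Zero C X Y"
    using idl[OF a(1)] perpD[OF assms(2) a(1)] by simp
  then obtain s where s: "\<guillemotleft>s : Z \<rightarrow> Y\<guillemotright>" "s \<bullet> g = Idm C Y"
    using tri_extend[OF T iY] by blast
  have "(g \<bullet> s) \<bullet> g = Idm C Z \<bullet> g"
    using assoc[OF a(2) s(1) a(2)] s(2) idl[OF a(2)] idr[OF a(2)] by simp
  then have "g \<bullet> s = Idm C Z"
    using tri_epic[OF T assms(3) comp_arr[OF s(1) a(2)] iZ] by blast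
  then show ?thesis using isoI[OF a(2) s(1) s(2)] by blast
qed

lemma tri_first_epic:
  assumes T: "(X, Y, Z, f, g, h) \<in> Tri C" and "Z \<perp> W"
    and u: "\<guillemotleft>u : Y \<rightarrow> W\<guillemotright>" "\<guillemotleft>v : Y \<rightarrow> W\<guillemotright>" "u \<bullet> f = v \<bullet> f"
  shows "u = v"
proof (rule right_cancel[OF tri_arr(1)[OF T] u])
  fix d assume d: "\<guillemotleft>d : Y \<rightarrow> W\<guillemotright>" "d \<bullet> f = Zero C X W"
  then obtain e where e: "\<guillemotleft>e : Z \<rightarrow> W\<guillemotright>" "e \<bullet> g = d"
    using tri_extend[OF T d] by blast
  then show "d = Zero C Y W"
    using perpD[OF assms(2) e(1)] zero_comp[OF tri_arr(2)[OF T] arr_cod[OF d(1)]] by simp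
qed

lemma sh_funpow_obj: "X \<in> Obj C \<Longrightarrow> (ShO C ^^ n) X \<in> Obj C"
  by (induction n) (auto simp: sh_obj)

lemma inv_sh_funpow: "X \<in> Obj C \<Longrightarrow> (inv_into (Obj C) (ShO C) ^^ n) ((ShO C ^^ n) X) = X"
proof (induction n)
  case (Suc n)
  have "inv_into (Obj C) (ShO C) (ShO C ((ShO C ^^ n) X)) = (ShO C ^^ n) X"
    using inv_into_f_f[of "ShO C" "Obj C"] shift_bij sh_funpow_obj[OF Suc.prems]
    by (simp add: bij_betw_def)
  then show ?case using Suc by (simp add: funpow_Suc_right del: funpow.simps) (simp add: funpow_swap1)
qed simp

text \<open>
  Membership in all shifts of a class, with both signs of the shift expressed through \<open>ShO\<close> alone.
\<close>

lemma mem_shift_class_if_unshifted: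
  assumes "D \<subseteq> Obj C" "X \<in> Obj C" and pos: "\<And>n. X \<in> (ShO C ^^ n) ` D" and neg: "\<And>n. (ShO C ^^ n) X \<in> D"
  shows "X \<in> shift_class C i D"
proof (cases "0 \<le> i")
  case True
  then show ?thesis using pos[of "nat i"] by (simp add: shift_class_def shift_obj_def)
next
  case False
  have "X = (inv_into (Obj C) (ShO C) ^^ nat (- i)) ((ShO C ^^ nat (- i)) X)"
    using inv_sh_funpow assms(2) by simp
  then show ?thesis using False neg[of "nat (- i)"] by (auto simp: shift_class_def shift_obj_def)
qed

end

section \<open>t-structures\<close>

locale t_category = triangulated_category C
  for C :: "('o, 'm, 'z) tricat_scheme" (structure) +
  fixes Tle Tge :: "'o set"
  assumes t_str: "t_structure C Tle Tge"
begin

lemma tle_obj: "X \<in> Tle \<Longrightarrow> X \<in> Obj C"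
  and tge_obj: "X \<in> Tge \<Longrightarrow> X \<in> Obj C"
  using t_str by (auto simp: t_structure_def)

lemma tle_unshift:
  assumes "X \<in> Obj C" "ShO C X \<in> Tle"
  shows "X \<in> Tle"
proof -
  have "ShO C X \<in> ShO C ` Tle"
    using t_str assms(2) by (auto simp: t_structure_def shift_class_1)
  then show ?thesis
    using sh_inj[OF assms(1)] tle_obj by auto
qed

lemma tge_shift: "X \<in> Tge \<Longrightarrow> ShO C X \<in> Tge"
  using t_str by (auto simp: t_structure_def shift_class_1)

lemma sh_tge_perp_tle:
  assumes "A \<in> Tge" "Z \<in> Tle"
  shows "ShO C A \<perp> Z"
proof -
  have "Hom C (ShO C A) Z = {Zero C (ShO C A) Z}"
    using t_str assms by (auto simp: t_structure_def shift_class_1 orth_def)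
  then show ?thesis
    using hom_zero_iff_perp assms sh_obj tge_obj tle_obj by simp
qed

lemma tge_perp: "A \<in> Tge \<Longrightarrow> Z \<in> Obj C \<Longrightarrow> ShO C Z \<in> Tle \<Longrightarrow> A \<perp> Z"
  using sh_tge_perp_tle sh_perp_iff tge_obj by blast

lemma tle_iso: "X \<in> Tle \<Longrightarrow> Y \<in> Obj C \<Longrightarrow> is_iso C X Y f \<Longrightarrow> Y \<in> Tle"
  and tge_iso: "X \<in> Tge \<Longrightarrow> Y \<in> Obj C \<Longrightarrow> is_iso C X Y f \<Longrightarrow> Y \<in> Tge"
  using t_str unfolding t_structure_def iso_closed_def by blast+

lemma t_dec_triangle:
  assumes "M \<in> Obj C" "t_dec C Tle Tge M = (L, R, l, r, d)"
  shows "L \<in> Tge" "R \<in> Obj C" "ShO C R \<in> Tle" "(L, M, R, l, r, d) \<in> Tri C"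
proof -
  have "\<exists>T. t_decomposition C Tle Tge M T"
    using t_str assms unfolding t_structure_def by blast
  then have "t_decomposition C Tle Tge M (L, R, l, r, d)"
    unfolding t_dec_def assms(2)[unfolded t_dec_def, symmetric] by (rule someI_ex)
  then show "L \<in> Tge" "R \<in> Obj C" "ShO C R \<in> Tle" "(L, M, R, l, r, d) \<in> Tri C"
    using mem_shift_class_minus[of Tle R] tle_obj by (auto simp: t_decomposition_def)
qed

text \<open>
  If \<open>X\<close> is left orthogonal to \<open>Tle[-1]\<close>, then the second map of its t-decomposition vanishes, so \<open>X\<close> is
  isomorphic to its truncation.  Similar arguments give the characterisations of \<open>Tge[1]\<close>, \<open>Tle\<close> and
  \<open>Tle[-1]\<close> below; they turn closure properties of these classes into exact sequences.
\<close>

lemma tge_iff: "X \<in> Tge \<longleftrightarrow> X \<in> Obj C \<and> (\<forall>Z\<in>Obj C. ShO C Z \<in> Tle \<longrightarrow> X \<perp> Z)"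
proof
  assume X: "X \<in> Obj C \<and> (\<forall>Z\<in>Obj C. ShO C Z \<in> Tle \<longrightarrow> X \<perp> Z)"
  obtain L R l r d where "t_dec C Tle Tge X = (L, R, l, r, d)"
    by (metis prod.exhaust)
  note D = t_dec_triangle[OF conjunct1[OF X] this]
  have "is_iso C L X l"
    using tri_iso_left[OF D(4)] X D sh_tge_perp_tle tle_unshift by blast
  then show "X \<in> Tge" using tge_iso D(1) X by blast
qed (use tge_obj tge_perp in blast)

lemma sh_tge_iff: "X \<in> ShO C ` Tge \<longleftrightarrow> X \<in> Obj C \<and> (\<forall>Z\<in>Tle. X \<perp> Z)"
proof
  assume X: "X \<in> Obj C \<and> (\<forall>Z\<in>Tle. X \<perp> Z)"
  then obtain Y where "Y \<in> Obj C" "X = ShO C Y" using sh_surj by blast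
  then show "X \<in> ShO C ` Tge" using X tge_iff sh_perp_iff by blast
qed (use tge_obj sh_obj sh_tge_perp_tle in blast)

lemma sh_tge_tge: "X \<in> ShO C ` Tge \<Longrightarrow> X \<in> Tge"
  using tge_shift by blast

text \<open>
  The decomposition with respect to the shifted classes, obtained from that of \<open>M[-1]\<close>.
\<close>

lemma t_dec_shift_ex:
  assumes "M \<in> Obj C"
  obtains K Q k q h where "K \<in> ShO C ` Tge" "Q \<in> Tle" "(K, M, Q, k, q, h) \<in> Tri C"
proof -
  obtain M' where M': "M' \<in> Obj C" "M = ShO C M'" using sh_surj assms by blast
  obtain L R l r d where "t_dec C Tle Tge M' = (L, R, l, r, d)"
    by (metis prod.exhaust)
  note D = t_dec_triangle[OF M'(1) this]
  show thesis
    by (rule tri_shift[OF D(4)]) (use D M' that in blast)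
qed

lemma tle_iff: "X \<in> Tle \<longleftrightarrow> X \<in> Obj C \<and> (\<forall>A\<in>Tge. ShO C A \<perp> X)"
proof
  assume X: "X \<in> Obj C \<and> (\<forall>A\<in>Tge. ShO C A \<perp> X)"
  then obtain K Q k q h where D: "K \<in> ShO C ` Tge" "Q \<in> Tle" "(K, X, Q, k, q, h) \<in> Tri C"
    using t_dec_shift_ex by blast
  have "is_iso C X Q q"
    using tri_iso_right[OF D(3)] X D sh_tge_perp_tle sh_tge_tge by blast
  then obtain s where "is_iso C Q X s" using iso_inverse X D(2) tle_obj by metis
  then show "X \<in> Tle" using tle_iso D(2) X by blast
qed (use tle_obj sh_tge_perp_tle in blast)

lemma sh_tle_iff: "X \<in> Obj C \<Longrightarrow> ShO C X \<in> Tle \<longleftrightarrow> (\<forall>A\<in>Tge. A \<perp> X)"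
  using tle_iff sh_perp_iff sh_obj tge_obj by blast

text \<open>
  In a triangle \<open>K \<rightarrow> X \<rightarrow> Q\<close> with \<open>K \<in> Tge[1]\<close> and \<open>Q \<in> Tle\<close>, the map \<open>X \<rightarrow> Q\<close> is the reflection of \<open>X\<close>
  into \<open>Tle\<close>.
\<close>

lemma truncation_factor:
  assumes "(K, X, Q, k, q, h) \<in> Tri C" "K \<in> ShO C ` Tge" "N \<in> Tle" "\<guillemotleft>g : X \<rightarrow> N\<guillemotright>"
  obtains v where "\<guillemotleft>v : Q \<rightarrow> N\<guillemotright>" "v \<bullet> q = g"
proof -
  have "g \<bullet> k = Zero C K N"
    using perpD[OF _ comp_arr[OF tri_arr(1)[OF assms(1)] assms(4)]] assms(2,3) sh_tge_perp_tle by blast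
  then show thesis using tri_extend[OF assms(1,4)] that by blast
qed

lemma truncation_epic:
  assumes "(K, X, Q, k, q, h) \<in> Tri C" "K \<in> ShO C ` Tge" "N \<in> Tle"
    and "\<guillemotleft>u : Q \<rightarrow> N\<guillemotright>" "\<guillemotleft>v : Q \<rightarrow> N\<guillemotright>" "u \<bullet> q = v \<bullet> q"
  shows "u = v"
  using tri_epic[OF assms(1) sh_tge_perp_tle[OF sh_tge_tge]] assms by blast

lemma truncation_tge:
  assumes "(K, X, Q, k, q, h) \<in> Tri C" "K \<in> ShO C ` Tge" "X \<in> Tge"
  shows "Q \<in> Tge"
proof -
  have "Q \<perp> Z" if "Z \<in> Obj C" "ShO C Z \<in> Tle" for Z
    using cone_perp[OF assms(1), of Z] that assms sh_tge_perp_tle[OF sh_tge_tge] tge_perp tle_unshift by blast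
  then show ?thesis
    using tge_iff tri_arr(2)[OF assms(1)] arr_cod by blast
qed

text \<open>
  The cone \<open>K\<close> of \<open>f\<close> is in \<open>Tge\<close>, and its truncation \<open>Q\<close> is a cokernel of \<open>f\<close> among objects of \<open>Tle\<close>.
  An object \<open>P\<close> that is left orthogonal to \<open>Tge[1]\<close> does not notice the fibre of \<open>K \<rightarrow> Q\<close>; so a map from
  \<open>P\<close> killed by \<open>N \<rightarrow> Q\<close> is already killed by \<open>N \<rightarrow> K\<close> and lifts to \<open>M\<close>.  This last clause is what
  projectivity of \<open>H\<^sub>0 P\<close> comes from.
\<close>

lemma heart_cokernel:
  assumes M: "M \<in> Tge" and N: "N \<in> Tge" and f: "\<guillemotleft>f : M \<rightarrow> N\<guillemotright>"
  obtains Q q where "Q \<in> Tle \<inter> Tge" "\<guillemotleft>q : N \<rightarrow> Q\<guillemotright>" "q \<bullet> f = Zero C M Q"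
    and "\<And>Z g. Z \<in> Tle \<Longrightarrow> \<guillemotleft>g : N \<rightarrow> Z\<guillemotright> \<Longrightarrow> g \<bullet> f = Zero C M Z \<Longrightarrow> \<exists>v. \<guillemotleft>v : Q \<rightarrow> Z\<guillemotright> \<and> v \<bullet> q = g"
    and "\<And>Z u v. Z \<in> Tle \<Longrightarrow> \<guillemotleft>u : Q \<rightarrow> Z\<guillemotright> \<Longrightarrow> \<guillemotleft>v : Q \<rightarrow> Z\<guillemotright> \<Longrightarrow> u \<bullet> q = v \<bullet> q \<Longrightarrow> u = v"
    and "\<And>P u. \<forall>A\<in>Tge. P \<perp> ShO C A \<Longrightarrow> \<guillemotleft>u : P \<rightarrow> N\<guillemotright> \<Longrightarrow> q \<bullet> u = Zero C P Q
      \<Longrightarrow> \<exists>v. \<guillemotleft>v : P \<rightarrow> M\<guillemotright> \<and> f \<bullet> v = u"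
proof -
  obtain K n c where T: "(M, N, K, f, n, c) \<in> Tri C"
    using tri_cone_ex f unfolding arr_def by blast
  note a = tri_arr[OF T]
  have K: "K \<in> Tge"
  proof -
    have "K \<perp> Z" if "Z \<in> Obj C" "ShO C Z \<in> Tle" for Z
      using cone_perp[OF T, of Z] that M N sh_tge_perp_tle tge_perp tle_unshift by blast
    then show ?thesis using tge_iff a(2) arr_cod by blast
  qed
  obtain K' Q k q h where D: "K' \<in> ShO C ` Tge" "Q \<in> Tle" "(K', K, Q, k, q, h) \<in> Tri C"
    using t_dec_shift_ex tge_obj[OF K] by blast
  note b = tri_arr[OF D(3)]
  show thesis
  proof (rule that[of Q "q \<bullet> n"])
    show "Q \<in> Tle \<inter> Tge" using truncation_tge D K by blast
    show qn: "\<guillemotleft>q \<bullet> n : N \<rightarrow> Q\<guillemotright>" using comp_arr a b by blast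
    show "(q \<bullet> n) \<bullet> f = Zero C M Q"
      using assoc[OF f a(2) b(2)] tri_comp_zero[OF T] comp_zero[OF b(2) tge_obj[OF M]] by simp
    show "\<exists>v. \<guillemotleft>v : Q \<rightarrow> Z\<guillemotright> \<and> v \<bullet> (q \<bullet> n) = g"
      if Z: "Z \<in> Tle" and g: "\<guillemotleft>g : N \<rightarrow> Z\<guillemotright>" "g \<bullet> f = Zero C M Z" for Z g
    proof -
      obtain w where w: "\<guillemotleft>w : K \<rightarrow> Z\<guillemotright>" "w \<bullet> n = g" using tri_extend[OF T g] by blast
      obtain v where v: "\<guillemotleft>v : Q \<rightarrow> Z\<guillemotright>" "v \<bullet> q = w"
        using truncation_factor[OF D(3,1) Z w(1)] by blast
      then show ?thesis using assoc[OF a(2) b(2) v(1)] w(2) by auto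
    qed
    show "u = v" if Z: "Z \<in> Tle" and u: "\<guillemotleft>u : Q \<rightarrow> Z\<guillemotright>" and v: "\<guillemotleft>v : Q \<rightarrow> Z\<guillemotright>"
      and e: "u \<bullet> (q \<bullet> n) = v \<bullet> (q \<bullet> n)" for Z u v
    proof -
      have "(u \<bullet> q) \<bullet> n = (v \<bullet> q) \<bullet> n"
        using e assoc[OF a(2) b(2) u] assoc[OF a(2) b(2) v] by simp
      then have "u \<bullet> q = v \<bullet> q"
        using tri_epic[OF T sh_tge_perp_tle[OF M Z]] comp_arr[OF b(2) u] comp_arr[OF b(2) v] by blast
      then show ?thesis using truncation_epic[OF D(3,1) Z u v] by blast
    qed
    show "\<exists>v. \<guillemotleft>v : P \<rightarrow> M\<guillemotright> \<and> f \<bullet> v = u"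
      if P: "\<forall>A\<in>Tge. P \<perp> ShO C A" and u: "\<guillemotleft>u : P \<rightarrow> N\<guillemotright>" and z: "(q \<bullet> n) \<bullet> u = Zero C P Q" for P u
    proof -
      have "q \<bullet> (n \<bullet> u) = Zero C P Q" using assoc[OF u a(2) b(2)] z by simp
      then obtain t where t: "\<guillemotleft>t : P \<rightarrow> K'\<guillemotright>" "k \<bullet> t = n \<bullet> u"
        using tri_lift[OF D(3) comp_arr[OF u a(2)]] by blast
      have "P \<perp> K'" using P D(1) by blast
      then have "n \<bullet> u = Zero C P K"
        using perpD[of P K' t] t comp_zero[OF b(1) arr_dom[OF u]] by simp
      then show ?thesis using tri_lift[OF T u] by blast
    qed
  qed
qed

text \<open>
  A right orthogonal class is closed under products, since a map into a product with zero components
  is zero.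
\<close>

lemma tle_product:
  assumes "is_product C I X P p" "\<forall>i\<in>I. X i \<in> Tle"
  shows "P \<in> Tle"
proof -
  have P: "P \<in> Obj C" and p: "\<And>i. i \<in> I \<Longrightarrow> \<guillemotleft>p i : P \<rightarrow> X i\<guillemotright>"
    using assms(1) unfolding is_product_def arr_def by blast+
  have "f = Zero C (ShO C A) P" if A: "A \<in> Tge" and f: "\<guillemotleft>f : ShO C A \<rightarrow> P\<guillemotright>" for A f
  proof -
    let ?z = "\<lambda>i. Zero C (ShO C A) (X i)"
    have Ao: "ShO C A \<in> Obj C" using arr_dom[OF f] .
    have z: "?z i \<in> Hom C (ShO C A) (X i)" if "i \<in> I" for i
      using zero_arr[OF Ao arr_cod[OF p[OF that]]] arr_hom by blast
    let ?Q = "\<lambda>f. f \<in> Hom C (ShO C A) P \<and> (\<forall>i\<in>I. p i \<bullet> f = ?z i)"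
    have ex1: "\<exists>!f. ?Q f"
      using assms(1)[unfolded is_product_def, THEN conjunct2, THEN conjunct2, THEN bspec[OF _ Ao], THEN spec[of _ ?z]] z
      by blast
    have "p i \<bullet> f = ?z i" if "i \<in> I" for i
      using perpD[OF sh_tge_perp_tle[OF A] comp_arr[OF f p[OF that]]] assms(2) that by blast
    then have f0: "?Q f" using arr_hom[OF f] by blast
    have "?Q (Zero C (ShO C A) P)"
      using comp_zero[OF p Ao] arr_hom[OF zero_arr[OF Ao P]] by blast
    with f0 ex1 show ?thesis by (elim ex1E) metis
  qed
  then show ?thesis using tle_iff P unfolding perp_def by blast
qed

section \<open>The functor \<open>H\<^sub>0\<close> and its unit\<close>

abbreviation LO :: "'o \<Rightarrow> 'o" where "LO \<equiv> FO (Lt C Tle Tge)"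
abbreviation RO :: "'o \<Rightarrow> 'o" where "RO \<equiv> FO (Rt C Tle Tge)"
abbreviation HO :: "'o \<Rightarrow> 'o" where "HO \<equiv> FO (H0 C Tle Tge)"

definition l_map :: "'o \<Rightarrow> 'm" where
  "l_map M = (case t_dec C Tle Tge M of (L, R, l, r, d) \<Rightarrow> l)"

definition r_map :: "'o \<Rightarrow> 'm" where
  "r_map M = (case t_dec C Tle Tge M of (L, R, l, r, d) \<Rightarrow> r)"

lemma lr_triangle:
  assumes "M \<in> Obj C"
  shows "LO M \<in> Tge" "RO M \<in> Obj C" "ShO C (RO M) \<in> Tle"
    and "\<exists>d. (LO M, M, RO M, l_map M, r_map M, d) \<in> Tri C"
proof -
  obtain L R l r d where "t_dec C Tle Tge M = (L, R, l, r, d)"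
    by (metis prod.exhaust)
  with t_dec_triangle[OF assms this] show "LO M \<in> Tge" "RO M \<in> Obj C" "ShO C (RO M) \<in> Tle"
    "\<exists>d. (LO M, M, RO M, l_map M, r_map M, d) \<in> Tri C"
    by (auto simp: Lt_def Rt_def l_map_def r_map_def)
qed

text \<open>
  The unique existence behind the definite description in \<open>Lt\<close>: the obstruction to lifting and the
  ambiguity of a lift lie in groups of maps from \<open>Tge\<close> to \<open>Tle[-1]\<close> and from \<open>Tge[1]\<close> to \<open>Tle[-1]\<close>.
\<close>

lemma Lt_map:
  assumes f: "\<guillemotleft>f : M \<rightarrow> N\<guillemotright>"
  shows "\<guillemotleft>FM (Lt C Tle Tge) M N f : LO M \<rightarrow> LO N\<guillemotright>"
    and "l_map N \<bullet> FM (Lt C Tle Tge) M N f = f \<bullet> l_map M"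
proof -
  note M = arr_dom[OF f] and N = arr_cod[OF f]
  note DM = lr_triangle[OF M] and DN = lr_triangle[OF N]
  obtain d d' where TM: "(LO M, M, RO M, l_map M, r_map M, d) \<in> Tri C"
    and TN: "(LO N, N, RO N, l_map N, r_map N, d') \<in> Tri C"
    using DM DN by blast
  note a = tri_arr[OF TM] and b = tri_arr[OF TN]
  let ?P = "\<lambda>g. g \<in> Hom C (LO M) (LO N) \<and> l_map N \<bullet> g = f \<bullet> l_map M"
  have "r_map N \<bullet> (f \<bullet> l_map M) = Zero C (LO M) (RO N)"
    using perpD[OF tge_perp comp_arr[OF comp_arr[OF a(1) f] b(2)]] DM DN by blast
  then obtain g where g: "\<guillemotleft>g : LO M \<rightarrow> LO N\<guillemotright>" "l_map N \<bullet> g = f \<bullet> l_map M"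
    using tri_lift[OF TN comp_arr[OF a(1) f]] by blast
  have u: "g' = g" if "?P g'" for g'
  proof (rule tri_monic[OF TN])
    show "ShO C (LO M) \<perp> RO N" using DM DN sh_tge_perp_tle tle_unshift by blast
  qed (use that g arrI[OF tge_obj tge_obj, OF DM(1) DN(1)] in auto)
  have "?P (THE g. ?P g)"
    by (rule theI[of ?P, OF _ u]) (use g arr_hom in auto)
  moreover have "FM (Lt C Tle Tge) M N f = (THE g. ?P g)"
    by (simp add: Lt_def l_map_def Let_def)
  ultimately show "\<guillemotleft>FM (Lt C Tle Tge) M N f : LO M \<rightarrow> LO N\<guillemotright>"
    and "l_map N \<bullet> FM (Lt C Tle Tge) M N f = f \<bullet> l_map M"
    using DM DN tge_obj by (auto simp: arr_def)
qed

lemma Rt_map: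
  assumes f: "\<guillemotleft>f : M \<rightarrow> N\<guillemotright>"
  shows "\<guillemotleft>FM (Rt C Tle Tge) M N f : RO M \<rightarrow> RO N\<guillemotright>"
    and "FM (Rt C Tle Tge) M N f \<bullet> r_map M = r_map N \<bullet> f"
proof -
  note M = arr_dom[OF f] and N = arr_cod[OF f]
  note DM = lr_triangle[OF M] and DN = lr_triangle[OF N]
  obtain d d' where TM: "(LO M, M, RO M, l_map M, r_map M, d) \<in> Tri C"
    and TN: "(LO N, N, RO N, l_map N, r_map N, d') \<in> Tri C"
    using DM DN by blast
  note a = tri_arr[OF TM] and b = tri_arr[OF TN]
  let ?P = "\<lambda>g. g \<in> Hom C (RO M) (RO N) \<and> g \<bullet> r_map M = r_map N \<bullet> f"
  have "(r_map N \<bullet> f) \<bullet> l_map M = Zero C (LO M) (RO N)"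
    using perpD[OF tge_perp comp_arr[OF a(1) comp_arr[OF f b(2)]]] DM DN by blast
  then obtain g where g: "\<guillemotleft>g : RO M \<rightarrow> RO N\<guillemotright>" "g \<bullet> r_map M = r_map N \<bullet> f"
    using tri_extend[OF TM comp_arr[OF f b(2)]] by blast
  have u: "g' = g" if "?P g'" for g'
  proof (rule tri_epic[OF TM])
    show "ShO C (LO M) \<perp> RO N" using DM DN sh_tge_perp_tle tle_unshift by blast
  qed (use that g arrI[OF DM(2) DN(2)] in auto)
  have "?P (THE g. ?P g)"
    by (rule theI[of ?P, OF _ u]) (use g arr_hom in auto)
  moreover have "FM (Rt C Tle Tge) M N f = (THE g. ?P g)"
    by (simp add: Rt_def r_map_def Let_def)
  ultimately show "\<guillemotleft>FM (Rt C Tle Tge) M N f : RO M \<rightarrow> RO N\<guillemotright>"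
    and "FM (Rt C Tle Tge) M N f \<bullet> r_map M = r_map N \<bullet> f"
    using DM DN by (auto simp: arr_def)
qed

text \<open>
  Since \<open>H\<^sub>0\<close> is defined by truncating \<open>L\<^sub>t M\<close> after unshifting it, the canonical maps form a zigzag
  \<open>M \<leftarrow> L\<^sub>t M \<rightarrow> H\<^sub>0 M\<close>, whose right-hand leg is \<open>q_map M\<close>.
\<close>

definition q_map :: "'o \<Rightarrow> 'm" where
  "q_map M = ShM C (r_map (shift_obj C (-1) (LO M)))"

lemma H0_obj: "HO M = ShO C (RO (shift_obj C (-1) (LO M)))"
  by (simp add: H0_def comp_functor_def shift_functor_def unshift_functor_def)

lemma q_triangle:
  assumes "M \<in> Obj C"
  obtains K k h where "K \<in> ShO C ` Tge" "HO M \<in> Tle" "(K, LO M, HO M, k, q_map M, h) \<in> Tri C"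
proof -
  let ?U = "shift_obj C (-1) (LO M)"
  have L: "LO M \<in> Obj C" using lr_triangle(1)[OF assms] tge_obj by blast
  then have U: "?U \<in> Obj C" "ShO C ?U = LO M" using unsh_obj sh_unsh by blast+
  obtain d where T: "(LO ?U, ?U, RO ?U, l_map ?U, r_map ?U, d) \<in> Tri C"
    using lr_triangle(4)[OF U(1)] by blast
  obtain h where "(ShO C (LO ?U), LO M, HO M, ShM C (l_map ?U), q_map M, h) \<in> Tri C"
    using tri_shift[OF T] U(2) unfolding H0_obj q_map_def by auto
  then show thesis using that lr_triangle[OF U(1)] unfolding H0_obj by blast
qed

lemma H0_map:
  assumes f: "\<guillemotleft>f : M \<rightarrow> N\<guillemotright>"
  shows "\<guillemotleft>FM (H0 C Tle Tge) M N f : HO M \<rightarrow> HO N\<guillemotright>"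
    and "FM (H0 C Tle Tge) M N f \<bullet> q_map M = q_map N \<bullet> FM (Lt C Tle Tge) M N f"
proof -
  let ?U = "shift_obj C (-1) (LO M)" and ?V = "shift_obj C (-1) (LO N)"
  let ?l = "FM (Lt C Tle Tge) M N f"
  let ?u = "FM (unshift_functor C) (LO M) (LO N) ?l"
  have e: "FM (H0 C Tle Tge) M N f = ShM C (FM (Rt C Tle Tge) ?U ?V ?u)"
    by (simp add: H0_def comp_functor_def shift_functor_def unshift_functor_def)
  note u = unsh_arr[OF Lt_map(1)[OF f]]
  note R = Rt_map[OF u(1)]
  obtain d d' where T: "(LO ?U, ?U, RO ?U, l_map ?U, r_map ?U, d) \<in> Tri C"
    and T': "(LO ?V, ?V, RO ?V, l_map ?V, r_map ?V, d') \<in> Tri C"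
    using lr_triangle(4)[OF arr_dom[OF u(1)]] lr_triangle(4)[OF arr_cod[OF u(1)]] by blast
  show "\<guillemotleft>FM (H0 C Tle Tge) M N f : HO M \<rightarrow> HO N\<guillemotright>"
    using sh_arr[OF R(1)] unfolding e H0_obj .
  show "FM (H0 C Tle Tge) M N f \<bullet> q_map M = q_map N \<bullet> ?l"
    using sh_comp[OF tri_arr(2)[OF T] R(1)] sh_comp[OF u(1) tri_arr(2)[OF T']] R(2) u(2)
    unfolding e q_map_def by simp
qed

text \<open>
  For \<open>M \<in> Tge\<close> the left-hand leg of the zigzag is invertible.
\<close>

definition l_inv :: "'o \<Rightarrow> 'm" where
  "l_inv M = (SOME g. \<guillemotleft>g : M \<rightarrow> LO M\<guillemotright> \<and> g \<bullet> l_map M = Idm C (LO M) \<and> l_map M \<bullet> g = Idm C M)"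

lemma l_inv:
  assumes "M \<in> Tge"
  shows "\<guillemotleft>l_map M : LO M \<rightarrow> M\<guillemotright>" "is_iso C (LO M) M (l_map M)"
    and "\<guillemotleft>l_inv M : M \<rightarrow> LO M\<guillemotright>" "l_inv M \<bullet> l_map M = Idm C (LO M)" "l_map M \<bullet> l_inv M = Idm C M"
proof -
  have M: "M \<in> Obj C" using assms tge_obj by blast
  note D = lr_triangle[OF M]
  obtain d where T: "(LO M, M, RO M, l_map M, r_map M, d) \<in> Tri C" using D by blast
  show "\<guillemotleft>l_map M : LO M \<rightarrow> M\<guillemotright>" using tri_arr[OF T] by blast
  show i: "is_iso C (LO M) M (l_map M)"
    by (rule tri_iso_left[OF T]) (use D assms tge_perp tge_shift in blast)+
  then have "\<exists>g. \<guillemotleft>g : M \<rightarrow> LO M\<guillemotright> \<and> g \<bullet> l_map M = Idm C (LO M) \<and> l_map M \<bullet> g = Idm C M"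
    using iso_inverse tge_obj D(1) M by metis
  from someI_ex[OF this]
  show "\<guillemotleft>l_inv M : M \<rightarrow> LO M\<guillemotright>" "l_inv M \<bullet> l_map M = Idm C (LO M)" "l_map M \<bullet> l_inv M = Idm C M"
    unfolding l_inv_def by blast+
qed

text \<open>
  The composite along the zigzag; it is the reflection of \<open>M \<in> Tge\<close> into \<open>Tle\<close>.
\<close>

definition t_unit :: "'o \<Rightarrow> 'm" where
  "t_unit M = q_map M \<bullet> l_inv M"

text \<open>
  The truncation triangle of \<open>L\<^sub>t M\<close>, transported along the isomorphism \<open>L\<^sub>t M \<rightarrow> M\<close>.
\<close>

lemma unit_triangle:
  assumes M: "M \<in> Tge"
  obtains K k h where "K \<in> ShO C ` Tge" "HO M \<in> Tle" "(K, M, HO M, k, t_unit M, h) \<in> Tri C"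
proof -
  have Mo: "M \<in> Obj C" using assms tge_obj by blast
  obtain K k h where K: "K \<in> ShO C ` Tge" "HO M \<in> Tle"
    and T: "(K, LO M, HO M, k, q_map M, h) \<in> Tri C"
    using q_triangle[OF Mo] by blast
  note a = tri_arr[OF T] and l = l_inv[OF M]
  have Ko: "K \<in> Obj C" "HO M \<in> Obj C" using a arr_dom arr_cod by blast+
  have u: "\<guillemotleft>t_unit M : M \<rightarrow> HO M\<guillemotright>" unfolding t_unit_def using comp_arr l a by blast
  have "t_unit M \<bullet> l_map M = q_map M"
    unfolding t_unit_def using assoc[OF l(1,3) a(2)] l(4) idr[OF a(2)] by simp
  then have "triangle_hom C (K, LO M, HO M, k, q_map M, h) (K, M, HO M, l_map M \<bullet> k, t_unit M, h)
      (Idm C K) (l_map M) (Idm C (HO M))"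
    using idr[OF comp_arr[OF a(1) l(1)]] idl[OF a(2)] idr[OF a(3)] idl[OF a(3)]
    by (simp add: triangle_hom_def shift_id Ko arr_hom[OF l(1)] id_in_hom)
  moreover have "is_iso C W W (Idm C W)" if "W \<in> Obj C" for W
    using isoI[OF idm_arr idm_arr] idl[OF idm_arr] that by blast
  ultimately have "triangle_iso C (K, LO M, HO M, k, q_map M, h) (K, M, HO M, l_map M \<bullet> k, t_unit M, h)"
    unfolding triangle_iso_def using l(2) Ko by blast
  then have "(K, M, HO M, l_map M \<bullet> k, t_unit M, h) \<in> Tri C"
    using tri_iso_closed[OF T] tri_triangle[OF comp_arr[OF a(1) l(1)] u a(3)] by blast
  then show thesis using that K by blast
qed

lemma unit_natural:
  assumes "M \<in> Tge" "N \<in> Tge" and f: "\<guillemotleft>f : M \<rightarrow> N\<guillemotright>"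
  shows "FM (H0 C Tle Tge) M N f \<bullet> t_unit M = t_unit N \<bullet> f"
proof -
  let ?H = "FM (H0 C Tle Tge) M N f" and ?L = "FM (Lt C Tle Tge) M N f"
  note H = H0_map[OF f] and L = Lt_map[OF f] and m = l_inv[OF assms(1)] and n = l_inv[OF assms(2)]
  have qM: "\<guillemotleft>q_map M : LO M \<rightarrow> HO M\<guillemotright>" and qN: "\<guillemotleft>q_map N : LO N \<rightarrow> HO N\<guillemotright>"
    by (rule q_triangle[OF arr_dom[OF f]], use tri_arr(2) in blast)
      (rule q_triangle[OF arr_cod[OF f]], use tri_arr(2) in blast)
  have "?L \<bullet> l_inv M = (l_inv N \<bullet> l_map N) \<bullet> (?L \<bullet> l_inv M)"
    using n(4) idl[OF comp_arr[OF m(3) L(1)]] by simp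
  also have "\<dots> = l_inv N \<bullet> (l_map N \<bullet> (?L \<bullet> l_inv M))"
    using assoc[OF comp_arr[OF m(3) L(1)] n(1,3)] .
  also have "l_map N \<bullet> (?L \<bullet> l_inv M) = (f \<bullet> l_map M) \<bullet> l_inv M"
    using assoc[OF m(3) L(1) n(1)] L(2) by simp
  also have "\<dots> = f"
    using assoc[OF m(3,1) f] m(5) idr[OF f] by simp
  finally have e: "?L \<bullet> l_inv M = l_inv N \<bullet> f" .
  have "?H \<bullet> t_unit M = (q_map N \<bullet> ?L) \<bullet> l_inv M"
    unfolding t_unit_def using assoc[OF m(3) qM H(1)] H(2) by simp
  also have "\<dots> = q_map N \<bullet> (l_inv N \<bullet> f)"
    using assoc[OF m(3) L(1) qN] e by simp
  also have "\<dots> = t_unit N \<bullet> f"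
    unfolding t_unit_def using assoc[OF f n(3) qN] by simp
  finally show ?thesis .
qed

lemma H0_heart:
  assumes M: "M \<in> Tge"
  shows "HO M \<in> Tle \<inter> Tge"
  by (rule unit_triangle[OF M]) (use truncation_tge M in blast)

lemma unit_arr:
  assumes M: "M \<in> Tge"
  shows "\<guillemotleft>t_unit M : M \<rightarrow> HO M\<guillemotright>"
  by (rule unit_triangle[OF M]) (use tri_arr(2) in blast)

lemma unit_factor:
  assumes "M \<in> Tge" "N \<in> Tle" "\<guillemotleft>g : M \<rightarrow> N\<guillemotright>"
  obtains v where "\<guillemotleft>v : HO M \<rightarrow> N\<guillemotright>" "v \<bullet> t_unit M = g"
proof -
  obtain K k h where K: "K \<in> ShO C ` Tge" and T: "(K, M, HO M, k, t_unit M, h) \<in> Tri C"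
    by (rule unit_triangle[OF assms(1)])
  show thesis
    by (rule truncation_factor[OF T K assms(2,3)]) (rule that)
qed

lemma unit_epic:
  assumes "M \<in> Tge" "N \<in> Tle" "\<guillemotleft>u : HO M \<rightarrow> N\<guillemotright>" "\<guillemotleft>v : HO M \<rightarrow> N\<guillemotright>" "u \<bullet> t_unit M = v \<bullet> t_unit M"
  shows "u = v"
proof -
  obtain K k h where K: "K \<in> ShO C ` Tge" and T: "(K, M, HO M, k, t_unit M, h) \<in> Tri C"
    by (rule unit_triangle[OF assms(1)])
  show ?thesis
    by (rule truncation_epic[OF T K assms(2-)])
qed

text \<open>
  Together with the next lemma: an object left orthogonal to \<open>Tge[1]\<close>, hence also to \<open>Tge[2]\<close>, cannot
  distinguish \<open>M\<close> from \<open>H\<^sub>0 M\<close>, as the fibre of the unit is in \<open>Tge[1]\<close>.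
\<close>

lemma unit_lift:
  assumes M: "M \<in> Tge" and W: "\<forall>A\<in>Tge. W \<perp> ShO C A" and u: "\<guillemotleft>u : W \<rightarrow> HO M\<guillemotright>"
  obtains v where "\<guillemotleft>v : W \<rightarrow> M\<guillemotright>" "t_unit M \<bullet> v = u"
proof -
  obtain K k h where K: "K \<in> ShO C ` Tge" and T: "(K, M, HO M, k, t_unit M, h) \<in> Tri C"
    by (rule unit_triangle[OF M])
  have "W \<perp> ShO C K" using W K tge_shift by blast
  then have "h \<bullet> u = Zero C W (ShO C K)"
    using perpD comp_arr[OF u tri_arr(3)[OF T]] by blast
  then show thesis using tri_lift[OF tri_rot[OF T] u] that by blast
qed

lemma unit_monic:
  assumes M: "M \<in> Tge" and W: "\<forall>A\<in>Tge. W \<perp> ShO C A"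
    and u: "\<guillemotleft>u : W \<rightarrow> M\<guillemotright>" "\<guillemotleft>v : W \<rightarrow> M\<guillemotright>" "t_unit M \<bullet> u = t_unit M \<bullet> v"
  shows "u = v"
proof (rule left_cancel[OF unit_arr[OF M] u])
  obtain K k h where K: "K \<in> ShO C ` Tge" and T: "(K, M, HO M, k, t_unit M, h) \<in> Tri C"
    by (rule unit_triangle[OF M])
  fix d assume d: "\<guillemotleft>d : W \<rightarrow> M\<guillemotright>" "t_unit M \<bullet> d = Zero C W (HO M)"
  obtain e where e: "\<guillemotleft>e : W \<rightarrow> K\<guillemotright>" "k \<bullet> e = d"
    using tri_lift[OF T d] by blast
  have "W \<perp> K" using W K by blast
  then show "d = Zero C W M"
    using perpD[of W K e] e comp_zero[OF tri_arr(1)[OF T] arr_dom[OF d(1)]] by simp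
qed

end

section \<open>A weight structure orthogonal to a t-structure\<close>

lemma full_tri_sub_simps [simp]:
  "Obj (full_tri_sub C D) = D" "Hom (full_tri_sub C D) = Hom C" "Idm (full_tri_sub C D) = Idm C"
  "Comp (full_tri_sub C D) = Comp C" "Zero (full_tri_sub C D) = Zero C" "ShO (full_tri_sub C D) = ShO C"
  "T \<in> Tri (full_tri_sub C D) \<Longrightarrow> T \<in> Tri C"
  by (auto simp: full_tri_sub_def full_sub_def)

lemma full_sub_add_simps [simp]: "Zero (full_sub C D) = Zero C" "Add (full_sub C D) = Add C"
  by (simp_all add: full_sub_def)

locale orthogonal_pair = t_category C Tle Tge
  for C :: "('o, 'm, 'z) tricat_scheme" (structure) and Tle Tge +
  fixes D Wle Wge :: "'o set"
  assumes tri_sub: "triangulated_subcategory C D"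
    and weight: "weight_structure (full_tri_sub C D) Wle Wge"
    and orthogonal: "orthogonal_structures C Wle Wge Tle Tge"
    and heart_sub: "Tle \<inter> Tge \<subseteq> D"
begin

lemma D_obj: "X \<in> D \<Longrightarrow> X \<in> Obj C"
  using tri_sub[unfolded triangulated_subcategory_def, THEN conjunct1] by blast

lemma D_shift:
  assumes "X \<in> D"
  shows "ShO C X \<in> D"
proof -
  have "shift_class C 1 D \<subseteq> D"
    using tri_sub unfolding triangulated_subcategory_def by (elim conjE)
  then show ?thesis using assms by (auto simp: shift_class_1)
qed

lemma wle_D: "P \<in> Wle \<Longrightarrow> P \<in> D" and wge_D: "P \<in> Wge \<Longrightarrow> P \<in> D"
  using weight by (auto simp: weight_structure_def)

lemma wle_obj: "P \<in> Wle \<Longrightarrow> P \<in> Obj C" and wge_obj: "P \<in> Wge \<Longrightarrow> P \<in> Obj C"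
  using wle_D wge_D D_obj by blast+

lemma wle_retract: "P \<in> Wle \<Longrightarrow> X \<in> D \<Longrightarrow> retract C X P \<Longrightarrow> X \<in> Wle"
  and wge_retract: "P \<in> Wge \<Longrightarrow> X \<in> D \<Longrightarrow> retract C X P \<Longrightarrow> X \<in> Wge"
  using weight by (auto simp: weight_structure_def retraction_closed_def retract_def)

lemma wle_unshift:
  assumes "P \<in> Wle" obtains P' where "P' \<in> Wle" "P = ShO C P'"
  using weight assms by (auto simp: weight_structure_def shift_class_1)

lemma wge_shift: "P \<in> Wge \<Longrightarrow> ShO C P \<in> Wge"
  using weight by (auto simp: weight_structure_def shift_class_1)

lemma weight_dec_ex:
  assumes "M \<in> D"
  obtains L R l r d where "L \<in> Wle" "R \<in> Wge" "(L, M, ShO C R, l, r, d) \<in> Tri C"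
proof -
  have "\<forall>M\<in>D. \<exists>L\<in>Wle. \<exists>R\<in>ShO C ` Wge. \<exists>l r d. (L, M, R, l, r, d) \<in> Tri (full_tri_sub C D)"
    using weight unfolding weight_structure_def shift_class_1 full_tri_sub_simps(1,6) by (elim conjE)
  from bspec[OF this assms] obtain L R l r d
    where L: "L \<in> Wle" and R: "R \<in> ShO C ` Wge" and T: "(L, M, R, l, r, d) \<in> Tri (full_tri_sub C D)"
    by (elim bexE exE)
  obtain R' where "R' \<in> Wge" "R = ShO C R'" using R by (elim imageE)
  then show thesis using that[OF L] full_tri_sub_simps(7)[OF T] by simp
qed

lemma wle_perp:
  assumes "P \<in> Wle" "A \<in> Tge"
  shows "P \<perp> ShO C A"
proof -
  have "Hom C P (ShO C A) = {Zero C P (ShO C A)}"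
    using orthogonal assms by (auto simp: orthogonal_structures_def shift_class_1 orth_def)
  then show ?thesis
    using hom_zero_iff_perp assms sh_obj tge_obj wle_obj by simp
qed

lemma wge_perp:
  assumes "P \<in> Wge" "Z \<in> Obj C" "ShO C Z \<in> Tle"
  shows "P \<perp> Z"
proof -
  have "Tle \<subseteq> Obj C" using tle_obj by blast
  then have "Hom C P Z = {Zero C P Z}"
    using orthogonal assms mem_shift_class_minus[of Tle Z] by (auto simp: orthogonal_structures_def orth_def)
  then show ?thesis
    using hom_zero_iff_perp assms wge_obj by simp
qed

lemma wge_tge: "P \<in> Wge \<Longrightarrow> P \<in> Tge"
  using tge_iff wge_perp wge_obj by blast

text \<open>
  \<open>X[1]\<close> is right orthogonal to \<open>Wle\<close>, so the first map of a weight decomposition of \<open>X[1]\<close> vanishes and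
  \<open>X[1]\<close> is a retract of an object of \<open>Wge[1]\<close>.
\<close>

lemma D_tge_wge:
  assumes "X \<in> D" "X \<in> Tge"
  shows "X \<in> Wge"
proof -
  obtain L R l r d where L: "L \<in> Wle" and R: "R \<in> Wge" and T: "(L, ShO C X, ShO C R, l, r, d) \<in> Tri C"
    using weight_dec_ex[OF D_shift[OF assms(1)]] by blast
  note a = tri_arr[OF T]
  have ob: "X \<in> Obj C" "R \<in> Obj C" using assms R D_obj wge_obj by blast+
  have "Idm C (ShO C X) \<bullet> l = Zero C L (ShO C X)"
    using idl[OF a(1)] perpD[OF wle_perp[OF L assms(2)] a(1)] by simp
  then obtain s where s: "\<guillemotleft>s : ShO C R \<rightarrow> ShO C X\<guillemotright>" "s \<bullet> r = Idm C (ShO C X)"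
    using tri_extend[OF T idm_arr[OF sh_obj[OF ob(1)]]] by blast
  obtain r' where r': "\<guillemotleft>r' : X \<rightarrow> R\<guillemotright>" "r = ShM C r'" using sh_arr_surj[OF ob a(2)] by blast
  obtain s' where s': "\<guillemotleft>s' : R \<rightarrow> X\<guillemotright>" "s = ShM C s'" using sh_arr_surj[OF ob(2,1) s(1)] by blast
  have "s' \<bullet> r' = Idm C X"
    using sh_arr_inj[OF comp_arr[OF r'(1) s'(1)] idm_arr[OF ob(1)]] sh_comp[OF r'(1) s'(1)] s(2) r'(2) s'(2)
      shift_id[OF ob(1)] by simp
  then have "retract C X R"
    using arr_hom[OF r'(1)] arr_hom[OF s'(1)] unfolding retract_def by blast
  then show ?thesis using wge_retract R assms(1) by blast
qed

text \<open>
  The weight decomposition of \<open>M\<close>.  Its first term \<open>P\<close> is in \<open>Tge\<close>, as an extension of \<open>M\<close> by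
  \<open>R \<in> Wge \<subseteq> Tge\<close>, and therefore in \<open>Wge\<close>.  This is the one place where the heart of \<open>t\<close> has to be
  contained in \<open>D\<close>.
\<close>

lemma cover_triangle:
  assumes M: "M \<in> Tle \<inter> Tge"
  obtains P R p n c where "P \<in> Wle \<inter> Wge" "R \<in> Tge" "(P, M, ShO C R, p, n, c) \<in> Tri C"
proof -
  obtain P R p n c where P: "P \<in> Wle" and R: "R \<in> Wge" and T: "(P, M, ShO C R, p, n, c) \<in> Tri C"
    using weight_dec_ex M heart_sub by blast
  note RT = wge_tge[OF R]
  have "P \<perp> Z" if Z: "Z \<in> Obj C" "ShO C Z \<in> Tle" for Z
    by (rule fibre_perp[OF T Z(1)]) (use M RT Z sh_tge_perp_tle tge_perp in blast)+
  then have "P \<in> Tge" using tge_iff wle_obj[OF P] by blast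
  then have "P \<in> Wge" using D_tge_wge wle_D[OF P] by blast
  then show thesis using that P RT T by blast
qed

lemma whrt_perp: "P \<in> Wle \<inter> Wge \<Longrightarrow> \<forall>A\<in>Tge. P \<perp> ShO C A"
  using wle_perp by blast

text \<open>
  An idempotent \<open>e\<close> is split by the cokernel of \<open>1 - e\<close>.
\<close>

lemma heart_idempotent_split:
  assumes N: "N \<in> Tle \<inter> Tge" and e: "\<guillemotleft>e : N \<rightarrow> N\<guillemotright>" "e \<bullet> e = e"
  shows "\<exists>Y\<in>Tle \<inter> Tge. \<exists>i p. \<guillemotleft>i : Y \<rightarrow> N\<guillemotright> \<and> \<guillemotleft>p : N \<rightarrow> Y\<guillemotright> \<and> p \<bullet> i = Idm C Y \<and> i \<bullet> p = e"
proof -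
  have i: "\<guillemotleft>Idm C N : N \<rightarrow> N\<guillemotright>" using idm_arr arr_dom[OF e(1)] by blast
  \<comment> \<open>The map \<open>d\<close> is \<open>1 - e\<close>, so \<open>q d = 0\<close> gives \<open>q e = q\<close>.\<close>
  obtain d where d: "\<guillemotleft>d : N \<rightarrow> N\<guillemotright>" and de: "Add C d e = Idm C N"
    using difference_ex[OF i e(1)] by blast
  obtain Q q where Q: "Q \<in> Tle \<inter> Tge" and q: "\<guillemotleft>q : N \<rightarrow> Q\<guillemotright>" and qd: "q \<bullet> d = Zero C N Q"
    and fac: "\<And>Z g. Z \<in> Tle \<Longrightarrow> \<guillemotleft>g : N \<rightarrow> Z\<guillemotright> \<Longrightarrow> g \<bullet> d = Zero C N Z \<Longrightarrow> \<exists>v. \<guillemotleft>v : Q \<rightarrow> Z\<guillemotright> \<and> v \<bullet> q = g"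
    and epic: "\<And>Z u v. Z \<in> Tle \<Longrightarrow> \<guillemotleft>u : Q \<rightarrow> Z\<guillemotright> \<Longrightarrow> \<guillemotleft>v : Q \<rightarrow> Z\<guillemotright> \<Longrightarrow> u \<bullet> q = v \<bullet> q \<Longrightarrow> u = v"
    by (rule heart_cokernel[OF _ _ d]) (use N in auto)
  have qe: "q \<bullet> e = q"
    using add_distrib_left[OF d e(1) q] de qd idr[OF q] add_zero[OF comp_arr[OF e(1) q]] by simp
  have "Add C (e \<bullet> d) e = e"
    using add_distrib_left[OF d e(1) e(1)] de e(2) idr[OF e(1)] by simp
  then have "e \<bullet> d = Zero C N N"
    using add_eq_right_iff[OF comp_arr[OF d e(1)] e(1)] by blast
  then obtain s where s: "\<guillemotleft>s : Q \<rightarrow> N\<guillemotright>" "s \<bullet> q = e"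
    using fac e(1) N by blast
  have "(q \<bullet> s) \<bullet> q = Idm C Q \<bullet> q"
    using assoc[OF q s(1) q] s(2) qe idl[OF q] by simp
  then have "q \<bullet> s = Idm C Q"
    using epic[OF _ comp_arr[OF s(1) q] idm_arr[OF arr_cod[OF q]]] Q by blast
  then show ?thesis using Q q s by blast
qed

text \<open>
  To lift \<open>g : H\<^sub>0 P \<rightarrow> Y\<close> along an epimorphism \<open>f : X \<rightarrow> Y\<close>, lift its restriction to \<open>P\<close>, using that the
  cokernel of \<open>f\<close> is zero, and extend the result back to \<open>H\<^sub>0 P\<close>.
\<close>

lemma H0_projective:
  assumes P: "P \<in> Wle \<inter> Wge"
  shows "projective (full_sub C (Tle \<inter> Tge)) (HO P)"
proof -
  have PT: "P \<in> Tge" using P wge_tge by blast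
  note eta = unit_arr[OF PT] and HP = H0_heart[OF PT]
  have "\<exists>h\<in>Hom C (HO P) X. f \<bullet> h = g"
    if X: "X \<in> Tle \<inter> Tge" and Y: "Y \<in> Tle \<inter> Tge"
      and epi: "is_epi (full_sub C (Tle \<inter> Tge)) X Y f" and g': "g \<in> Hom C (HO P) Y" for X Y f g
  proof -
    have g: "\<guillemotleft>g : HO P \<rightarrow> Y\<guillemotright>" and f: "\<guillemotleft>f : X \<rightarrow> Y\<guillemotright>"
      using g' epi X Y HP tle_obj by (auto simp: arr_def is_epi_def)
    obtain Q q where Q: "Q \<in> Tle \<inter> Tge" and q: "\<guillemotleft>q : Y \<rightarrow> Q\<guillemotright>" and qf: "q \<bullet> f = Zero C X Q"
      and lift: "\<And>P u. \<forall>A\<in>Tge. P \<perp> ShO C A \<Longrightarrow> \<guillemotleft>u : P \<rightarrow> Y\<guillemotright> \<Longrightarrow> q \<bullet> u = Zero C P Q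
        \<Longrightarrow> \<exists>v. \<guillemotleft>v : P \<rightarrow> X\<guillemotright> \<and> f \<bullet> v = u"
      by (rule heart_cokernel[OF _ _ f]) (use X Y in auto)
    \<comment> \<open>The cokernel of an epimorphism vanishes.\<close>
    have z: "\<guillemotleft>Zero C Y Q : Y \<rightarrow> Q\<guillemotright>" using zero_arr arr_dom[OF q] arr_cod[OF q] by blast
    have "q = Zero C Y Q"
      using epi Q arr_hom[OF q] arr_hom[OF z] qf zero_comp[OF f arr_cod[OF q]]
      unfolding is_epi_def full_sub_simps by metis
    then have "q \<bullet> (g \<bullet> t_unit P) = Zero C P Q"
      using zero_comp[OF comp_arr[OF eta g] arr_cod[OF q]] by simp
    then obtain v where v: "\<guillemotleft>v : P \<rightarrow> X\<guillemotright>" "f \<bullet> v = g \<bullet> t_unit P"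
      using lift[OF whrt_perp[OF P] comp_arr[OF eta g]] by blast
    have XT: "X \<in> Tle" and YT: "Y \<in> Tle" using X Y by blast+
    obtain h where h: "\<guillemotleft>h : HO P \<rightarrow> X\<guillemotright>" "h \<bullet> t_unit P = v"
      by (rule unit_factor[OF PT XT v(1)])
    have "f \<bullet> h = g"
      by (rule unit_epic[OF PT YT comp_arr[OF h(1) f] g]) (use assoc[OF eta h(1) f] h(2) v(2) in simp)
    then show ?thesis using arr_hom[OF h(1)] by blast
  qed
  then show ?thesis using HP unfolding projective_def full_sub_simps by blast
qed

text \<open>
  Two maps to \<open>Z \<in> Tle\<close> that agree on \<open>H\<^sub>0 P\<close> agree on \<open>P\<close>; their difference factors through an object
  of \<open>Tge[1]\<close> and is zero.
\<close>

lemma H0_cover: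
  assumes M: "M \<in> Tle \<inter> Tge"
  shows "\<exists>P\<in>Wle \<inter> Wge. \<exists>f. is_epi (full_sub C (Tle \<inter> Tge)) (HO P) M f"
proof -
  obtain P R p n c where P: "P \<in> Wle \<inter> Wge" and R: "R \<in> Tge" and T: "(P, M, ShO C R, p, n, c) \<in> Tri C"
    using cover_triangle[OF M] by blast
  note p = tri_arr(1)[OF T]
  have PT: "P \<in> Tge" and MT: "M \<in> Tle" using P M wge_tge by blast+
  obtain f where f: "\<guillemotleft>f : HO P \<rightarrow> M\<guillemotright>" "f \<bullet> t_unit P = p"
    by (rule unit_factor[OF PT MT p])
  have "g = h"
    if Z: "Z \<in> Tle \<inter> Tge" and g': "g \<in> Hom C M Z" "h \<in> Hom C M Z" and gh: "g \<bullet> f = h \<bullet> f" for Z g h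
  proof -
    have g: "\<guillemotleft>g : M \<rightarrow> Z\<guillemotright>" and h: "\<guillemotleft>h : M \<rightarrow> Z\<guillemotright>"
      using g' M Z tle_obj by (auto simp: arr_def)
    have "g \<bullet> p = h \<bullet> p"
      using assoc[OF unit_arr[OF PT] f(1) g] assoc[OF unit_arr[OF PT] f(1) h] f(2) gh by simp
    then show ?thesis
      using tri_first_epic[OF T _ g h] sh_tge_perp_tle[OF R] Z by blast
  qed
  then have "is_epi (full_sub C (Tle \<inter> Tge)) (HO P) M f"
    using arr_hom[OF f(1)] unfolding is_epi_def full_sub_simps by blast
  then show ?thesis using P by blast
qed

sublocale lifted_projectives C "Wle \<inter> Wge" "Tle \<inter> Tge" "H0 C Tle Tge" t_unit
proof
  show "Wle \<inter> Wge \<subseteq> Obj C" "Tle \<inter> Tge \<subseteq> Obj C" using wle_obj tle_obj by blast+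
next
  fix P assume "P \<in> Wle \<inter> Wge"
  then show "HO P \<in> Tle \<inter> Tge" "\<guillemotleft>t_unit P : P \<rightarrow> HO P\<guillemotright>"
    using H0_heart unit_arr wge_tge by blast+
next
  fix P Q f assume PQ: "P \<in> Wle \<inter> Wge" "Q \<in> Wle \<inter> Wge" and f: "\<guillemotleft>f : P \<rightarrow> Q\<guillemotright>"
  show "\<guillemotleft>FM (H0 C Tle Tge) P Q f : HO P \<rightarrow> HO Q\<guillemotright>" by (rule H0_map(1)[OF f])
  show "FM (H0 C Tle Tge) P Q f \<bullet> t_unit P = t_unit Q \<bullet> f"
    by (rule unit_natural[OF _ _ f]) (use PQ wge_tge in blast)+
next
  fix P N u v
  assume "P \<in> Wle \<inter> Wge" "N \<in> Tle \<inter> Tge" "\<guillemotleft>u : HO P \<rightarrow> N\<guillemotright>" "\<guillemotleft>v : HO P \<rightarrow> N\<guillemotright>"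
    "u \<bullet> t_unit P = v \<bullet> t_unit P"
  then show "u = v" using unit_epic[of P N u v] wge_tge by blast
next
  fix P Q u assume PQ: "P \<in> Wle \<inter> Wge" "Q \<in> Wle \<inter> Wge" and u: "\<guillemotleft>u : Q \<rightarrow> HO P\<guillemotright>"
  have "P \<in> Tge" using PQ wge_tge by blast
  then show "\<exists>v. \<guillemotleft>v : Q \<rightarrow> P\<guillemotright> \<and> t_unit P \<bullet> v = u"
    by (rule unit_lift[OF _ whrt_perp[OF PQ(2)] u]) blast
next
  fix P Q u v assume PQ: "P \<in> Wle \<inter> Wge" "Q \<in> Wle \<inter> Wge"
    and u: "\<guillemotleft>u : Q \<rightarrow> P\<guillemotright>" "\<guillemotleft>v : Q \<rightarrow> P\<guillemotright>" "t_unit P \<bullet> u = t_unit P \<bullet> v"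
  have "P \<in> Tge" using PQ wge_tge by blast
  then show "u = v" by (rule unit_monic[OF _ whrt_perp[OF PQ(2)] u])
qed (use heart_idempotent_split H0_projective H0_cover in blast)+

text \<open>
  Both summands cut out in \<open>C\<close> by an idempotent of the heart are retracts of an object of the heart.
\<close>

lemma karoubian_w_heart:
  assumes "retraction_closed C D" "karoubian C"
  shows "karoubian (heart C Wle Wge)"
  unfolding karoubian_def
proof (intro ballI impI)
  fix B e assume "B \<in> Obj (heart C Wle Wge)" "e \<in> Hom (heart C Wle Wge) B B" "e \<bullet>\<^bsub>heart C Wle Wge\<^esub> e = e"
  then have B: "B \<in> Wle" "B \<in> Wge" "B \<in> Obj C" and "e \<in> Hom C B B" "e \<bullet> e = e"
    using wle_obj by (auto simp: heart_def)
  then obtain X Y i j p q where XY: "X \<in> Obj C" "Y \<in> Obj C"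
    and sum: "is_direct_sum C B X Y i j p q" and e: "e = i \<bullet> p"
    using assms(2) unfolding karoubian_def by blast
  have "retract C X B" "retract C Y B"
    using sum unfolding is_direct_sum_def retract_def by blast+
  moreover from this have "X \<in> D" "Y \<in> D"
    using assms(1) XY wle_D[OF B(1)] unfolding retraction_closed_def by blast+
  ultimately have "X \<in> Wle \<inter> Wge" "Y \<in> Wle \<inter> Wge"
    using wle_retract wge_retract B by blast+
  then show "\<exists>X\<in>Obj (heart C Wle Wge). \<exists>Y\<in>Obj (heart C Wle Wge). \<exists>i j p q.
      is_direct_sum (heart C Wle Wge) B X Y i j p q \<and> e = i \<bullet>\<^bsub>heart C Wle Wge\<^esub> p"
    using sum e unfolding heart_def is_direct_sum_def full_sub_simps full_sub_add_simps by blast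
qed

lemma karoubian_w_heart_equivalence:
  assumes "karoubian (heart C Wle Wge)"
  shows "is_equivalence (full_sub C (Wle \<inter> Wge)) (Proj (full_sub C (Tle \<inter> Tge))) (H0 C Tle Tge)"
proof (rule karoubian_equivalence)
  fix P e assume P: "P \<in> Wle \<inter> Wge" and e: "\<guillemotleft>e : P \<rightarrow> P\<guillemotright>" "e \<bullet> e = e"
  obtain X Y i j p q where "X \<in> Wle \<inter> Wge" "is_direct_sum (heart C Wle Wge) P X Y i j p q" "e = i \<bullet> p"
    using assms P e arr_hom[OF e(1)] unfolding karoubian_def heart_def full_sub_simps by blast
  then show "\<exists>Y\<in>Wle \<inter> Wge. \<exists>i p. \<guillemotleft>i : Y \<rightarrow> P\<guillemotright> \<and> \<guillemotleft>p : P \<rightarrow> Y\<guillemotright> \<and> p \<bullet> i = Idm C Y \<and> i \<bullet> p = e"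
    using P wle_obj unfolding arr_def heart_def is_direct_sum_def full_sub_simps by blast
qed

text \<open>
  The cover \<open>P \<rightarrow> Q\<close> is an epimorphism for maps to \<open>Tle\<close>, and here it is zero.
\<close>

lemma heart_zero:
  assumes Q: "Q \<in> Tle \<inter> Tge" and "\<And>P. P \<in> Wle \<inter> Wge \<Longrightarrow> P \<perp> Q"
  shows "is_zero_object C Q"
proof -
  obtain P R p n c where P: "P \<in> Wle \<inter> Wge" and R: "R \<in> Tge" and T: "(P, Q, ShO C R, p, n, c) \<in> Tri C"
    using cover_triangle[OF Q] by blast
  note p = tri_arr(1)[OF T]
  have ob: "P \<in> Obj C" "Q \<in> Obj C" using p arr_dom arr_cod by blast+
  have "p = Zero C P Q" using perpD assms(2)[OF P] p by blast
  then have "Idm C Q \<bullet> p = Zero C Q Q \<bullet> p"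
    using idl[OF p] zero_comp[OF p ob(2)] by simp
  then have "Idm C Q = Zero C Q Q"
    using tri_first_epic[OF T _ idm_arr[OF ob(2)] zero_arr[OF ob(2,2)]] sh_tge_perp_tle[OF R] Q by blast
  then show ?thesis using zero_object_iff ob by blast
qed

text \<open>
  Any map from the heart of \<open>w\<close> to \<open>H\<^sub>0 L\<close> lifts to \<open>L\<close> and is therefore zero, so \<open>H\<^sub>0 L\<close> is zero; as the unit is the
  reflection of \<open>L\<close> into \<open>Tle\<close>, no map from \<open>L\<close> to \<open>Tle\<close> survives.
\<close>

lemma tge_step:
  assumes L: "L \<in> Tge" and perp: "\<And>P. P \<in> Wge \<Longrightarrow> P \<perp> L"
  shows "L \<in> ShO C ` Tge"
proof -
  have "P \<perp> HO L" if P: "P \<in> Wle \<inter> Wge" for P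
    unfolding perp_def
  proof (intro allI impI)
    fix u assume u: "\<guillemotleft>u : P \<rightarrow> HO L\<guillemotright>"
    obtain v where v: "\<guillemotleft>v : P \<rightarrow> L\<guillemotright>" "t_unit L \<bullet> v = u"
      by (rule unit_lift[OF L whrt_perp[OF P] u])
    have "P \<perp> L" using perp P by blast
    then show "u = Zero C P (HO L)"
      using perpD[OF _ v(1)] v(2) comp_zero[OF unit_arr[OF L] arr_dom[OF u]] by simp
  qed
  then have zero: "is_zero_object C (HO L)" using heart_zero H0_heart[OF L] by blast
  have "L \<perp> Z" if Z: "Z \<in> Tle" for Z
    unfolding perp_def
  proof (intro allI impI)
    fix g assume g: "\<guillemotleft>g : L \<rightarrow> Z\<guillemotright>"
    obtain v where v: "\<guillemotleft>v : HO L \<rightarrow> Z\<guillemotright>" "v \<bullet> t_unit L = g"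
      by (rule unit_factor[OF L Z g])
    then show "g = Zero C L Z"
      using perpD[OF zero_object_perp'[OF zero tle_obj[OF Z]] v(1)] zero_comp[OF unit_arr[OF L] tle_obj[OF Z]] by simp
  qed
  then show ?thesis using sh_tge_iff tge_obj[OF L] by blast
qed

text \<open>
  Dually, the truncation of \<open>R\<close> into \<open>Tge\<close> lies in the heart of \<open>t\<close> and receives no map from the heart
  of \<open>w\<close>, because such a map stays non-zero in \<open>R\<close>.
\<close>

lemma tle_step:
  assumes R: "R \<in> Tle" and perp: "\<And>P. P \<in> Wle \<Longrightarrow> P \<perp> R"
  shows "ShO C R \<in> Tle"
proof -
  have Ro: "R \<in> Obj C" using tle_obj[OF R] .
  obtain Q S l r d where "t_dec C Tle Tge R = (Q, S, l, r, d)" by (metis prod.exhaust)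
  note D = t_dec_triangle[OF Ro this]
  have S: "S \<in> Tle" using tle_unshift D by blast
  have Qo: "Q \<in> Obj C" using tge_obj D by blast
  have "ShO C A \<perp> Q" if A: "A \<in> Tge" for A
    by (rule perp_fibre[OF D(4)]) (use A S R tge_shift sh_tge_perp_tle sh_obj tge_obj in blast)+
  then have Q: "Q \<in> Tle \<inter> Tge" using tle_iff Qo D by blast
  have "P \<perp> Q" if P: "P \<in> Wle \<inter> Wge" for P
    by (rule perp_fibre[OF D(4)]) (use P D perp wle_obj wge_shift wge_perp in blast)+
  then have "is_zero_object C Q" using heart_zero Q by blast
  then have "A \<perp> R" if "A \<in> Tge" for A
    using perp_middle[OF D(4), of A] zero_object_perp that tge_obj tge_perp D by blast
  then show ?thesis using sh_tle_iff Ro by blast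
qed

text \<open>
  The step from \<open>Tge\<close> to \<open>Tge[1]\<close> can be iterated: \<open>L[-1]\<close> is again in \<open>Tge\<close>, and \<open>Wge[1] \<subseteq> Wge\<close> makes
  \<open>Wge\<close> left orthogonal to it.
\<close>

lemma tge_everywhere:
  assumes "L \<in> Tge" and "\<And>P. P \<in> Wge \<Longrightarrow> P \<perp> L"
  shows "L \<in> shift_class C i Tge"
proof (rule mem_shift_class_if_unshifted)
  show "(ShO C ^^ n) L \<in> Tge" for n using assms(1) by (induction n) (auto intro: tge_shift)
  show "L \<in> (ShO C ^^ n) ` Tge" for n
    using assms
  proof (induction n arbitrary: L)
    case (Suc n)
    obtain L' where L': "L' \<in> Tge" "L = ShO C L'" using tge_step[OF Suc.prems] by blast
    have "P \<perp> L'" if "P \<in> Wge" for P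
      using Suc.prems(2)[OF wge_shift[OF that]] L' sh_perp_iff wge_obj[OF that] tge_obj by blast
    then have "L' \<in> (ShO C ^^ n) ` Tge" using Suc.IH L' by blast
    then show ?case using L'(2) by auto
  qed simp
qed (use assms tge_obj in auto)

lemma tle_everywhere:
  assumes R: "R \<in> Tle" and perp: "\<And>P. P \<in> Wle \<Longrightarrow> P \<perp> R"
  shows "R \<in> shift_class C i Tle"
proof (rule mem_shift_class_if_unshifted)
  have "(ShO C ^^ n) R \<in> Tle \<and> (\<forall>P\<in>Wle. P \<perp> (ShO C ^^ n) R)" for n
  proof (induction n)
    case (Suc n)
    then have X: "(ShO C ^^ n) R \<in> Tle" "\<And>P. P \<in> Wle \<Longrightarrow> P \<perp> (ShO C ^^ n) R" by blast+
    have "P \<perp> ShO C ((ShO C ^^ n) R)" if P: "P \<in> Wle" for P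
    proof -
      obtain P' where P': "P' \<in> Wle" "P = ShO C P'" by (rule wle_unshift[OF P])
      then show ?thesis using sh_perp_iff[OF wle_obj[OF P'(1)] tle_obj[OF X(1)]] X(2) by blast
    qed
    then show ?case using tle_step[OF X] by simp
  qed (use R perp in auto)
  then show "(ShO C ^^ n) R \<in> Tle" for n by blast
  show "R \<in> (ShO C ^^ n) ` Tle" for n
    using R
  proof (induction n arbitrary: R)
    case (Suc n)
    obtain R' where R': "R' \<in> Obj C" "R = ShO C R'" by (rule sh_surj[OF tle_obj[OF Suc.prems]])
    then have "R' \<in> Tle" using tle_unshift Suc.prems by blast
    then show ?case using Suc.IH R'(2) by auto
  qed simp
qed (use R tle_obj in auto)

text \<open>
  The part of \<open>Y\<close> in \<open>Tge\<close> inherits the orthogonality from \<open>Y\<close>, so by non-degeneracy it is zero and \<open>Y\<close>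
  agrees with its part in \<open>Tle[-1]\<close>.
\<close>

lemma minus_orthogonal:
  assumes "left_nondegenerate C Tge"
  shows "minus_orthogonal C Wge Tle"
  unfolding minus_orthogonal_def
proof (intro equalityI subsetI)
  fix Y assume "Y \<in> shift_class C (-1) Tle"
  then have "Y \<in> Obj C" "ShO C Y \<in> Tle" using mem_shift_class_minus[of Tle Y] tle_obj by blast+
  then show "Y \<in> right_orth C Wge"
    using wge_perp wge_obj hom_zero_iff_perp by (simp add: right_orth_def)
next
  fix Y assume "Y \<in> right_orth C Wge"
  then have Y: "Y \<in> Obj C" "\<And>P. P \<in> Wge \<Longrightarrow> P \<perp> Y"
    using wge_obj hom_zero_iff_perp by (auto simp: right_orth_def)
  obtain L R l r d where "t_dec C Tle Tge Y = (L, R, l, r, d)" by (metis prod.exhaust)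
  note D = t_dec_triangle[OF Y(1) this]
  have "P \<perp> L" if P: "P \<in> Wge" for P
    by (rule perp_fibre[OF D(4)]) (use P Y D wge_obj wge_shift wge_perp in blast)+
  then have "L \<in> (\<Inter>i. shift_class C i Tge)" using tge_everywhere D(1) by blast
  then have "is_zero_object C L" using assms unfolding left_nondegenerate_def by blast
  then have "A \<perp> Y" if "A \<in> Tge" for A
    using perp_middle[OF D(4), of A] zero_object_perp that tge_obj tge_perp D by blast
  then show "Y \<in> shift_class C (-1) Tle"
    using sh_tle_iff[OF Y(1)] mem_shift_class_minus[of Tle Y] tle_obj Y(1) by blast
qed

text \<open>
  The same argument for the other term of the decomposition of \<open>Y\<close> by \<open>Tge[1]\<close> and \<open>Tle\<close>.
\<close>

lemma plus_orthogonal: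
  assumes "right_nondegenerate C Tle"
  shows "plus_orthogonal C Wle Tge"
  unfolding plus_orthogonal_def shift_class_1
proof (intro equalityI subsetI)
  fix Y assume "Y \<in> ShO C ` Tge"
  then obtain A where A: "A \<in> Tge" "Y = ShO C A" by blast
  then have "Y \<in> Obj C" using tge_obj sh_obj by blast
  then show "Y \<in> right_orth C Wle"
    using wle_perp[OF _ A(1)] wle_obj hom_zero_iff_perp A(2) by (simp add: right_orth_def)
next
  fix Y assume "Y \<in> right_orth C Wle"
  then have Y: "Y \<in> Obj C" "\<And>P. P \<in> Wle \<Longrightarrow> P \<perp> Y"
    using wle_obj hom_zero_iff_perp by (auto simp: right_orth_def)
  obtain K Q k q h where D: "K \<in> ShO C ` Tge" "Q \<in> Tle" "(K, Y, Q, k, q, h) \<in> Tri C"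
    by (rule t_dec_shift_ex[OF Y(1)])
  have "P \<perp> Q" if P: "P \<in> Wle" for P
    by (rule perp_cone[OF D(3)]) (use P Y D sh_tge_tge wle_perp in blast)+
  then have "Q \<in> (\<Inter>i. shift_class C i Tle)" using tle_everywhere D(2) by blast
  then have "is_zero_object C Q" using assms unfolding right_nondegenerate_def by blast
  then have "Y \<perp> Z" if "Z \<in> Tle" for Z
    using middle_perp[OF D(3), of Z] zero_object_perp' that tle_obj sh_tge_iff D(1) by blast
  then show "Y \<in> ShO C ` Tge" using sh_tge_iff Y(1) by blast
qed

end

theorem proposition5p2p1:
  fixes C :: "('o, 'm) tricat" and D Wle Wge Tle Tge :: "'o set"
  assumes "triangulated_category C"
    and "triangulated_subcategory C D"
    and "weight_structure (full_tri_sub C D) Wle Wge"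
    and "t_structure C Tle Tge"
    and "orthogonal_structures C Wle Wge Tle Tge"
    and "Tle \<inter> Tge \<subseteq> D"
  shows "(enough_projectives (heart C Tle Tge) \<and>
      (\<forall>M \<in> Tle \<inter> Tge. \<exists>P \<in> Wle \<inter> Wge. \<exists>f.
         is_epi (heart C Tle Tge) (FO (H0 C Tle Tge) P) M f) \<and>
      (\<exists>F. is_equivalence (Kar (heart C Wle Wge)) (Proj (heart C Tle Tge)) F \<and>
         naturally_isomorphic (heart C Wle Wge) (Proj (heart C Tle Tge))
           (F \<circ>\<^sub>F kar_embedding (heart C Wle Wge)) (H0 C Tle Tge)))
    \<and> (karoubian (heart C Wle Wge) \<longrightarrow>
         equivalent_categories (heart C Wle Wge) (Proj (heart C Tle Tge)))
    \<and> (retraction_closed C D \<and> karoubian C \<longrightarrow>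
         karoubian (heart C Wle Wge) \<and>
         equivalent_categories (heart C Wle Wge) (Proj (heart C Tle Tge)))
    \<and> (left_nondegenerate C Tge \<longrightarrow>
         minus_orthogonal C Wge Tle \<and>
         (\<forall>(I :: 'i set) X P p. is_product C I X P p \<and> (\<forall>i \<in> I. X i \<in> Tle) \<longrightarrow> P \<in> Tle))
    \<and> (right_nondegenerate C Tle \<longrightarrow> plus_orthogonal C Wle Tge)"
proof -
  interpret triangulated_category C by (rule assms(1))
  interpret orthogonal_pair C Tle Tge D Wle Wge
    by unfold_locales (fact assms)+
  have eq: "equivalent_categories (heart C Wle Wge) (Proj (heart C Tle Tge))"
    if "karoubian (heart C Wle Wge)"
    using karoubian_w_heart_equivalence[OF that] unfolding equivalent_categories_def heart_def by blast
  show ?thesis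
  proof (intro conjI impI allI)
    show "enough_projectives (heart C Tle Tge)" unfolding heart_def by (rule enough)
    show "\<forall>M \<in> Tle \<inter> Tge. \<exists>P \<in> Wle \<inter> Wge. \<exists>f. is_epi (heart C Tle Tge) (HO P) M f"
      unfolding heart_def using H0_cover by blast
    show "\<exists>F. is_equivalence (Kar (heart C Wle Wge)) (Proj (heart C Tle Tge)) F \<and>
         naturally_isomorphic (heart C Wle Wge) (Proj (heart C Tle Tge))
           (F \<circ>\<^sub>F kar_embedding (heart C Wle Wge)) (H0 C Tle Tge)"
      unfolding heart_def by (rule kar_equivalence)
  qed (use eq karoubian_w_heart minus_orthogonal plus_orthogonal tle_product in blast)+
qed

end
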